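(* Let $p\ge0$. Then the point $(p+c(p),c(p))$ is the first nontrivial point in the intersection between $\Sigma_K$ and the line $\{(p,0)+t(1,1):t\in\mathbb R\}$; that is, $(p+c(p),c(p))$ belongs to $\Sigma_K$, does not lie on the trivial lines $\{\lambda_1\}\times\mathbb R$ and $\mathbb R\times\{\lambda_1\}$, and every point $(p+t,t)\in\Sigma_K$ $(t\in\mathbb R)$ not lying on these two trivial lines satisfies $t\ge c(p)$.
   Context: Let $s\in(0,1)$, $n>2s$, and let $\Omega\subset\mathbb R^n$ be a bounded domain with Lipschitz boundary. Let $K:\mathbb R^n\setminus\{0\}\to(0,\infty)$ satisfy: (i) $mK\in L^1(\mathbb R^n)$ with $m(x)=\min\{|x|^2,1\}$; (ii) there is $\lambda>0$ with $K(x)\ge\lambda|x|^{-(n+2s)}$ for all $x\ne0$; (iii) $K(x)=K(-x)$. Put $Q=\mathbb R^{2n}\setminus((\mathbb R^n\setminus\Omega)\times(\mathbb R^n\setminus\Omega))$. Let $X$ be the space of measurable $u:\mathbb R^n\to\mathbb R$ with $u|_\Omega\in L^2(\Omega)$ and $(u(x)-u(y))\sqrt{K(x-y)}\in L^2(Q)$, and let $X_0=\{u\in X: u=0 \text{ a.e. in }\mathbb R^n\setminus\Omega\}$, a Hilbert space with norm $\|u\|_{X_0}=\left(\int_Q|u(x)-u(y)|^2K(x-y)\,dx\,dy\right)^{1/2}$. Write $u^\pm=\max(\pm u,0)$. The Fučík spectrum $\Sigma_K$ is the set of $(\alpha,\beta)\in\mathbb R^2$ for which the problem $-\mathcal L_Ku=\alpha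 u^+-\beta u^-$ in $\Omega$, $u=0$ in $\mathbb R^n\setminus\Omega$, has a nontrivial weak solution, where $\mathcal L_Ku(x)=\frac12\int_{\mathbb R^n}(u(x+y)+u(x-y)-2u(x))K(y)\,dy$. Here $u\in X_0$ is a weak solution if for all $v\in X_0$: $\int_Q(u(x)-u(y))(v(x)-v(y))K(x-y)\,dx\,dy=\alpha\int_\Omega u^+v\,dx-\beta\int_\Omega u^-v\,dx$. $\lambda_1=\inf\{\|u\|_{X_0}^2: u\in X_0,\ \int_\Omega u^2=1\}$ is the first eigenvalue; it is simple and its eigenfunctions have constant sign; $\phi_1$ denotes the associated nonnegative eigenfunction with $\int_\Omega\phi_1^2=1$. Let $\mathcal P=\{u\in X_0:\int_\Omega u^2\,dx=1\}$ with the topology of $X_0$, $J_p(u)=\|u\|_{X_0}^2-p\int_\Omega(u^+)^2\,dx$, $\Gamma=\{\gamma\in C([-1,1],\mathcal P):\gamma(-1)=-\phi_1,\ \gamma(1)=\phi_1\}$, and $c(p)=\inf_{\gamma\in\Gamma}\max_{u\in\gamma([-1,1])}J_p(u)$. *)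

theory Defs
  imports "HOL-Analysis.Analysis"
begin

text \<open>
  Elements of the function spaces are represented by functions; two functions that agree
  almost everywhere stand for the same element.  Measurability and integrals refer to Lebesgue
  measure, on \<open>\<real>\<^sup>2\<^sup>n\<close> rendered as the Euclidean space \<open>'a \<times> 'a\<close>.
\<close>

text \<open>
  Near each boundary point, the set is the part of a ball strictly above the graph of a Lipschitz
  function over the hyperplane orthogonal to some unit vector \<open>e\<close>; the orthogonal projection of
  \<open>x\<close> onto that hyperplane is \<open>x - (x \<bullet> e) *\<^sub>R e\<close>.
\<close>

definition lipschitz_boundary :: "'a::euclidean_space set \<Rightarrow> bool" where
  "lipschitz_boundary \<Omega> \<longleftrightarrow>
     (\<forall>x0\<in>frontier \<Omega>. \<exists>r>0. \<exists>e. \<exists>g :: 'a \<Rightarrow> real. \<exists>C.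
        norm e = 1 \<and> C-lipschitz_on {y. y \<bullet> e = 0} g \<and>
        \<Omega> \<inter> ball x0 r = {x \<in> ball x0 r. g (x - (x \<bullet> e) *\<^sub>R e) < x \<bullet> e})"

definition bounded_lipschitz_domain :: "'a::euclidean_space set \<Rightarrow> bool" where
  "bounded_lipschitz_domain \<Omega> \<longleftrightarrow>
     open \<Omega> \<and> connected \<Omega> \<and> \<Omega> \<noteq> {} \<and> bounded \<Omega> \<and> lipschitz_boundary \<Omega>"

text \<open>
  The kernel lives on the complement of the origin; its value at \<open>0\<close> is unconstrained and affects
  none of the integrals below.
\<close>

definition admissible_kernel :: "real \<Rightarrow> ('a::euclidean_space \<Rightarrow> real) \<Rightarrow> bool" where
  "admissible_kernel s K \<longleftrightarrow>
     (\<forall>x. x \<noteq> 0 \<longrightarrow> 0 < K x) \<and>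
     integrable lebesgue (\<lambda>x. min ((norm x)\<^sup>2) 1 * K x) \<and>
     (\<exists>l>0. \<forall>x. x \<noteq> 0 \<longrightarrow> K x \<ge> l * norm x powr (- (real DIM('a) + 2 * s))) \<and>
     (\<forall>x. x \<noteq> 0 \<longrightarrow> K (- x) = K x)"

definition Q_set :: "'a set \<Rightarrow> ('a \<times> 'a) set" where
  "Q_set \<Omega> = UNIV - ((UNIV - \<Omega>) \<times> (UNIV - \<Omega>))"

definition X_space :: "('a::euclidean_space \<Rightarrow> real) \<Rightarrow> 'a set \<Rightarrow> ('a \<Rightarrow> real) set" where
  "X_space K \<Omega> =
     {u. u \<in> borel_measurable lebesgue \<and>
         set_integrable lebesgue \<Omega> (\<lambda>x. (u x)\<^sup>2) \<and>
         set_integrable lebesgue (Q_set \<Omega>) (\<lambda>(x, y). ((u x - u y) * sqrt (K (x - y)))\<^sup>2)}"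

definition X0_space :: "('a::euclidean_space \<Rightarrow> real) \<Rightarrow> 'a set \<Rightarrow> ('a \<Rightarrow> real) set" where
  "X0_space K \<Omega> = {u \<in> X_space K \<Omega>. AE x in lebesgue. x \<notin> \<Omega> \<longrightarrow> u x = 0}"

definition X0_norm :: "('a::euclidean_space \<Rightarrow> real) \<Rightarrow> 'a set \<Rightarrow> ('a \<Rightarrow> real) \<Rightarrow> real" where
  "X0_norm K \<Omega> u =
     sqrt (set_lebesgue_integral lebesgue (Q_set \<Omega>) (\<lambda>(x, y). \<bar>u x - u y\<bar>\<^sup>2 * K (x - y)))"

definition X0_form ::
  "('a::euclidean_space \<Rightarrow> real) \<Rightarrow> 'a set \<Rightarrow> ('a \<Rightarrow> real) \<Rightarrow> ('a \<Rightarrow> real) \<Rightarrow> real" where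
  "X0_form K \<Omega> u v =
     set_lebesgue_integral lebesgue (Q_set \<Omega>) (\<lambda>(x, y). (u x - u y) * (v x - v y) * K (x - y))"

definition pos_part :: "('a \<Rightarrow> real) \<Rightarrow> 'a \<Rightarrow> real" where
  "pos_part u x = max (u x) 0"

definition neg_part :: "('a \<Rightarrow> real) \<Rightarrow> 'a \<Rightarrow> real" where
  "neg_part u x = max (- u x) 0"

text \<open>
  Weak form of the problem \<open>- L\<^sub>K u = \<alpha> u\<^sup>+ - \<beta> u\<^sup>-\<close> in \<open>\<Omega>\<close>, \<open>u = 0\<close> outside \<open>\<Omega>\<close>, normalised without
  a factor \<open>1/2\<close> in front of the form, so that \<open>X0_form K \<Omega> u u\<close> is the square of \<open>X0_norm K \<Omega> u\<close>.
\<close>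

definition weak_solution ::
  "('a::euclidean_space \<Rightarrow> real) \<Rightarrow> 'a set \<Rightarrow> real \<Rightarrow> real \<Rightarrow> ('a \<Rightarrow> real) \<Rightarrow> bool" where
  "weak_solution K \<Omega> \<alpha> \<beta> u \<longleftrightarrow>
     u \<in> X0_space K \<Omega> \<and>
     (\<forall>v\<in>X0_space K \<Omega>.
        X0_form K \<Omega> u v =
          \<alpha> * (LINT x:\<Omega>|lebesgue. pos_part u x * v x) -
          \<beta> * (LINT x:\<Omega>|lebesgue. neg_part u x * v x))"

definition fucik_spectrum :: "('a::euclidean_space \<Rightarrow> real) \<Rightarrow> 'a set \<Rightarrow> (real \<times> real) set" where
  "fucik_spectrum K \<Omega> =
     {(\<alpha>, \<beta>). \<exists>u. weak_solution K \<Omega> \<alpha> \<beta> u \<and> \<not> (AE x in lebesgue. u x = 0)}"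

definition unit_sphere :: "('a::euclidean_space \<Rightarrow> real) \<Rightarrow> 'a set \<Rightarrow> ('a \<Rightarrow> real) set" where
  "unit_sphere K \<Omega> = {u \<in> X0_space K \<Omega>. (LINT x:\<Omega>|lebesgue. (u x)\<^sup>2) = 1}"

definition lambda1 :: "('a::euclidean_space \<Rightarrow> real) \<Rightarrow> 'a set \<Rightarrow> real" where
  "lambda1 K \<Omega> = (INF u\<in>unit_sphere K \<Omega>. (X0_norm K \<Omega> u)\<^sup>2)"

definition first_eigenfunction ::
  "('a::euclidean_space \<Rightarrow> real) \<Rightarrow> 'a set \<Rightarrow> ('a \<Rightarrow> real) \<Rightarrow> bool" where
  "first_eigenfunction K \<Omega> \<phi> \<longleftrightarrow>
     \<phi> \<in> X0_space K \<Omega> \<and>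
     (\<forall>v\<in>X0_space K \<Omega>.
        X0_form K \<Omega> \<phi> v = lambda1 K \<Omega> * (LINT x:\<Omega>|lebesgue. \<phi> x * v x)) \<and>
     (AE x in lebesgue. 0 \<le> \<phi> x) \<and>
     (LINT x:\<Omega>|lebesgue. (\<phi> x)\<^sup>2) = 1"

definition J_fun ::
  "('a::euclidean_space \<Rightarrow> real) \<Rightarrow> 'a set \<Rightarrow> real \<Rightarrow> ('a \<Rightarrow> real) \<Rightarrow> real" where
  "J_fun K \<Omega> p u = (X0_norm K \<Omega> u)\<^sup>2 - p * (LINT x:\<Omega>|lebesgue. (pos_part u x)\<^sup>2)"

text \<open>
  Continuity of a path is continuity for the distance \<open>X0_norm K \<Omega> (u - v)\<close>.
  The endpoint conditions are equalities in the function space, hence almost everywhere.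
\<close>

definition sphere_paths ::
  "('a::euclidean_space \<Rightarrow> real) \<Rightarrow> 'a set \<Rightarrow> ('a \<Rightarrow> real) \<Rightarrow> (real \<Rightarrow> 'a \<Rightarrow> real) set" where
  "sphere_paths K \<Omega> \<phi> =
     {\<gamma>. (\<forall>t\<in>{-1..1}. \<gamma> t \<in> unit_sphere K \<Omega>) \<and>
         (\<forall>t\<in>{-1..1}.
            ((\<lambda>r. X0_norm K \<Omega> (\<lambda>x. \<gamma> r x - \<gamma> t x)) \<longlongrightarrow> 0) (at t within {-1..1})) \<and>
         (AE x in lebesgue. \<gamma> (-1) x = - \<phi> x) \<and>
         (AE x in lebesgue. \<gamma> 1 x = \<phi> x)}"

text \<open>
  The inner supremum is a maximum: \<open>J_fun K \<Omega> p\<close> is continuous along each path and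
  \<open>{-1..1}\<close> is compact.
\<close>

definition minimax_level ::
  "('a::euclidean_space \<Rightarrow> real) \<Rightarrow> 'a set \<Rightarrow> ('a \<Rightarrow> real) \<Rightarrow> real \<Rightarrow> real" where
  "minimax_level K \<Omega> \<phi> p =
     (INF \<gamma>\<in>sphere_paths K \<Omega> \<phi>. SUP t\<in>{-1..1}. J_fun K \<Omega> p (\<gamma> t))"

definition trivial_lines :: "('a::euclidean_space \<Rightarrow> real) \<Rightarrow> 'a set \<Rightarrow> (real \<times> real) set" where
  "trivial_lines K \<Omega> = {lambda1 K \<Omega>} \<times> UNIV \<union> UNIV \<times> {lambda1 K \<Omega>}"

end

theory Submission
  imports Defs "HOL-Library.Diagonal_Subsequence"
begin

text \<open>
  Write \<open>a\<close> for the energy form, \<open>b u v\<close> for the integral of \<open>u v\<close> over \<open>\<Omega>\<close>, \<open>l\<close> for the first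
  eigenvalue, \<open>\<phi>\<close> for its nonnegative eigenfunction, and
  \<open>J\<^sub>t u = a u u - p b u\<^sup>+ u\<^sup>+ - t b u u\<close>.  This functional is homogeneous of degree two, so a path on
  the sphere on which \<open>J\<^sub>0\<close> is at most \<open>t\<close> is the normalisation of a path inside the
  cone \<open>J\<^sub>t \<le> 0\<close>; all paths below are first built in that cone (\<open>level_le\<close>).  For fixed \<open>t\<close>, the points
  \<open>(p + t, t)\<close> of the spectrum are given by the fixed points of the operator \<open>S\<close> defined by
  \<open>a (S u) v = p b u\<^sup>+ v + t b u v\<close>.

  The part of \<open>J\<^sub>t\<close> that is subtracted is convex, hence (\<open>J_convex_step\<close>)
  \<open>J\<^sub>t (u + h) \<le> J\<^sub>t u + 2 a (u - S u) h + a h h - t b h h\<close>.  Two choices of \<open>h\<close> decide the theorem.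

  With \<open>h = S u - u\<close>, applying \<open>S\<close> lowers \<open>J\<^sub>t\<close> by at least \<open>a (u - S u) (u - S u)\<close>.  Let \<open>c\<close> be the
  minimax level and suppose that there is no nontrivial fixed point for \<open>t = c\<close>.  As bounded sets of
  finite energy are relatively compact for \<open>b\<close>, there is then a \<open>\<delta> > 0\<close> such that
  \<open>a (u - S u) (u - S u) \<ge> \<delta> a u u\<close> for all \<open>u\<close> (\<open>residual_bound\<close>).  So one application of \<open>S\<close> to
  a path whose maximum is close to \<open>c\<close> gives, after normalisation, a path whose maximum is below
  \<open>c\<close>.  Its endpoints are again \<open>- \<phi>\<close> and \<open>\<phi>\<close>, because \<open>S\<close> maps each of the two to a positive multiple
  of itself.  This contradicts the choice of \<open>c\<close>, and \<open>(p + c, c)\<close> lies in the spectrum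
  (\<open>level_solution\<close>).

  With \<open>u\<close> a nontrivial fixed point off the trivial lines and \<open>h = r \<phi>\<close>, the inequality gives
  \<open>J\<^sub>t (u + r \<phi>) \<le> r\<^sup>2 (l - t)\<close>.  Testing with \<open>u\<^sup>-\<close> and with \<open>\<phi>\<close> shows \<open>l \<le> t\<close>, so the path
  \<open>(1 - \<bar>r\<bar>) u + r \<phi>\<close> stays in the cone and \<open>c \<le> t\<close> (\<open>level_le_solution\<close>).

  It remains to see that \<open>l < c\<close> (\<open>lam_less_level\<close>), which also keeps \<open>(p + c, c)\<close> off the trivial
  lines.  Otherwise there are points \<open>u\<^sub>n\<close> of the sphere with \<open>b u\<^sub>n\<^sup>+ u\<^sub>n\<^sup>+ = 1/n\<close> and
  \<open>J\<^sub>0 u\<^sub>n \<le> l + 1/n\<^sup>2\<close>.  They converge to a minimiser of the Rayleigh quotient that is nonpositive, hence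
  negative almost everywhere in \<open>\<Omega>\<close>, while the normalised positive parts have bounded energy and
  converge to a nonzero nonnegative function supported where the limit is not negative: a
  contradiction.

  These arguments use only a few properties of \<open>a\<close>, \<open>b\<close> and the positive part, collected in the locale
  \<open>fucik_form\<close>.  The analytic content lies in two of them.  The compact embedding comes from
  averaging over small cubes: the singularity of the kernel makes the averages uniformly good
  approximations of functions of bounded energy.  The strong maximum principle is obtained by testing
  with \<open>(\<eta> - M U)\<^sup>+\<close> for large \<open>M\<close>, where \<open>\<eta>\<close> is the distance to the complement of \<open>\<Omega>\<close>.
\<close>

section \<open>Semi-inner products on spaces of functions\<close>

text \<open>
  Functions that agree almost everywhere stand for the same element, so on functions the form
  is only semidefinite.
\<close>

locale semi_inner =
  fixes V :: "('a \<Rightarrow> real) set" and a :: "('a \<Rightarrow> real) \<Rightarrow> ('a \<Rightarrow> real) \<Rightarrow> real"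
  assumes lin_closed: "\<And>u v c d. u \<in> V \<Longrightarrow> v \<in> V \<Longrightarrow> (\<lambda>x. c * u x + d * v x) \<in> V"
    and lin: "\<And>u v w c d. u \<in> V \<Longrightarrow> v \<in> V \<Longrightarrow> w \<in> V \<Longrightarrow>
                a (\<lambda>x. c * u x + d * v x) w = c * a u w + d * a v w"
    and sym: "\<And>u v. u \<in> V \<Longrightarrow> v \<in> V \<Longrightarrow> a u v = a v u"
    and nonneg: "\<And>u. u \<in> V \<Longrightarrow> 0 \<le> a u u"
begin

abbreviation sqdist :: "('a \<Rightarrow> real) \<Rightarrow> ('a \<Rightarrow> real) \<Rightarrow> real" where
  "sqdist u v \<equiv> a (\<lambda>x. u x - v x) (\<lambda>x. u x - v x)"

lemma closed [simp]:
  assumes "u \<in> V"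
  shows "v \<in> V \<Longrightarrow> (\<lambda>x. u x + v x) \<in> V" "v \<in> V \<Longrightarrow> (\<lambda>x. u x - v x) \<in> V"
    "(\<lambda>x. c * u x) \<in> V" "(\<lambda>x. - u x) \<in> V" "(\<lambda>x. u x / c) \<in> V"
  using lin_closed[OF assms, of v 1 1] lin_closed[OF assms, of v 1 "-1"]
    lin_closed[OF assms assms, of c 0] lin_closed[OF assms assms, of "-1" 0]
    lin_closed[OF assms assms, of "inverse c" 0]
  by (simp_all add: divide_inverse mult.commute)

lemma linear_left [simp]:
  assumes "u \<in> V" "w \<in> V"
  shows "v \<in> V \<Longrightarrow> a (\<lambda>x. u x + v x) w = a u w + a v w"
    "v \<in> V \<Longrightarrow> a (\<lambda>x. u x - v x) w = a u w - a v w"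
    "a (\<lambda>x. c * u x) w = c * a u w" "a (\<lambda>x. - u x) w = - a u w"
    "a (\<lambda>x. u x / c) w = a u w / c"
  using lin[OF assms(1) _ assms(2), of v 1 1] lin[OF assms(1) _ assms(2), of v 1 "-1"]
    lin[OF assms(1) assms(1) assms(2), of c 0] lin[OF assms(1) assms(1) assms(2), of "-1" 0]
    lin[OF assms(1) assms(1) assms(2), of "inverse c" 0]
  by (simp_all add: divide_inverse mult.commute)

lemma linear_right [simp]:
  assumes "u \<in> V" "w \<in> V"
  shows "v \<in> V \<Longrightarrow> a w (\<lambda>x. u x + v x) = a w u + a w v"
    "v \<in> V \<Longrightarrow> a w (\<lambda>x. u x - v x) = a w u - a w v"
    "a w (\<lambda>x. c * u x) = c * a w u" "a w (\<lambda>x. - u x) = - a w u"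
    "a w (\<lambda>x. u x / c) = a w u / c"
  using assms by (simp_all add: sym[of w])

lemma Cauchy_Schwarz_sq:
  assumes "u \<in> V" "v \<in> V" shows "(a u v)\<^sup>2 \<le> a u u * a v v"
proof -
  have q: "0 \<le> a u u + 2 * s * a u v + s\<^sup>2 * a v v" for s
    using nonneg[of "\<lambda>x. u x + s * v x"] assms
    by (simp add: sym[of v u] power2_eq_square algebra_simps)
  show ?thesis
  proof (cases "a v v = 0")
    case True
    have "a u v = 0"
    proof (rule ccontr)
      assume ne: "a u v \<noteq> 0"
      \<comment> \<open>a slope at which the affine lower bound takes the value \<open>- 1\<close>\<close>
      show False using q[of "- (a u u + 1) / (2 * a u v)"] ne True by (simp add: field_simps)
    qed
    then show ?thesis using nonneg assms by simp
  next
    case False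
    then have pos: "a v v > 0" using nonneg[OF assms(2)] by simp
    show ?thesis using q[of "- (a u v / a v v)"] pos
      by (simp add: field_simps power2_eq_square)
  qed
qed

lemma Cauchy_Schwarz:
  assumes "u \<in> V" "v \<in> V" shows "\<bar>a u v\<bar> \<le> sqrt (a u u) * sqrt (a v v)"
  using real_sqrt_le_mono[OF Cauchy_Schwarz_sq[OF assms]] by (simp add: real_sqrt_mult)

lemma triangle:
  assumes "u \<in> V" "v \<in> V"
  shows "sqrt (a (\<lambda>x. u x + v x) (\<lambda>x. u x + v x)) \<le> sqrt (a u u) + sqrt (a v v)"
proof (rule real_le_lsqrt)
  show "0 \<le> sqrt (a u u) + sqrt (a v v)" using nonneg assms by simp
  have "a (\<lambda>x. u x + v x) (\<lambda>x. u x + v x) = a u u + 2 * a u v + a v v"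
    using assms by (simp add: sym[of v u])
  also have "\<dots> \<le> (sqrt (a u u) + sqrt (a v v))\<^sup>2"
    using Cauchy_Schwarz[OF assms] nonneg assms by (simp add: power2_sum)
  finally show "a (\<lambda>x. u x + v x) (\<lambda>x. u x + v x) \<le> (sqrt (a u u) + sqrt (a v v))\<^sup>2" .
qed

lemma norm_sq_add_le:
  assumes "u \<in> V" "v \<in> V"
  shows "a (\<lambda>x. u x + v x) (\<lambda>x. u x + v x) \<le> 2 * a u u + 2 * a v v"
  using nonneg[of "\<lambda>x. u x - v x"] assms by (simp add: sym[of v u])

lemma norm_diff_commute:
  assumes "u \<in> V" "v \<in> V"
  shows "sqdist u v = sqdist v u"
  using assms by simp

text \<open>
  In particular, functions at distance zero have the same norm.
\<close>

lemma reverse_triangle: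
  assumes "u \<in> V" "v \<in> V"
  shows "\<bar>sqrt (a u u) - sqrt (a v v)\<bar> \<le> sqrt (sqdist u v)"
  using triangle[of "\<lambda>x. u x - v x" v] triangle[of "\<lambda>x. v x - u x" u] assms
    norm_diff_commute[OF assms] by (simp del: linear_left linear_right)

lemma tendsto_inner:
  assumes "\<forall>\<^sub>F n in F. u n \<in> V" "w \<in> V" "v \<in> V"
    and "((\<lambda>n. sqdist (u n) w) \<longlongrightarrow> 0) F"
  shows "((\<lambda>n. a (u n) v) \<longlongrightarrow> a w v) F"
proof -
  have "((\<lambda>n. a (u n) v - a w v) \<longlongrightarrow> 0) F"
  proof (rule Lim_null_comparison)
    show "\<forall>\<^sub>F n in F. norm (a (u n) v - a w v)
            \<le> sqrt (sqdist (u n) w) * sqrt (a v v)"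
      using assms(1)
    proof eventually_elim
      case (elim n)
      then show ?case using Cauchy_Schwarz[of "\<lambda>x. u n x - w x" v] assms(2,3) by (simp del: linear_right)
    qed
    show "((\<lambda>n. sqrt (sqdist (u n) w) * sqrt (a v v)) \<longlongrightarrow> 0) F"
      using tendsto_mult_left_zero[OF tendsto_real_sqrt[OF assms(4), unfolded real_sqrt_zero]] .
  qed
  then show ?thesis by (simp add: LIM_zero_iff)
qed

lemma tendsto_norm_sq:
  assumes "\<forall>\<^sub>F n in F. u n \<in> V" "w \<in> V"
    and "((\<lambda>n. sqdist (u n) w) \<longlongrightarrow> 0) F"
  shows "((\<lambda>n. a (u n) (u n)) \<longlongrightarrow> a w w) F"
proof -
  have "((\<lambda>n. sqdist (u n) w + 2 * a (u n) w - a w w)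
          \<longlongrightarrow> 0 + 2 * a w w - a w w) F"
    by (intro tendsto_intros assms(3) tendsto_inner assms)
  moreover have "\<forall>\<^sub>F n in F.
      sqdist (u n) w + 2 * a (u n) w - a w w = a (u n) (u n)"
    using assms(1)
  proof eventually_elim
    case (elim n)
    then show ?case using assms(2) by (simp add: sym[of w "u n"])
  qed
  ultimately show ?thesis by (simp add: filterlim_cong)
qed

lemma tendsto_sqdist_zero:
  assumes "\<forall>\<^sub>F n in F. u n \<in> V" "w \<in> V"
    and "(g \<longlongrightarrow> 0) F" "\<forall>\<^sub>F n in F. sqdist (u n) w \<le> g n"
  shows "((\<lambda>n. sqdist (u n) w) \<longlongrightarrow> 0) F"
proof (rule Lim_null_comparison[OF _ assms(3)])
  show "\<forall>\<^sub>F n in F. norm (sqdist (u n) w) \<le> g n"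
    using assms(1,4)
  proof eventually_elim
    case (elim n)
    then show ?case using nonneg[OF closed(2)[OF elim(1) assms(2)]] by (simp only: real_norm_def abs_of_nonneg)
  qed
qed

end

section \<open>A compact pair of forms with a positive part\<close>

text \<open>
  The form \<open>a\<close> plays the energy, \<open>b\<close> the inner product of \<open>L\<^sup>2(\<Omega>)\<close>, and \<open>lam\<close> the first eigenvalue.
  An element \<open>u\<close> counts as zero when \<open>b u u = 0\<close>.  The compactness assumption includes that the
  limit has finite energy with the same bound, which makes \<open>a\<close> lower semicontinuous.
\<close>

locale fucik_form = A: semi_inner V a + B: semi_inner V b
  for V :: "('a \<Rightarrow> real) set" and a b +
  fixes lam :: real and \<phi> :: "'a \<Rightarrow> real"
  assumes pos_part_closed [simp]: "\<And>u. u \<in> V \<Longrightarrow> pos_part u \<in> V"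
    and lam_pos: "0 < lam"
    and poincare: "\<And>u. u \<in> V \<Longrightarrow> lam * b u u \<le> a u u"
    and null: "\<And>u. u \<in> V \<Longrightarrow> b u u = 0 \<Longrightarrow> a u u = 0"
    and compact_embedding:
      "\<And>u C. (\<And>n::nat. u n \<in> V) \<Longrightarrow> (\<And>n. a (u n) (u n) \<le> C) \<Longrightarrow>
         \<exists>r w. strict_mono (r :: nat \<Rightarrow> nat) \<and> w \<in> V \<and> a w w \<le> C \<and>
           (\<lambda>n. B.sqdist (u (r n)) w) \<longlonglongrightarrow> 0"
    and a_pos_part: "\<And>u. u \<in> V \<Longrightarrow> a (pos_part u) (pos_part u) \<le> a (pos_part u) u"
    and b_pos_part: "\<And>u. u \<in> V \<Longrightarrow> b (pos_part u) u = b (pos_part u) (pos_part u)"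
    and b_pos_part_Lipschitz: "\<And>u v. u \<in> V \<Longrightarrow> v \<in> V \<Longrightarrow>
      B.sqdist (pos_part u) (pos_part v) \<le> B.sqdist u v"
    and b_pos_part_convex: "\<And>u h. u \<in> V \<Longrightarrow> h \<in> V \<Longrightarrow>
      b (pos_part u) (pos_part u) + 2 * b (pos_part u) h
        \<le> b (pos_part (\<lambda>x. u x + h x)) (pos_part (\<lambda>x. u x + h x))"
    and \<phi>_in [simp]: "\<phi> \<in> V"
    and \<phi>_eigen: "\<And>v. v \<in> V \<Longrightarrow> a \<phi> v = lam * b \<phi> v"
    and \<phi>_norm: "b \<phi> \<phi> = 1"
    and \<phi>_nonneg: "B.sqdist (pos_part \<phi>) \<phi> = 0"
    and strong_maximum: "\<And>u w. u \<in> V \<Longrightarrow> (\<And>v. v \<in> V \<Longrightarrow> a u v = lam * b u v) \<Longrightarrow>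
      b (pos_part u) (pos_part u) = 0 \<Longrightarrow> b u u \<noteq> 0 \<Longrightarrow> w \<in> V \<Longrightarrow> 0 \<le> b u (pos_part w) \<Longrightarrow>
      b (pos_part w) (pos_part w) = 0"
    and dim_ge_2: "\<exists>w\<in>V. \<forall>c. 0 < b (\<lambda>x. w x - c * \<phi> x) (\<lambda>x. w x - c * \<phi> x)"
begin

lemma b_null_left: "u \<in> V \<Longrightarrow> v \<in> V \<Longrightarrow> b u u = 0 \<Longrightarrow> b u v = 0"
  using B.Cauchy_Schwarz[of u v] by simp

lemma a_null_left: "u \<in> V \<Longrightarrow> v \<in> V \<Longrightarrow> b u u = 0 \<Longrightarrow> a u v = 0"
  using A.Cauchy_Schwarz[of u v] null[of u] by simp

lemma b_pos_part_le: "u \<in> V \<Longrightarrow> b (pos_part u) (pos_part u) \<le> b u u"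
  using b_pos_part_Lipschitz[of u "\<lambda>x. 0 * u x"] A.closed(3)[of u 0]
  by (simp add: pos_part_def[abs_def])

lemma b_le_a: "u \<in> V \<Longrightarrow> b u u \<le> a u u / lam"
  using poincare[of u] lam_pos by (simp add: field_simps)

lemma energy_eigenfunction: "a \<phi> \<phi> = lam" using \<phi>_eigen[of \<phi>] \<phi>_norm by simp

text \<open>
  A limit in \<open>b\<close> of a bounded sequence coincides up to a null element with the limit that compactness
  provides along a subsequence, and that limit inherits the energy bound.
\<close>

lemma a_lower_semicontinuous:
  assumes u: "\<And>n. u n \<in> V" and w: "w \<in> V"
    and lim: "(\<lambda>n. B.sqdist (u n) w) \<longlonglongrightarrow> 0"
    and bd: "\<forall>\<^sub>F n in sequentially. a (u n) (u n) \<le> C"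
  shows "a w w \<le> C"
proof -
  obtain N where N: "\<And>n. n \<ge> N \<Longrightarrow> a (u n) (u n) \<le> C"
    using bd by (auto simp: eventually_sequentially)
  obtain r w' where r: "strict_mono r" and w': "w' \<in> V" "a w' w' \<le> C"
    and lim': "(\<lambda>n. B.sqdist (u (r n + N)) w') \<longlonglongrightarrow> 0"
    using compact_embedding[of "\<lambda>n. u (n + N)" C] u N by auto
  let ?q = "\<lambda>n. r n + N"
  have q: "strict_mono ?q" using r by (auto simp: strict_mono_def)
  have lim2: "(\<lambda>n. B.sqdist (u (?q n)) w) \<longlonglongrightarrow> 0"
    using LIMSEQ_subseq_LIMSEQ[OF lim q] by (simp only: o_def)
  have eq: "b w v = b w' v" if "v \<in> V" for v
  proof (rule LIMSEQ_unique)
    show "(\<lambda>n. b (u (?q n)) v) \<longlonglongrightarrow> b w v" using u w that lim2 by (intro B.tendsto_inner) auto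
    show "(\<lambda>n. b (u (?q n)) v) \<longlonglongrightarrow> b w' v" using u w' that lim' by (intro B.tendsto_inner) auto
  qed
  have z: "B.sqdist w w' = 0"
    using w w' eq[of w] eq[of w'] by (simp add: B.sym[of w' w])
  have "a w w = a w' w'"
    using A.reverse_triangle[OF w w'(1)] null[OF _ z] w w'
    by (simp del: A.linear_left A.linear_right)
  then show ?thesis using w' by simp
qed

text \<open>
  The solution minimises \<open>a v v - 2 b g v\<close>.  A minimising sequence is bounded in \<open>a\<close>, so along a
  subsequence it converges in \<open>b\<close>, for which the linear term is continuous, and lower semicontinuity
  of the quadratic term makes the limit a minimiser.
\<close>

lemma riesz:
  assumes g: "g \<in> V"
  shows "\<exists>z\<in>V. \<forall>v\<in>V. a z v = b g v"
proof -
  define F where "F v = a v v - 2 * b g v" for v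
  have bg: "\<bar>b g v\<bar> \<le> sqrt (b g g) / sqrt lam * sqrt (a v v)" if "v \<in> V" for v
  proof -
    have "\<bar>b g v\<bar> \<le> sqrt (b g g) * sqrt (b v v)" by (rule B.Cauchy_Schwarz[OF g that])
    also have "\<dots> \<le> sqrt (b g g) * sqrt (a v v / lam)"
      using b_le_a[OF that] B.nonneg[OF g] by (intro mult_left_mono) auto
    finally show ?thesis by (simp add: real_sqrt_divide)
  qed
  define D where "D = sqrt (b g g) / sqrt lam"
  have Flow: "a v v \<le> 2 * F v + 4 * D\<^sup>2" if "v \<in> V" for v
  proof -
    have "2 * \<bar>b g v\<bar> \<le> 2 * (D * sqrt (a v v))" using bg[OF that] by (simp add: D_def)
    moreover have "0 \<le> (sqrt (a v v) - 2 * D)\<^sup>2" by simp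
    ultimately show ?thesis using A.nonneg[OF that]
      unfolding F_def by (simp add: power2_diff power_mult_distrib mult.commute[of D])
  qed
  have bdd: "bdd_below (F ` V)"
  proof (rule bdd_belowI2)
    show "- 2 * D\<^sup>2 \<le> F v" if "v \<in> V" for v using Flow[OF that] A.nonneg[OF that] by simp
  qed
  define m where "m = Inf (F ` V)"
  have "\<exists>v\<in>V. F v < m + 1 / real (Suc n)" for n
    using cInf_lessD[of "F ` V" "m + 1 / real (Suc n)"] g unfolding m_def by auto
  then obtain v where v: "\<And>n. v n \<in> V" "\<And>n. F (v n) < m + 1 / real (Suc n)" by metis
  have "a (v n) (v n) \<le> 2 * (m + 1) + 4 * D\<^sup>2" for n
  proof -
    have "1 / real (Suc n) \<le> 1" by simp
    then show ?thesis using Flow[OF v(1)[of n]] v(2)[of n] by argo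
  qed
  then obtain r z where r: "strict_mono r" and z: "z \<in> V"
    and lim: "(\<lambda>n. B.sqdist (v (r n)) z) \<longlonglongrightarrow> 0"
    using compact_embedding[of v] v by blast
  have lb: "(\<lambda>n. b (v (r n)) g) \<longlonglongrightarrow> b z g"
    using v z g lim by (intro B.tendsto_inner) auto
  have up: "(\<lambda>n. m + 1 / real (Suc (r n)) + 2 * b (v (r n)) g) \<longlonglongrightarrow> m + 0 + 2 * b z g"
    by (intro tendsto_intros lb LIMSEQ_subseq_LIMSEQ[OF LIMSEQ_Suc[OF lim_1_over_n] r, unfolded o_def])
  have "a z z \<le> m + 2 * b z g + e" if e: "e > 0" for e
  proof (rule a_lower_semicontinuous[OF _ z lim])
    show "v (r n) \<in> V" for n using v by simp
    have "\<forall>\<^sub>F n in sequentially. m + 1 / real (Suc (r n)) + 2 * b (v (r n)) g < m + 2 * b z g + e"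
      using order_tendstoD(2)[OF up, of "m + 2 * b z g + e"] e by simp
    then show "\<forall>\<^sub>F n in sequentially. a (v (r n)) (v (r n)) \<le> m + 2 * b z g + e"
    proof eventually_elim
      case (elim n)
      then show ?case using v(2)[of "r n"] v(1)[of "r n"] g
        unfolding F_def by (simp add: B.sym[of g])
    qed
  qed
  then have "a z z \<le> m + 2 * b z g" by (rule field_le_epsilon)
  then have Fz: "F z \<le> F v" if "v \<in> V" for v
    using cInf_lower[OF imageI[OF that] bdd] g z unfolding m_def F_def
    by (simp add: B.sym[of g])
  have "a z v = b g v" if "v \<in> V" for v
  proof (rule ccontr)
    assume ne: "a z v \<noteq> b g v"
    define k where "k = a z v - b g v"
    have q: "0 \<le> 2 * s * k + s\<^sup>2 * a v v" for s
      using Fz[of "\<lambda>x. z x + s * v x"] z that g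
      unfolding F_def k_def by (simp add: A.sym[of v z] power2_eq_square algebra_simps)
    define s where "s = - k / (a v v + 1)"
    have p1: "a v v + 1 > 0" using A.nonneg[OF that] by simp
    have "2 * s * k + s\<^sup>2 * a v v = s\<^sup>2 * a v v - 2 * k\<^sup>2 / (a v v + 1)"
      by (simp add: s_def power2_eq_square)
    also have "s\<^sup>2 * a v v \<le> s\<^sup>2 * (a v v + 1)" by (simp add: algebra_simps)
    also have "s\<^sup>2 * (a v v + 1) = k\<^sup>2 / (a v v + 1)"
      using p1 by (simp add: s_def power2_eq_square)
    finally have "2 * s * k + s\<^sup>2 * a v v \<le> - (k\<^sup>2 / (a v v + 1))" by simp
    moreover have "k\<^sup>2 / (a v v + 1) > 0" using ne p1 by (simp add: k_def)
    ultimately show False using q[of s] by linarith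
  qed
  then show ?thesis using z by blast
qed

end

section \<open>Curves on the sphere and the minimax level\<close>

context fucik_form begin

definition J :: "real \<Rightarrow> ('a \<Rightarrow> real) \<Rightarrow> real" where
  "J p u = a u u - p * b (pos_part u) (pos_part u)"

definition curve :: "(real \<Rightarrow> 'a \<Rightarrow> real) \<Rightarrow> bool" where
  "curve \<zeta> \<longleftrightarrow> (\<forall>r\<in>{-1..1}. \<zeta> r \<in> V) \<and>
     (\<forall>r\<in>{-1..1}. ((\<lambda>q. A.sqdist (\<zeta> q) (\<zeta> r)) \<longlongrightarrow> 0)
        (at r within {-1..1}))"

definition paths :: "(real \<Rightarrow> 'a \<Rightarrow> real) set" where
  "paths = {\<gamma>. curve \<gamma> \<and> (\<forall>r\<in>{-1..1}. b (\<gamma> r) (\<gamma> r) = 1) \<and>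
     b (\<lambda>x. \<gamma> (-1) x + \<phi> x) (\<lambda>x. \<gamma> (-1) x + \<phi> x) = 0 \<and>
     B.sqdist (\<gamma> 1) \<phi> = 0}"

definition level :: "real \<Rightarrow> real" where
  "level p = (INF \<gamma>\<in>paths. SUP r\<in>{-1..1}. J p (\<gamma> r))"

text \<open>
  The graph of the operator whose nontrivial fixed points are the solutions of the Fucik problem with
  \<open>\<alpha> = p + t\<close> and \<open>\<beta> = t\<close>, since \<open>(p + t) u\<^sup>+ - t u\<^sup>- = p u\<^sup>+ + t u\<close>.  It is a relation because
  \<open>z\<close> is determined up to null elements only.
\<close>

definition resolves :: "real \<Rightarrow> real \<Rightarrow> ('a \<Rightarrow> real) \<Rightarrow> ('a \<Rightarrow> real) \<Rightarrow> bool" where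
  "resolves p t u z \<longleftrightarrow> u \<in> V \<and> z \<in> V \<and> (\<forall>v\<in>V. a z v = p * b (pos_part u) v + t * b u v)"

lemma curve_in: "curve \<zeta> \<Longrightarrow> r \<in> {-1..1} \<Longrightarrow> \<zeta> r \<in> V"
  by (simp add: curve_def)

lemma eventually_curve_in: "curve \<zeta> \<Longrightarrow> \<forall>\<^sub>F q in at r within {-1..1}. \<zeta> q \<in> V"
  by (auto simp: curve_def eventually_at_filter)

lemma curve_tendsto_a:
  assumes "curve \<zeta>" "r \<in> {-1..1}"
  shows "((\<lambda>q. A.sqdist (\<zeta> q) (\<zeta> r)) \<longlongrightarrow> 0) (at r within {-1..1})"
  using assms by (simp add: curve_def)

lemma curve_tendsto_b:
  assumes "curve \<zeta>" "r \<in> {-1..1}"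
  shows "((\<lambda>q. B.sqdist (\<zeta> q) (\<zeta> r)) \<longlongrightarrow> 0) (at r within {-1..1})"
proof (rule B.tendsto_sqdist_zero[OF eventually_curve_in[OF assms(1)] curve_in[OF assms]])
  show "((\<lambda>q. A.sqdist (\<zeta> q) (\<zeta> r) / lam) \<longlongrightarrow> 0) (at r within {-1..1})"
    using tendsto_divide[OF curve_tendsto_a[OF assms] tendsto_const[of lam]] lam_pos by simp
  show "\<forall>\<^sub>F q in at r within {-1..1}. B.sqdist (\<zeta> q) (\<zeta> r) \<le> A.sqdist (\<zeta> q) (\<zeta> r) / lam"
    using eventually_curve_in[OF assms(1)]
    by eventually_elim (rule b_le_a[OF A.closed(2)[OF _ curve_in[OF assms]]])
qed

lemma continuous_on_curve_a: "curve \<zeta> \<Longrightarrow> continuous_on {-1..1} (\<lambda>r. a (\<zeta> r) (\<zeta> r))"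
  unfolding continuous_on_def
  by (intro ballI A.tendsto_norm_sq curve_tendsto_a eventually_curve_in curve_in)

lemma continuous_on_curve_b: "curve \<zeta> \<Longrightarrow> continuous_on {-1..1} (\<lambda>r. b (\<zeta> r) (\<zeta> r))"
  unfolding continuous_on_def
  by (intro ballI B.tendsto_norm_sq curve_tendsto_b eventually_curve_in curve_in)

lemma tendsto_pos_part:
  assumes "\<forall>\<^sub>F n in F. u n \<in> V" "w \<in> V"
    and "((\<lambda>n. B.sqdist (u n) w) \<longlongrightarrow> 0) F"
  shows "((\<lambda>n. b (pos_part (u n)) (pos_part (u n))) \<longlongrightarrow> b (pos_part w) (pos_part w)) F"
proof (rule B.tendsto_norm_sq)
  show "\<forall>\<^sub>F n in F. pos_part (u n) \<in> V" using assms(1) by eventually_elim simp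
  show "pos_part w \<in> V" using assms by simp
  show "((\<lambda>n. B.sqdist (pos_part (u n)) (pos_part w)) \<longlongrightarrow> 0) F"
  proof (rule B.tendsto_sqdist_zero[OF _ pos_part_closed[OF assms(2)] assms(3)])
    show "\<forall>\<^sub>F n in F. pos_part (u n) \<in> V" using assms(1) by eventually_elim simp
    show "\<forall>\<^sub>F n in F. B.sqdist (pos_part (u n)) (pos_part w) \<le> B.sqdist (u n) w"
      using assms(1) by eventually_elim (rule b_pos_part_Lipschitz[OF _ assms(2)])
  qed
qed

lemma continuous_on_curve_pos_part:
  "curve \<zeta> \<Longrightarrow> continuous_on {-1..1} (\<lambda>r. b (pos_part (\<zeta> r)) (pos_part (\<zeta> r)))"
  unfolding continuous_on_def
  by (intro ballI tendsto_pos_part curve_tendsto_b eventually_curve_in curve_in)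

lemma bdd_above_J:
  assumes "curve \<zeta>" shows "bdd_above ((\<lambda>r. J p (\<zeta> r)) ` {-1..1})"
proof -
  have "continuous_on {-1..1} (\<lambda>r. J p (\<zeta> r))"
    unfolding J_def by (intro continuous_intros continuous_on_curve_a continuous_on_curve_pos_part assms)
  then have "compact ((\<lambda>r. J p (\<zeta> r)) ` {-1..1})" by (intro compact_continuous_image) auto
  then show ?thesis by (simp add: bounded_imp_bdd_above compact_imp_bounded)
qed

lemma J_ge: "u \<in> V \<Longrightarrow> 0 \<le> p \<Longrightarrow> a u u - p * b u u \<le> J p u"
  unfolding J_def using b_pos_part_le[of u] by (simp add: mult_left_mono)

text \<open>
  Without this bound and \<open>bdd_above_J\<close> the real infimum and supremum in \<open>level\<close> would be
  meaningless.
\<close>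

lemma bdd_below_sup_J:
  assumes "0 \<le> p" shows "bdd_below ((\<lambda>\<gamma>. SUP r\<in>{-1..1}. J p (\<gamma> r)) ` paths)"
proof (rule bdd_belowI2)
  fix \<gamma> assume g: "\<gamma> \<in> paths"
  then have c: "curve \<gamma>" and n: "b (\<gamma> 0) (\<gamma> 0) = 1" by (auto simp: paths_def)
  have "lam - p \<le> J p (\<gamma> 0)"
    using poincare[of "\<gamma> 0"] J_ge[of "\<gamma> 0" p] curve_in[OF c, of 0] n assms by simp
  also have "\<dots> \<le> (SUP r\<in>{-1..1}. J p (\<gamma> r))" by (intro cSUP_upper bdd_above_J c) simp
  finally show "lam - p \<le> (SUP r\<in>{-1..1}. J p (\<gamma> r))" .
qed

lemma pos_part_scale: "0 \<le> c \<Longrightarrow> pos_part (\<lambda>x. c * u x) = (\<lambda>x. c * pos_part u x)"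
  by (rule ext) (simp add: pos_part_def max_mult_distrib_left)

lemma pos_part_divide: "0 \<le> c \<Longrightarrow> pos_part (\<lambda>x. u x / c) = (\<lambda>x. pos_part u x / c)"
  by (rule ext) (simp add: pos_part_def max_divide_distrib_right)

text \<open>
  The squared distance between normalised points is expanded into inner products of the original
  points, each of which is continuous along the curve.
\<close>

lemma curve_normalise:
  assumes c: "curve \<zeta>" and pos: "\<And>r. r \<in> {-1..1} \<Longrightarrow> 0 < b (\<zeta> r) (\<zeta> r)"
  shows "curve (\<lambda>r x. \<zeta> r x / sqrt (b (\<zeta> r) (\<zeta> r)))"
  unfolding curve_def
proof (intro conjI ballI)
  fix r :: real assume r: "r \<in> {-1..1}"
  define \<beta> where "\<beta> q = sqrt (b (\<zeta> q) (\<zeta> q))" for q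
  show "(\<lambda>x. \<zeta> r x / sqrt (b (\<zeta> r) (\<zeta> r))) \<in> V" using curve_in[OF c r] by simp
  have b0: "\<beta> r \<noteq> 0" using pos[OF r] by (simp add: \<beta>_def)
  have lb: "(\<beta> \<longlongrightarrow> \<beta> r) (at r within {-1..1})"
    using continuous_on_curve_b[OF c] r unfolding \<beta>_def continuous_on_def
    by (auto intro!: tendsto_real_sqrt)
  have l1: "((\<lambda>q. a (\<zeta> q) (\<zeta> q)) \<longlongrightarrow> a (\<zeta> r) (\<zeta> r)) (at r within {-1..1})"
    using continuous_on_curve_a[OF c] r unfolding continuous_on_def by auto
  have l2: "((\<lambda>q. a (\<zeta> q) (\<zeta> r)) \<longlongrightarrow> a (\<zeta> r) (\<zeta> r)) (at r within {-1..1})"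
    by (intro A.tendsto_inner eventually_curve_in curve_in curve_tendsto_a c r)
  have lim: "((\<lambda>q. a (\<zeta> q) (\<zeta> q) / (\<beta> q * \<beta> q) - 2 * (a (\<zeta> q) (\<zeta> r) / (\<beta> q * \<beta> r))
            + a (\<zeta> r) (\<zeta> r) / (\<beta> r * \<beta> r))
      \<longlongrightarrow> a (\<zeta> r) (\<zeta> r) / (\<beta> r * \<beta> r) - 2 * (a (\<zeta> r) (\<zeta> r) / (\<beta> r * \<beta> r))
            + a (\<zeta> r) (\<zeta> r) / (\<beta> r * \<beta> r)) (at r within {-1..1})"
    using b0 by (intro tendsto_intros l1 l2 lb) auto
  have ev: "\<forall>\<^sub>F q in at r within {-1..1}.
      a (\<lambda>x. \<zeta> q x / \<beta> q - \<zeta> r x / \<beta> r) (\<lambda>x. \<zeta> q x / \<beta> q - \<zeta> r x / \<beta> r)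
       = a (\<zeta> q) (\<zeta> q) / (\<beta> q * \<beta> q) - 2 * (a (\<zeta> q) (\<zeta> r) / (\<beta> q * \<beta> r))
            + a (\<zeta> r) (\<zeta> r) / (\<beta> r * \<beta> r)"
    using eventually_curve_in[OF c]
  proof eventually_elim
    case (elim q)
    then show ?case using curve_in[OF c r] A.sym[of "\<zeta> r" "\<zeta> q"]
      by (simp add: diff_divide_distrib mult.commute)
  qed
  show "((\<lambda>q. a (\<lambda>x. \<zeta> q x / sqrt (b (\<zeta> q) (\<zeta> q)) - \<zeta> r x / sqrt (b (\<zeta> r) (\<zeta> r)))
      (\<lambda>x. \<zeta> q x / sqrt (b (\<zeta> q) (\<zeta> q)) - \<zeta> r x / sqrt (b (\<zeta> r) (\<zeta> r)))) \<longlongrightarrow> 0)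
      (at r within {-1..1})"
    unfolding \<beta>_def[symmetric] tendsto_cong[OF ev] using lim by simp
qed

lemma normalise_endpoint:
  assumes "z \<in> V" "k \<noteq> 0" "b (\<lambda>x. z x - k * \<phi> x) (\<lambda>x. z x - k * \<phi> x) = 0"
  shows "b z z = k\<^sup>2" "b z \<phi> = k"
proof -
  have "b (\<lambda>x. z x - k * \<phi> x) \<phi> = 0" using b_null_left[OF _ \<phi>_in assms(3)] assms(1) A.closed(2,3) \<phi>_in by blast
  then show 1: "b z \<phi> = k" using assms(1) \<phi>_norm by simp
  have "b z z - k * b z \<phi> - k * (b \<phi> z - k * b \<phi> \<phi>) = 0"
    using assms(3) by (simp add: assms(1))
  then show "b z z = k\<^sup>2" unfolding B.sym[OF \<phi>_in assms(1)] 1 \<phi>_norm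
    by (simp add: power2_eq_square)
qed

lemma path_normalise:
  assumes c: "curve \<zeta>" and pos: "\<And>r. r \<in> {-1..1} \<Longrightarrow> 0 < b (\<zeta> r) (\<zeta> r)"
    and k: "k1 > 0" "k2 > 0"
    and m: "b (\<lambda>x. \<zeta> (-1) x + k1 * \<phi> x) (\<lambda>x. \<zeta> (-1) x + k1 * \<phi> x) = 0"
    and p: "b (\<lambda>x. \<zeta> 1 x - k2 * \<phi> x) (\<lambda>x. \<zeta> 1 x - k2 * \<phi> x) = 0"
  shows "(\<lambda>r x. \<zeta> r x / sqrt (b (\<zeta> r) (\<zeta> r))) \<in> paths"
proof -
  have V: "\<zeta> (-1) \<in> V" "\<zeta> 1 \<in> V" using curve_in[OF c] by auto
  have e1: "b (\<zeta> (-1)) (\<zeta> (-1)) = k1\<^sup>2" "b (\<zeta> (-1)) \<phi> = - k1"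
    using normalise_endpoint[OF V(1), of "- k1"] k m by simp_all
  have e2: "b (\<zeta> 1) (\<zeta> 1) = k2\<^sup>2" "b (\<zeta> 1) \<phi> = k2"
    using normalise_endpoint[OF V(2), of "k2"] k p by simp_all
  have "b (\<lambda>x. \<zeta> r x / sqrt (b (\<zeta> r) (\<zeta> r))) (\<lambda>x. \<zeta> r x / sqrt (b (\<zeta> r) (\<zeta> r))) = 1"
    if "r \<in> {-1..1}" for r
    using curve_in[OF c that] pos[OF that] by simp
  moreover have "b (\<lambda>x. \<zeta> (-1) x / k1 + \<phi> x) (\<lambda>x. \<zeta> (-1) x / k1 + \<phi> x) = 0"
    using V k e1 \<phi>_norm B.sym[OF \<phi>_in V(1)] by (simp add: power2_eq_square)
  moreover have "b (\<lambda>x. \<zeta> 1 x / k2 - \<phi> x) (\<lambda>x. \<zeta> 1 x / k2 - \<phi> x) = 0"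
    using V k e2 \<phi>_norm B.sym[OF \<phi>_in V(2)] by (simp add: power2_eq_square)
  moreover have "sqrt (b (\<zeta> (-1)) (\<zeta> (-1))) = k1" "sqrt (b (\<zeta> 1) (\<zeta> 1)) = k2"
    using e1 e2 k by auto
  ultimately show ?thesis
    unfolding paths_def using curve_normalise[OF c pos] by simp
qed

text \<open>
  By homogeneity, an upper bound for the quotient of \<open>J\<close> and the squared norm along any curve that
  avoids zero and joins the two rays bounds the minimax level.
\<close>

lemma level_le:
  assumes p0: "0 \<le> p" and c: "curve \<zeta>" and pos: "\<And>r. r \<in> {-1..1} \<Longrightarrow> 0 < b (\<zeta> r) (\<zeta> r)"
    and k: "k1 > 0" "k2 > 0"
    and m: "b (\<lambda>x. \<zeta> (-1) x + k1 * \<phi> x) (\<lambda>x. \<zeta> (-1) x + k1 * \<phi> x) = 0"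
    and p: "b (\<lambda>x. \<zeta> 1 x - k2 * \<phi> x) (\<lambda>x. \<zeta> 1 x - k2 * \<phi> x) = 0"
    and J: "\<And>r. r \<in> {-1..1} \<Longrightarrow> J p (\<zeta> r) \<le> d * b (\<zeta> r) (\<zeta> r)"
  shows "level p \<le> d"
  unfolding level_def
proof (rule cINF_lower2[OF bdd_below_sup_J[OF p0] path_normalise[OF c pos k m p]])
  show "(SUP r\<in>{-1..1}. J p (\<lambda>x. \<zeta> r x / sqrt (b (\<zeta> r) (\<zeta> r)))) \<le> d"
  proof (rule cSUP_least)
    fix r :: real assume r: "r \<in> {-1..1}"
    have "J p (\<lambda>x. \<zeta> r x / sqrt (b (\<zeta> r) (\<zeta> r))) = J p (\<zeta> r) / b (\<zeta> r) (\<zeta> r)"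
      unfolding J_def using curve_in[OF c r] pos[OF r]
      by (simp add: pos_part_divide diff_divide_distrib)
    then show "J p (\<lambda>x. \<zeta> r x / sqrt (b (\<zeta> r) (\<zeta> r))) \<le> d"
      using J[OF r] pos[OF r] by (simp add: divide_le_eq)
  qed simp
qed

text \<open>
  This curve from \<open>- \<phi>\<close> through \<open>w\<close> to \<open>\<phi>\<close> serves twice: with an arbitrary \<open>w\<close> independent of
  \<open>\<phi>\<close> it shows that there are paths at all, and with a solution \<open>w\<close> it bounds the minimax level.
\<close>

lemma eigenfunction_curve:
  assumes w: "w \<in> V" shows "curve (\<lambda>r x. (1 - \<bar>r\<bar>) * w x + r * \<phi> x)"
  unfolding curve_def
proof (intro conjI ballI)
  fix r :: real
  show "(\<lambda>x. (1 - \<bar>r\<bar>) * w x + r * \<phi> x) \<in> V" using w by simp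
  have "((\<lambda>q. (\<bar>r\<bar> - \<bar>q\<bar>)\<^sup>2 * a w w + 2 * (\<bar>r\<bar> - \<bar>q\<bar>) * (q - r) * a w \<phi> + (q - r)\<^sup>2 * a \<phi> \<phi>)
      \<longlongrightarrow> (\<bar>r\<bar> - \<bar>r\<bar>)\<^sup>2 * a w w + 2 * (\<bar>r\<bar> - \<bar>r\<bar>) * (r - r) * a w \<phi> + (r - r)\<^sup>2 * a \<phi> \<phi>)
      (at r within {-1..1})"
    by (intro tendsto_intros)
  moreover have "a (\<lambda>x. (1 - \<bar>q\<bar>) * w x + q * \<phi> x - ((1 - \<bar>r\<bar>) * w x + r * \<phi> x))
      (\<lambda>x. (1 - \<bar>q\<bar>) * w x + q * \<phi> x - ((1 - \<bar>r\<bar>) * w x + r * \<phi> x))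
      = (\<bar>r\<bar> - \<bar>q\<bar>)\<^sup>2 * a w w + 2 * (\<bar>r\<bar> - \<bar>q\<bar>) * (q - r) * a w \<phi> + (q - r)\<^sup>2 * a \<phi> \<phi>" for q
    using w by (simp add: A.sym[of \<phi> w] power2_eq_square algebra_simps)
  ultimately show "((\<lambda>q. a (\<lambda>x. (1 - \<bar>q\<bar>) * w x + q * \<phi> x - ((1 - \<bar>r\<bar>) * w x + r * \<phi> x))
      (\<lambda>x. (1 - \<bar>q\<bar>) * w x + q * \<phi> x - ((1 - \<bar>r\<bar>) * w x + r * \<phi> x))) \<longlongrightarrow> 0)
      (at r within {-1..1})"
    by simp
qed

lemma eigenfunction_curve_pos:
  assumes w: "w \<in> V" and ind: "\<And>c. 0 < b (\<lambda>x. w x - c * \<phi> x) (\<lambda>x. w x - c * \<phi> x)"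
  shows "0 < b (\<lambda>x. (1 - \<bar>r\<bar>) * w x + r * \<phi> x) (\<lambda>x. (1 - \<bar>r\<bar>) * w x + r * \<phi> x)"
proof (cases "\<bar>r\<bar> = 1")
  case True
  then have "r * r = 1" by (simp flip: power2_eq_square add: abs_square_eq_1)
  then show ?thesis using True w \<phi>_norm by simp
next
  case False
  define k where "k = - r / (1 - \<bar>r\<bar>)"
  have r: "r = - (1 - \<bar>r\<bar>) * k" using False by (simp add: k_def divide_simps) (simp add: algebra_simps)
  have "(\<lambda>x. (1 - \<bar>r\<bar>) * w x + r * \<phi> x) = (\<lambda>x. (1 - \<bar>r\<bar>) * (w x - k * \<phi> x))"
    by (subst (2) r) (simp add: algebra_simps)
  moreover have "0 < (1 - \<bar>r\<bar>)\<^sup>2 * b (\<lambda>x. w x - k * \<phi> x) (\<lambda>x. w x - k * \<phi> x)"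
    using ind[of k] False by (simp del: B.linear_left B.linear_right)
  moreover have "b (\<lambda>x. (1 - \<bar>r\<bar>) * (w x - k * \<phi> x)) (\<lambda>x. (1 - \<bar>r\<bar>) * (w x - k * \<phi> x))
     = (1 - \<bar>r\<bar>)\<^sup>2 * b (\<lambda>x. w x - k * \<phi> x) (\<lambda>x. w x - k * \<phi> x)"
    using B.linear_left(3)[of "\<lambda>x. w x - k * \<phi> x"] B.linear_right(3)[of "\<lambda>x. w x - k * \<phi> x"] w
    by (simp add: power2_eq_square del: B.linear_left B.linear_right)
  ultimately show ?thesis by simp
qed

lemma paths_nonempty: "paths \<noteq> {}"
proof -
  obtain w where w: "w \<in> V" "\<And>c. 0 < b (\<lambda>x. w x - c * \<phi> x) (\<lambda>x. w x - c * \<phi> x)"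
    using dim_ge_2 by blast
  show ?thesis
    using path_normalise[OF eigenfunction_curve[OF w(1)] eigenfunction_curve_pos[OF w], of 1 1]
      B.linear_left(3)[OF \<phi>_in B.closed(3)[OF \<phi>_in], of 0 0] by auto
qed

lemma ex_path_below:
  assumes "level p < d"
  obtains \<gamma> where "\<gamma> \<in> paths" "\<And>r. r \<in> {-1..1} \<Longrightarrow> J p (\<gamma> r) < d"
proof -
  obtain \<gamma> where g: "\<gamma> \<in> paths" "(SUP r\<in>{-1..1}. J p (\<gamma> r)) < d"
    using cInf_lessD[of "(\<lambda>\<gamma>. SUP r\<in>{-1..1}. J p (\<gamma> r)) ` paths" d] assms paths_nonempty
    unfolding level_def by auto
  have "J p (\<gamma> r) < d" if r: "r \<in> {-1..1}" for r
    using cSUP_upper[OF r bdd_above_J[of \<gamma> p]] g by (auto simp: paths_def)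
  then show ?thesis using g that by blast
qed

end

section \<open>Solutions and the minimax level\<close>

context fucik_form begin

lemma ex_resolves:
  assumes "u \<in> V" shows "\<exists>z. resolves p t u z"
proof -
  obtain z where "z \<in> V" "\<forall>v\<in>V. a z v = b (\<lambda>x. p * pos_part u x + t * u x) v"
    using riesz[of "\<lambda>x. p * pos_part u x + t * u x"] assms by auto
  then show ?thesis using assms by (auto simp: resolves_def)
qed

lemma resolves_scale:
  assumes "resolves p t u z" "0 \<le> c"
  shows "resolves p t (\<lambda>x. c * u x) (\<lambda>x. c * z x)"
  using assms by (auto simp: resolves_def pos_part_scale algebra_simps)

text \<open>
  For positive \<open>t\<close> the operator maps \<open>\<phi>\<close> and, below, \<open>- \<phi>\<close> to positive multiples of themselves.
  This is why it preserves the endpoints of a path after normalisation.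
\<close>

lemma resolves_eigenfunction: "resolves p t \<phi> (\<lambda>x. (p + t) / lam * \<phi> x)"
proof -
  have "b (\<lambda>x. pos_part \<phi> x - \<phi> x) v = 0" if "v \<in> V" for v
    using b_null_left[OF _ that \<phi>_nonneg] by simp
  then have "b (pos_part \<phi>) v = b \<phi> v" if "v \<in> V" for v using that by simp
  then show ?thesis using \<phi>_eigen lam_pos
    by (simp add: resolves_def field_simps)
qed

lemma resolves_neg_eigenfunction: "resolves p t (\<lambda>x. - \<phi> x) (\<lambda>x. - (t / lam * \<phi> x))"
proof -
  have "pos_part (\<lambda>x. - \<phi> x) = (\<lambda>x. pos_part \<phi> x - \<phi> x)"
    by (rule ext) (simp add: pos_part_def max_def)
  then have "b (pos_part (\<lambda>x. - \<phi> x)) v = 0" if "v \<in> V" for v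
    using b_null_left[OF _ that \<phi>_nonneg] by simp
  then show ?thesis using \<phi>_eigen lam_pos A.linear_left(4)[OF A.closed(3)[OF \<phi>_in]]
    by (simp add: resolves_def)
qed

text \<open>
  The right-hand side depends on \<open>u\<close> only through \<open>b\<close>, and the positive part is nonexpansive
  there.  Hence the operator is Lipschitz from the distance of \<open>b\<close> to the stronger distance of \<open>a\<close>,
  which, given the compact embedding, makes it compact.
\<close>

lemma resolves_Lipschitz:
  assumes r: "resolves p t u z" "resolves p t u' z'" and p: "0 \<le> p" "0 \<le> t"
  shows "A.sqdist z z'
    \<le> (p + t)\<^sup>2 / lam * B.sqdist u u'"
proof -
  define w where "w = (\<lambda>x. z x - z' x)"
  define d where "d = (\<lambda>x. u x - u' x)"
  define dp where "dp = (\<lambda>x. pos_part u x - pos_part u' x)"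
  have V: "u \<in> V" "u' \<in> V" "z \<in> V" "z' \<in> V" "w \<in> V" "d \<in> V" "dp \<in> V"
    using r unfolding resolves_def w_def d_def dp_def by auto
  have "a w w = a z w - a z' w" using V by (simp add: w_def[symmetric] flip: A.linear_left(2))
  also have "\<dots> = p * b dp w + t * b d w"
    using r V unfolding resolves_def dp_def d_def by (simp add: algebra_simps)
  also have "\<dots> \<le> p * (sqrt (b d d) * sqrt (b w w)) + t * (sqrt (b d d) * sqrt (b w w))"
  proof (intro add_mono mult_left_mono p)
    show "b d w \<le> sqrt (b d d) * sqrt (b w w)" using B.Cauchy_Schwarz[of d w] V by simp
    have "b dp w \<le> sqrt (b dp dp) * sqrt (b w w)" using B.Cauchy_Schwarz[of dp w] V by simp
    also have "\<dots> \<le> sqrt (b d d) * sqrt (b w w)"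
      using b_pos_part_Lipschitz[OF V(1,2)] B.nonneg[OF V(5)]
      by (intro mult_right_mono) (auto simp: dp_def d_def simp del: B.linear_left B.linear_right)
    finally show "b dp w \<le> sqrt (b d d) * sqrt (b w w)" .
  qed
  also have "\<dots> = (p + t) * sqrt (b d d) * sqrt (b w w)" by (simp add: algebra_simps)
  also have "\<dots> \<le> (p + t) * sqrt (b d d) * sqrt (a w w / lam)"
    using b_le_a[OF V(5)] B.nonneg[OF V(6)] p by (intro mult_left_mono) auto
  finally have "sqrt (a w w) * sqrt (a w w) \<le> (p + t) * sqrt (b d d) / sqrt lam * sqrt (a w w)"
    using A.nonneg[OF V(5)] by (simp add: real_sqrt_divide)
  then have "sqrt (a w w) \<le> (p + t) * sqrt (b d d) / sqrt lam"
  proof (cases "a w w = 0")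
    case False
    then have "0 < sqrt (a w w)" using A.nonneg[OF V(5)] by simp
    with \<open>sqrt (a w w) * sqrt (a w w) \<le> _\<close> show ?thesis by (simp only: mult_le_cancel_right_pos)
  qed (use B.nonneg[OF V(6)] p lam_pos in simp)
  then have "(sqrt (a w w))\<^sup>2 \<le> ((p + t) * sqrt (b d d) / sqrt lam)\<^sup>2"
    using A.nonneg[OF V(5)] by (intro power_mono) auto
  then show ?thesis
    using A.nonneg[OF V(5)] B.nonneg[OF V(6)] lam_pos
    by (simp add: power_mult_distrib power_divide w_def d_def del: A.linear_left A.linear_right B.linear_left B.linear_right)
qed

lemma resolves_cong:
  assumes r: "resolves p t u z" "resolves p t u' z'" and p: "0 \<le> p" "0 \<le> t"
    and e: "B.sqdist u u' = 0"
  shows "B.sqdist z z' = 0"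
proof -
  have d: "(\<lambda>x. z x - z' x) \<in> V" using r by (simp add: resolves_def)
  have "A.sqdist z z' \<le> 0"
    using resolves_Lipschitz[OF r p] unfolding e by simp
  then have "lam * B.sqdist z z' \<le> 0"
    using poincare[OF d] by linarith
  then show ?thesis using lam_pos B.nonneg[OF d] by (simp add: mult_le_0_iff del: B.linear_left B.linear_right)
qed

text \<open>
  The terms \<open>a\<close> and \<open>t * b\<close> are quadratic and expand exactly; the remaining term enters with a
  negative sign and lies above its linearisation by convexity.
\<close>

lemma J_convex_step:
  assumes "u \<in> V" "h \<in> V" "0 \<le> p"
  shows "J p (\<lambda>x. u x + h x) - t * b (\<lambda>x. u x + h x) (\<lambda>x. u x + h x)
    \<le> J p u - t * b u u + 2 * (a u h - p * b (pos_part u) h - t * b u h) + a h h - t * b h h"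
proof -
  have "p * (b (pos_part u) (pos_part u) + 2 * b (pos_part u) h)
      \<le> p * b (pos_part (\<lambda>x. u x + h x)) (pos_part (\<lambda>x. u x + h x))"
    using b_pos_part_convex[OF assms(1,2)] assms(3) by (rule mult_left_mono)
  then show ?thesis unfolding J_def
    using assms by (simp add: A.sym[of h u] B.sym[of h u] algebra_simps)
qed

text \<open>
  For the increment \<open>h\<close> from \<open>u\<close> to \<open>z\<close>, the linear term of \<open>J_convex_step\<close> equals
  \<open>- 2 * a h h\<close>, which outweighs the quadratic term \<open>a h h\<close>.
\<close>

lemma J_descent:
  assumes r: "resolves p t u z" and p: "0 \<le> p" "0 \<le> t"
  shows "J p z - t * b z z + A.sqdist u z \<le> J p u - t * b u u"
proof -
  define h where "h = (\<lambda>x. z x - u x)"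
  have V: "u \<in> V" "z \<in> V" "h \<in> V" using r unfolding resolves_def h_def by auto
  have z: "z = (\<lambda>x. u x + h x)" by (simp add: h_def)
  have "a z h = p * b (pos_part u) h + t * b u h" using r V by (simp add: resolves_def)
  then have "a u h + a h h = p * b (pos_part u) h + t * b u h" using V unfolding z by simp
  moreover have "0 \<le> t * b h h" using B.nonneg[OF V(3)] p by simp
  moreover have "A.sqdist u z = a h h"
    unfolding h_def by (rule A.norm_diff_commute[OF V(1,2)])
  ultimately show ?thesis
    using J_convex_step[OF V(1,3) p(1), of t] unfolding z[symmetric]
    by (smt (verit) distrib_left)
qed

text \<open>
  This replaces the Palais-Smale condition.  Normalised functions with residuals tending to zero have
  a subsequence along which \<open>u\<close> converges in \<open>b\<close>; then the images converge in \<open>a\<close>, hence so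
  does \<open>u\<close>, and the limit is a solution of energy one.
\<close>

lemma residual_bound:
  assumes p: "0 \<le> p" "0 \<le> t" and no: "\<nexists>u. resolves p t u u \<and> b u u \<noteq> 0"
  shows "\<exists>\<delta>>0. \<forall>u z. resolves p t u z \<longrightarrow> \<delta> * a u u \<le> A.sqdist u z"
proof (rule ccontr)
  assume "\<not> ?thesis"
  then have "\<exists>u z. resolves p t u z \<and> A.sqdist u z < 1 / real (Suc n) * a u u" for n
    by (metis not_le of_nat_0_less_iff zero_less_Suc zero_less_divide_1_iff)
  then obtain u z where uz: "\<And>n. resolves p t (u n) (z n)"
    and res: "\<And>n. A.sqdist (u n) (z n) < 1 / real (Suc n) * a (u n) (u n)"
    by metis
  have V: "u n \<in> V" "z n \<in> V" for n using uz[of n] by (auto simp: resolves_def)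
  have apos: "0 < a (u n) (u n)" for n
  proof -
    have "0 < 1 / real (Suc n) * a (u n) (u n)"
      using le_less_trans[OF A.nonneg res[of n]] V[of n] by simp
    then show ?thesis by (rule zero_less_mult_pos) simp
  qed
  define c where "c n = 1 / sqrt (a (u n) (u n))" for n
  define u' where "u' n = (\<lambda>x. c n * u n x)" for n
  define z' where "z' n = (\<lambda>x. c n * z n x)" for n
  have c: "0 < c n" "c n * c n * a (u n) (u n) = 1" for n
    using apos[of n] by (simp_all add: c_def)
  have V': "u' n \<in> V" "z' n \<in> V" for n using V by (simp_all add: u'_def z'_def)
  have uz': "resolves p t (u' n) (z' n)" for n
    unfolding u'_def z'_def using uz c(1)[of n] by (intro resolves_scale) auto
  have one: "a (u' n) (u' n) = 1" for n
  proof -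
    have "a (u' n) (u' n) = c n * c n * a (u n) (u n)"
      using V[of n] unfolding u'_def by simp
    then show ?thesis using c(2) by simp
  qed
  have res': "A.sqdist (u' n) (z' n) \<le> 1 / real (Suc n)" for n
  proof -
    have d: "(\<lambda>x. u n x - z n x) \<in> V" using V by simp
    have "A.sqdist (u' n) (z' n)
        = a (\<lambda>x. c n * (u n x - z n x)) (\<lambda>x. c n * (u n x - z n x))"
      by (simp add: u'_def z'_def right_diff_distrib)
    also have "\<dots> = c n * c n * A.sqdist (u n) (z n)"
      using A.linear_left(3)[OF d A.closed(3)[OF d]] A.linear_right(3)[OF d d] by simp
    also have "\<dots> \<le> c n * c n * (1 / real (Suc n) * a (u n) (u n))"
      using res[of n] c(1)[of n] by (intro mult_left_mono) auto
    also have "\<dots> = 1 / real (Suc n)" using c(2)[of n] by (simp add: field_simps)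
    finally show ?thesis .
  qed
  obtain r w where r: "strict_mono r" and w: "w \<in> V"
    and lim: "(\<lambda>n. B.sqdist (u' (r n)) w) \<longlonglongrightarrow> 0"
    using compact_embedding[of u' 1] V' one by auto
  obtain y where y: "resolves p t w y" using ex_resolves[OF w] by blast
  then have yV: "y \<in> V" by (simp add: resolves_def)
  have lz: "(\<lambda>n. A.sqdist (z' (r n)) y) \<longlonglongrightarrow> 0"
  proof (rule A.tendsto_sqdist_zero[OF _ yV])
    show "(\<lambda>n. (p + t)\<^sup>2 / lam * B.sqdist (u' (r n)) w) \<longlonglongrightarrow> 0"
      using tendsto_mult[OF tendsto_const[of "(p + t)\<^sup>2 / lam"] lim]
      by (simp del: B.linear_left B.linear_right)
    have "A.sqdist (z' (r n)) y \<le> (p + t)\<^sup>2 / lam * B.sqdist (u' (r n)) w" for n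
      by (rule resolves_Lipschitz[OF uz' y p])
    then show "\<forall>\<^sub>F n in sequentially.
        A.sqdist (z' (r n)) y \<le> (p + t)\<^sup>2 / lam * B.sqdist (u' (r n)) w"
      by (rule always_eventually[OF allI])
  qed (simp add: V')
  have la: "(\<lambda>n. A.sqdist (u' (r n)) y) \<longlonglongrightarrow> 0"
  proof (rule A.tendsto_sqdist_zero[OF _ yV])
    have "(\<lambda>n. 2 * (1 / real (Suc (r n))) + 2 * A.sqdist (z' (r n)) y) \<longlonglongrightarrow> 2 * 0 + 2 * 0"
      by (intro tendsto_add tendsto_mult tendsto_const lz
          LIMSEQ_subseq_LIMSEQ[OF LIMSEQ_Suc[OF lim_1_over_n] r, unfolded o_def])
    then show "(\<lambda>n. 2 * (1 / real (Suc (r n))) + 2 * A.sqdist (z' (r n)) y) \<longlonglongrightarrow> 0"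
      by (simp only: mult_zero_right add_0)
    have "A.sqdist (u' (r n)) y \<le> 2 * (1 / real (Suc (r n))) + 2 * A.sqdist (z' (r n)) y" for n
    proof -
      define d1 where "d1 = (\<lambda>x. u' (r n) x - z' (r n) x)"
      define d2 where "d2 = (\<lambda>x. z' (r n) x - y x)"
      have "d1 \<in> V" "d2 \<in> V"
        unfolding d1_def d2_def by (rule A.closed(2)[OF V'(1) V'(2)], rule A.closed(2)[OF V'(2) yV])
      then have "a (\<lambda>x. d1 x + d2 x) (\<lambda>x. d1 x + d2 x) \<le> 2 * a d1 d1 + 2 * a d2 d2"
        by (rule A.norm_sq_add_le)
      moreover have "a d1 d1 \<le> 1 / real (Suc (r n))" using res'[of "r n"] unfolding d1_def .
      moreover have "(\<lambda>x. d1 x + d2 x) = (\<lambda>x. u' (r n) x - y x)" by (simp add: d1_def d2_def)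
      ultimately show ?thesis unfolding d2_def[symmetric] by simp
    qed
    then show "\<forall>\<^sub>F n in sequentially.
        A.sqdist (u' (r n)) y \<le> 2 * (1 / real (Suc (r n))) + 2 * A.sqdist (z' (r n)) y"
      by (rule always_eventually[OF allI])
  qed (simp add: V')
  have lb: "(\<lambda>n. B.sqdist (u' (r n)) y) \<longlonglongrightarrow> 0"
  proof (rule B.tendsto_sqdist_zero[OF _ yV])
    show "(\<lambda>n. A.sqdist (u' (r n)) y / lam) \<longlonglongrightarrow> 0"
      using tendsto_divide[OF la tendsto_const[of lam]] lam_pos
      by (simp del: A.linear_left A.linear_right)
    show "\<forall>\<^sub>F n in sequentially. B.sqdist (u' (r n)) y \<le> A.sqdist (u' (r n)) y / lam"
      by (rule always_eventually[OF allI]) (rule b_le_a[OF A.closed(2)[OF V'(1) yV]])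
  qed (simp add: V')
  have "B.sqdist y w = 0"
  proof -
    have eq: "b w v = b y v" if "v \<in> V" for v
    proof (rule LIMSEQ_unique)
      show "(\<lambda>n. b (u' (r n)) v) \<longlonglongrightarrow> b w v" using V' w that lim by (intro B.tendsto_inner) auto
      show "(\<lambda>n. b (u' (r n)) v) \<longlonglongrightarrow> b y v" using V' yV that lb by (intro B.tendsto_inner) auto
    qed
    then show ?thesis using w yV by simp
  qed
  then have yw: "a (\<lambda>x. y x - w x) v = 0" if "v \<in> V" for v
    using that w yV by (intro a_null_left) auto
  have ww: "resolves p t w w"
    using y w yV yw by (simp add: resolves_def)
  have "(\<lambda>n. a (u' (r n)) (u' (r n))) \<longlonglongrightarrow> a y y"
    using V' yV la by (intro A.tendsto_norm_sq) auto
  then have "a y y = 1" using one by (simp add: LIMSEQ_const_iff)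
  moreover have "a y y = a w w" using yw[OF w] yw[OF yV] w yV by (simp add: A.sym[of w y])
  ultimately have "b w w \<noteq> 0" using null[OF w] by auto
  then show False using no ww by blast
qed

text \<open>
  If there were no solution, one application of the operator to an almost optimal path would push it
  uniformly below the minimax level: the gain \<open>\<delta> * a u u\<close> is at least \<open>\<delta> * lam\<close> on the sphere.
\<close>

theorem level_solution:
  assumes p: "0 \<le> p" and lev: "0 < level p"
  shows "\<exists>u. resolves p (level p) u u \<and> b u u \<noteq> 0"
proof (rule ccontr)
  define c where "c = level p"
  assume "\<not> ?thesis"
  then obtain \<delta> where d0: "\<delta> > 0"
    and d: "\<And>u z. resolves p c u z \<Longrightarrow> \<delta> * a u u \<le> A.sqdist u z"
    using residual_bound[of p c] p lev unfolding c_def by auto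
  have c0: "0 < c" using lev by (simp add: c_def)
  \<comment> \<open>half of the guaranteed gain: the path may start this much above \<open>c\<close> and ends this much below\<close>
  define \<eta> where "\<eta> = \<delta> * lam / 2"
  have \<eta>: "\<eta> > 0" using d0 lam_pos by (simp add: \<eta>_def)
  obtain \<gamma> where g: "\<gamma> \<in> paths" and Jg: "\<And>r. r \<in> {-1..1} \<Longrightarrow> J p (\<gamma> r) < c + \<eta>"
    using ex_path_below[of p "c + \<eta>"] \<eta> by (auto simp: c_def)
  have cg: "curve \<gamma>" and ng: "\<And>r. r \<in> {-1..1} \<Longrightarrow> b (\<gamma> r) (\<gamma> r) = 1"
    using g by (auto simp: paths_def)
  have "\<forall>r. \<exists>z. r \<in> {-1..1} \<longrightarrow> resolves p c (\<gamma> r) z"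
    using ex_resolves curve_in[OF cg] by blast
  then obtain \<zeta> where z: "\<And>r. r \<in> {-1..1} \<Longrightarrow> resolves p c (\<gamma> r) (\<zeta> r)" by metis
  have V: "\<zeta> r \<in> V" "\<gamma> r \<in> V" if "r \<in> {-1..1}" for r
    using z[OF that] by (auto simp: resolves_def)
  have cz: "curve \<zeta>"
    unfolding curve_def
  proof (intro conjI ballI)
    fix r :: real assume r: "r \<in> {-1..1}"
    show "\<zeta> r \<in> V" using V r by simp
    show "((\<lambda>q. A.sqdist (\<zeta> q) (\<zeta> r)) \<longlongrightarrow> 0) (at r within {-1..1})"
    proof (rule A.tendsto_sqdist_zero[OF _ V(1)[OF r]])
      show "((\<lambda>q. (p + c)\<^sup>2 / lam * B.sqdist (\<gamma> q) (\<gamma> r)) \<longlongrightarrow> 0) (at r within {-1..1})"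
        using tendsto_mult[OF tendsto_const[of "(p + c)\<^sup>2 / lam"] curve_tendsto_b[OF cg r]]
        by (simp del: B.linear_left B.linear_right)
      have "A.sqdist (\<zeta> q) (\<zeta> r) \<le> (p + c)\<^sup>2 / lam * B.sqdist (\<gamma> q) (\<gamma> r)" if "q \<in> {-1..1}" for q
        by (rule resolves_Lipschitz[OF z[OF that] z[OF r] p less_imp_le[OF c0]])
      then show "\<forall>\<^sub>F q in at r within {-1..1}.
          A.sqdist (\<zeta> q) (\<zeta> r) \<le> (p + c)\<^sup>2 / lam * B.sqdist (\<gamma> q) (\<gamma> r)"
        by (auto simp: eventually_at_filter
            simp del: A.linear_left A.linear_right B.linear_left B.linear_right)
      show "\<forall>\<^sub>F q in at r within {-1..1}. \<zeta> q \<in> V" using V by (auto simp: eventually_at_filter)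
    qed
  qed
  have Jz: "J p (\<zeta> r) \<le> c * b (\<zeta> r) (\<zeta> r) - \<eta>" if r: "r \<in> {-1..1}" for r
  proof -
    have "\<delta> * lam \<le> \<delta> * a (\<gamma> r) (\<gamma> r)"
      using poincare[of "\<gamma> r"] V[OF r] ng[OF r] d0 by simp
    then show ?thesis
      using J_descent[OF z[OF r] p] d[OF z[OF r]] Jg[OF r] ng[OF r] c0 unfolding \<eta>_def by simp
  qed
  \<comment> \<open>where \<open>J\<close> is that low the function is not null, so it can be normalised\<close>
  have bz_pos: "0 < b (\<zeta> r) (\<zeta> r)" if r: "r \<in> {-1..1}" for r
  proof (rule ccontr)
    assume "\<not> ?thesis"
    then have b0: "b (\<zeta> r) (\<zeta> r) = 0" using B.nonneg[OF V(1)[OF r]] by simp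
    then show False
      using J_ge[OF V(1)[OF r] p] A.nonneg[OF V(1)[OF r]] Jz[OF r] \<eta> by simp
  qed
  \<comment> \<open>the images have squared norm at most \<open>D\<close>, so the gain survives normalisation\<close>
  define D where "D = ((p + c) / lam)\<^sup>2"
  have D: "D > 0" using p c0 lam_pos by (simp add: D_def)
  have bz_le: "b (\<zeta> r) (\<zeta> r) \<le> D" if r: "r \<in> {-1..1}" for r
  proof -
    define \<beta> where "\<beta> = sqrt (b (\<zeta> r) (\<zeta> r))"
    have bp: "\<beta> > 0" using bz_pos[OF r] by (simp add: \<beta>_def)
    have bb: "b (\<zeta> r) (\<zeta> r) = \<beta> * \<beta>" using bz_pos[OF r] by (simp add: \<beta>_def)
    have "b (pos_part (\<gamma> r)) (\<zeta> r) \<le> sqrt (b (pos_part (\<gamma> r)) (pos_part (\<gamma> r))) * \<beta>"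
      using B.Cauchy_Schwarz[of "pos_part (\<gamma> r)" "\<zeta> r"] V[OF r] by (simp add: \<beta>_def)
    also have "\<dots> \<le> 1 * \<beta>"
      using b_pos_part_le[of "\<gamma> r"] V[OF r] ng[OF r] bp by (intro mult_right_mono) auto
    finally have 1: "b (pos_part (\<gamma> r)) (\<zeta> r) \<le> \<beta>" by simp
    have 2: "b (\<gamma> r) (\<zeta> r) \<le> \<beta>"
      using B.Cauchy_Schwarz[of "\<gamma> r" "\<zeta> r"] V[OF r] ng[OF r] by (simp add: \<beta>_def)
    have "lam * (\<beta> * \<beta>) \<le> a (\<zeta> r) (\<zeta> r)" using poincare[OF V(1)[OF r]] by (simp add: bb)
    also have "\<dots> = p * b (pos_part (\<gamma> r)) (\<zeta> r) + c * b (\<gamma> r) (\<zeta> r)"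
      using z[OF r] by (simp add: resolves_def)
    also have "\<dots> \<le> p * \<beta> + c * \<beta>" using 1 2 p c0 by (intro add_mono mult_left_mono) auto
    finally have "(lam * \<beta>) * \<beta> \<le> (p + c) * \<beta>" by (simp add: algebra_simps)
    then have "lam * \<beta> \<le> p + c" using bp by (simp only: mult_le_cancel_right_pos)
    then have "\<beta> \<le> (p + c) / lam" using lam_pos by (simp add: field_simps)
    then have "\<beta>\<^sup>2 \<le> D" unfolding D_def using bp by (intro power_mono) auto
    then show ?thesis by (simp add: bb power2_eq_square)
  qed
  have "level p \<le> c - \<eta> / D"
  proof (rule level_le[OF p cz bz_pos])
    show "0 < c / lam" "0 < (p + c) / lam" using p c0 lam_pos by auto
    have ends: "b (\<lambda>x. \<gamma> (-1) x - (- \<phi> x)) (\<lambda>x. \<gamma> (-1) x - (- \<phi> x)) = 0"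
      "B.sqdist (\<gamma> 1) \<phi> = 0" using g by (simp_all add: paths_def)
    show "b (\<lambda>x. \<zeta> (- 1) x + c / lam * \<phi> x) (\<lambda>x. \<zeta> (- 1) x + c / lam * \<phi> x) = 0"
      using resolves_cong[OF z resolves_neg_eigenfunction p less_imp_le[OF c0] ends(1)] by simp
    show "b (\<lambda>x. \<zeta> 1 x - (p + c) / lam * \<phi> x) (\<lambda>x. \<zeta> 1 x - (p + c) / lam * \<phi> x) = 0"
      using resolves_cong[OF z resolves_eigenfunction p less_imp_le[OF c0] ends(2)] by simp
    fix r :: real assume r: "r \<in> {-1..1}"
    have "\<eta> / D * b (\<zeta> r) (\<zeta> r) \<le> \<eta> / D * D"
      using bz_le[OF r] \<eta> D by (intro mult_left_mono) auto
    then have "\<eta> / D * b (\<zeta> r) (\<zeta> r) \<le> \<eta>" using D by simp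
    then show "J p (\<zeta> r) \<le> (c - \<eta> / D) * b (\<zeta> r) (\<zeta> r)"
      using Jz[OF r] by (simp add: algebra_simps)
  qed
  moreover have "0 < \<eta> / D" using \<eta> D by simp
  ultimately show False by (simp add: c_def[symmetric])
qed


text \<open>
  Every nonnegative multiple \<open>w\<close> of a solution satisfies \<open>J p w = t * b w w\<close>, and the linear term of
  \<open>J_convex_step\<close> vanishes there.  Adding \<open>r \<phi>\<close> to \<open>w\<close> therefore leaves \<open>J p - t * b\<close> at most
  \<open>r\<^sup>2 * (lam - t)\<close>, which is not positive.
\<close>

theorem level_le_solution:
  assumes p: "0 \<le> p" and t: "lam \<le> t" and u: "resolves p t u u"
    and ind: "\<And>c. 0 < b (\<lambda>x. u x - c * \<phi> x) (\<lambda>x. u x - c * \<phi> x)"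
  shows "level p \<le> t"
proof -
  have V: "u \<in> V" using u by (simp add: resolves_def)
  show ?thesis
  proof (rule level_le[OF p eigenfunction_curve[OF V] eigenfunction_curve_pos[OF V ind], of 1 1])
    fix r :: real assume r: "r \<in> {-1..1}"
    define w where "w = (\<lambda>x. (1 - \<bar>r\<bar>) * u x)"
    have w: "resolves p t w w" unfolding w_def using r by (intro resolves_scale u) auto
    then have wV: "w \<in> V" by (simp add: resolves_def)
    have "J p w - t * b w w = 0"
      using w b_pos_part[OF wV] by (simp add: resolves_def J_def)
    moreover define h where "h = (\<lambda>x. r * \<phi> x)"
    have hV: "h \<in> V" by (simp add: h_def)
    have "a w h - p * b (pos_part w) h - t * b w h = 0"
      using w hV unfolding resolves_def by fastforce
    moreover have "a h h - t * b h h \<le> 0"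
    proof -
      have "a h h - t * b h h = (r * r) * (lam - t)"
        unfolding h_def by (simp add: energy_eigenfunction \<phi>_norm algebra_simps)
      also have "\<dots> \<le> 0" using t by (intro mult_nonneg_nonpos) auto
      finally show ?thesis .
    qed
    ultimately have "J p (\<lambda>x. w x + h x) - t * b (\<lambda>x. w x + h x) (\<lambda>x. w x + h x) \<le> 0"
      using J_convex_step[OF wV hV p, of t] by argo
    then have "J p (\<lambda>x. w x + h x) \<le> t * b (\<lambda>x. w x + h x) (\<lambda>x. w x + h x)" by argo
    then show "J p (\<lambda>x. (1 - \<bar>r\<bar>) * u x + r * \<phi> x)
       \<le> t * b (\<lambda>x. (1 - \<bar>r\<bar>) * u x + r * \<phi> x) (\<lambda>x. (1 - \<bar>r\<bar>) * u x + r * \<phi> x)"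
      unfolding w_def h_def .
  next
    show "b (\<lambda>x. (1 - \<bar>- 1\<bar>) * u x + - 1 * \<phi> x + 1 * \<phi> x)
     (\<lambda>x. (1 - \<bar>- 1\<bar>) * u x + - 1 * \<phi> x + 1 * \<phi> x) = 0"
      "b (\<lambda>x. (1 - \<bar>1\<bar>) * u x + 1 * \<phi> x - 1 * \<phi> x)
     (\<lambda>x. (1 - \<bar>1\<bar>) * u x + 1 * \<phi> x - 1 * \<phi> x) = 0"
      using B.linear_left(3)[OF \<phi>_in B.closed(3)[OF \<phi>_in], of 0 0] by auto
  qed auto
qed

text \<open>
  The form \<open>a - lam * b\<close> is nonnegative and vanishes at \<open>w\<close>, so by its Cauchy-Schwarz inequality it
  vanishes against every \<open>v\<close>.
\<close>

lemma minimiser_eigen: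
  assumes w: "w \<in> V" "a w w \<le> lam * b w w" and v: "v \<in> V"
  shows "a w v = lam * b w v"
proof -
  interpret D: semi_inner V "\<lambda>u v. a u v - lam * b u v"
  proof
    show "0 \<le> a u u - lam * b u u" if "u \<in> V" for u using poincare[OF that] by simp
    show "a u v - lam * b u v = a v u - lam * b v u" if "u \<in> V" "v \<in> V" for u v
      using A.sym[OF that] B.sym[OF that] by simp
  qed (auto simp: algebra_simps)
  have "a w w - lam * b w w = 0" using w poincare[OF w(1)] by simp
  then show ?thesis using D.Cauchy_Schwarz_sq[OF w(1) v] by simp
qed

text \<open>
  The interaction \<open>a u\<^sup>+ u\<^sup>-\<close> is nonpositive, so the energy is at least the sum of the energies of the
  two parts; the negative part is estimated by the first eigenvalue.
\<close>

lemma a_parts_le: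
  assumes "u \<in> V"
  shows "a (pos_part u) (pos_part u) + lam * (b u u - b (pos_part u) (pos_part u)) \<le> a u u"
proof -
  define P where "P = pos_part u"
  define N where "N = (\<lambda>x. P x - u x)"
  have V: "P \<in> V" "N \<in> V" using assms by (simp_all add: P_def N_def)
  have bN: "b N N = b u u - b P P"
    using b_pos_part[OF assms] assms V unfolding N_def P_def[symmetric]
    by (simp add: B.sym[of u P])
  have aPN: "a P N \<le> 0"
    using a_pos_part[OF assms] assms V unfolding N_def P_def[symmetric] by simp
  have "u = (\<lambda>x. P x - N x)" by (simp add: N_def)
  then have "a u u = a P P - 2 * a P N + a N N"
    using V A.linear_left(2)[OF V(1) _ V(2)] A.linear_right(2)[OF V(1) _ V(2)] by (simp add: A.sym[of N P])
  then show ?thesis using aPN poincare[OF V(2)] unfolding bN P_def by simp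
qed

text \<open>
  If the level were not above \<open>lam\<close>, every path close to optimal would start at \<open>- \<phi>\<close> with energy so
  low that the positive parts of its points soon after the start, once normalised, keep bounded energy and survive in the limit, on
  a set where the limit of the path itself is negative.
\<close>

theorem lam_less_level:
  assumes p: "0 \<le> p" shows "lam < level p"
proof (rule ccontr)
  assume "\<not> ?thesis"
  then have le: "level p \<le> lam" by simp
  have "\<exists>u\<in>V. b u u = 1 \<and> b (pos_part u) (pos_part u) = 1 / real (Suc n) \<and>
          J p u < lam + (1 / real (Suc n))\<^sup>2" for n
  proof -
    define e where "e = 1 / real (Suc n)"
    have e: "0 < e" "e \<le> 1" by (simp_all add: e_def)
    obtain \<gamma> where g: "\<gamma> \<in> paths" and J: "\<And>r. r \<in> {-1..1} \<Longrightarrow> J p (\<gamma> r) < lam + e\<^sup>2"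
      using ex_path_below[of p "lam + e\<^sup>2"] le e by (smt (verit) zero_less_power)
    have c: "curve \<gamma>" and ng: "\<And>r. r \<in> {-1..1} \<Longrightarrow> b (\<gamma> r) (\<gamma> r) = 1"
      and ends: "b (\<lambda>x. \<gamma> (-1) x + \<phi> x) (\<lambda>x. \<gamma> (-1) x + \<phi> x) = 0"
        "B.sqdist (\<gamma> 1) \<phi> = 0"
      using g by (auto simp: paths_def)
    have V: "\<gamma> (-1) \<in> V" "\<gamma> 1 \<in> V" using curve_in[OF c] by auto
    define P where "P r = b (pos_part (\<gamma> r)) (pos_part (\<gamma> r))" for r
    have cont: "continuous_on {-1..1} P"
      unfolding P_def by (rule continuous_on_curve_pos_part[OF c])
    have same: "b (pos_part v) (pos_part v) = b (pos_part v') (pos_part v')"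
      if "v \<in> V" "v' \<in> V" "B.sqdist v v' = 0" for v v'
    proof -
      have d: "(\<lambda>x. pos_part v x - pos_part v' x) \<in> V" using that by simp
      have "B.sqdist (pos_part v) (pos_part v') = 0"
        using b_pos_part_Lipschitz[OF that(1,2)] B.nonneg[OF d] unfolding that(3) by linarith
      then show ?thesis
        using B.reverse_triangle[of "pos_part v" "pos_part v'"] that by (simp del: B.linear_left B.linear_right)
    qed
    have P1: "P 1 = 1"
    proof -
      have "b (\<lambda>x. pos_part \<phi> x - \<phi> x) v = 0" if "v \<in> V" for v
        using b_null_left[OF _ that \<phi>_nonneg] by simp
      then have "b (pos_part \<phi>) (pos_part \<phi>) = 1"
        using \<phi>_norm by (simp add: B.sym[of \<phi> "pos_part \<phi>"])
      then show ?thesis using same[OF V(2) \<phi>_in ends(2)] by (simp add: P_def)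
    qed
    have Pm: "P (-1) = 0"
    proof -
      have "pos_part (\<lambda>x. - \<phi> x) = (\<lambda>x. pos_part \<phi> x - \<phi> x)"
        by (rule ext) (simp add: pos_part_def max_def)
      then show ?thesis using same[OF V(1) B.closed(4)[OF \<phi>_in]] ends(1) \<phi>_nonneg
        by (simp add: P_def del: B.linear_left B.linear_right)
    qed
    obtain r where r: "r \<in> {-1..1}" "P r = e"
      using IVT'[of P "-1" e 1] cont e Pm P1 by auto
    then show ?thesis using J[OF r(1)] ng[OF r(1)] curve_in[OF c r(1)]
      unfolding P_def e_def by blast
  qed
  then obtain u where u: "\<And>n. u n \<in> V" "\<And>n. b (u n) (u n) = 1"
      "\<And>n. b (pos_part (u n)) (pos_part (u n)) = 1 / real (Suc n)"
      "\<And>n. J p (u n) < lam + (1 / real (Suc n))\<^sup>2" by metis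
  define e where "e n = 1 / real (Suc n)" for n
  have e: "0 < e n" "e n \<le> 1" for n by (simp_all add: e_def)
  have e_lim: "e \<longlonglongrightarrow> 0" unfolding e_def by (rule LIMSEQ_Suc[OF lim_1_over_n])
  have au: "a (u n) (u n) \<le> lam + (e n)\<^sup>2 + p * e n" for n
    using u(3,4)[of n] by (simp add: J_def e_def)
  \<comment> \<open>\<open>e n\<close> is the squared norm of the positive part of \<open>u n\<close>\<close>
  define v where "v n = (\<lambda>x. pos_part (u n) x / sqrt (e n))" for n
  have vV: "v n \<in> V" for n using u by (simp add: v_def)
  have vp: "pos_part (v n) = v n" for n
    using e[of n] by (auto simp: v_def pos_part_def fun_eq_iff)
  have bv: "b (v n) (v n) = 1" for n
  proof -
    have "b (v n) (v n) = b (pos_part (u n)) (pos_part (u n)) / (sqrt (e n) * sqrt (e n))"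
      using u(1)[of n] by (simp add: v_def)
    then show ?thesis using u(3)[of n] e[of n] by (simp add: e_def)
  qed
  have av: "a (v n) (v n) \<le> 1 + p + lam" for n
  proof -
    have "a (pos_part (u n)) (pos_part (u n)) \<le> (e n)\<^sup>2 + p * e n + lam * e n"
      using a_parts_le[OF u(1)[of n]] u(2,3)[of n] au[of n] by (simp add: e_def algebra_simps)
    then have "a (pos_part (u n)) (pos_part (u n)) / e n \<le> e n + p + lam"
      using e[of n] by (simp add: divide_le_eq power2_eq_square algebra_simps)
    then show ?thesis using u(1)[of n] e[of n] by (simp add: v_def)
  qed
  have buv: "0 \<le> b (u n) (v n)" for n
    using u(1,3)[of n] e[of n] b_pos_part[OF u(1)[of n]]
    by (simp add: v_def B.sym[of "u n" "pos_part (u n)"])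
  have "a (u n) (u n) \<le> lam + 1 + p" for n
  proof -
    have "(e n)\<^sup>2 \<le> 1" using e[of n] by (simp add: power_le_one)
    moreover have "p * e n \<le> p" using e[of n] p by (simp add: mult_left_le)
    ultimately show ?thesis using au[of n] by linarith
  qed
  then obtain r w where r: "strict_mono r" and w: "w \<in> V"
    and lw: "(\<lambda>n. B.sqdist (u (r n)) w) \<longlonglongrightarrow> 0"
    using compact_embedding[of u] u(1) by blast
  obtain r' y where r': "strict_mono r'" and y: "y \<in> V"
    and ly: "(\<lambda>n. B.sqdist (v (r (r' n))) y) \<longlonglongrightarrow> 0"
    using compact_embedding[of "\<lambda>n. v (r n)" "1 + p + lam"] vV av by blast
  have lwy: "(\<lambda>n. B.sqdist (u (r (r' n))) w) \<longlonglongrightarrow> 0"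
    using LIMSEQ_subseq_LIMSEQ[OF lw r'] by (simp only: o_def)
  have bw: "b w w = 1"
    using LIMSEQ_unique[OF B.tendsto_norm_sq[OF _ w lw]] u by simp
  have el: "(\<lambda>n. e (r n)) \<longlonglongrightarrow> 0" using LIMSEQ_subseq_LIMSEQ[OF e_lim r] by (simp only: o_def)
  have bwp: "b (pos_part w) (pos_part w) = 0"
  proof (rule LIMSEQ_unique[OF tendsto_pos_part[OF _ w lw]])
    show "(\<lambda>n. b (pos_part (u (r n))) (pos_part (u (r n)))) \<longlonglongrightarrow> 0"
      using el u(3) by (simp add: e_def)
  qed (use u in simp)
  have "a w w \<le> lam + d" if d: "d > 0" for d
  proof (rule a_lower_semicontinuous[OF _ w lw])
    have "(\<lambda>n. lam + (e (r n))\<^sup>2 + p * e (r n)) \<longlonglongrightarrow> lam + 0\<^sup>2 + p * 0"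
      by (intro tendsto_intros el)
    then have "\<forall>\<^sub>F n in sequentially. lam + (e (r n))\<^sup>2 + p * e (r n) < lam + d"
      using d by (intro order_tendstoD(2)) auto
    then show "\<forall>\<^sub>F n in sequentially. a (u (r n)) (u (r n)) \<le> lam + d"
    proof eventually_elim
      case (elim n)
      then show ?case using au[of "r n"] by argo
    qed
  qed (use u in simp)
  then have "a w w \<le> lam" by (rule field_le_epsilon)
  then have weig: "a w x = lam * b w x" if "x \<in> V" for x
    using minimiser_eigen[OF w _ that] bw by simp
  have by1: "b y y = 1"
    using LIMSEQ_unique[OF B.tendsto_norm_sq[OF _ y ly]] vV bv by simp
  have byp: "b (pos_part y) (pos_part y) = 1"
    using LIMSEQ_unique[OF tendsto_pos_part[OF _ y ly]] vV bv vp by simp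
  have "B.sqdist (pos_part y) y = 0"
    using b_pos_part[OF y] by1 byp y by (simp add: B.sym[of y "pos_part y"])
  then have "b (\<lambda>x. pos_part y x - y x) w = 0" using b_null_left[OF _ w] y by simp
  then have wy: "b w (pos_part y) = b y w" using y w by (simp add: B.sym[of w "pos_part y"])
  \<comment> \<open>\<open>b (v n) (u n) \<ge> 0\<close> passes to the limit because \<open>v n\<close> has norm one\<close>
  have "0 \<le> b y w"
  proof (rule tendsto_le[OF sequentially_bot])
    have "(\<lambda>n. b (v (r (r' n))) w) \<longlonglongrightarrow> b y w" using vV y w ly by (intro B.tendsto_inner) auto
    then show "(\<lambda>n. b (v (r (r' n))) w + sqrt (B.sqdist (u (r (r' n))) w))
        \<longlonglongrightarrow> b y w"
      using tendsto_add[OF _ tendsto_real_sqrt[OF lwy], of _ "b y w"]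
      by (simp only: real_sqrt_zero add_0_right)
    show "(\<lambda>n. 0 :: real) \<longlonglongrightarrow> 0" by simp
    have "0 \<le> b (v n) w + sqrt (B.sqdist (u n) w)" for n
    proof -
      have d: "(\<lambda>x. u n x - w x) \<in> V" using u w by simp
      have "\<bar>b (\<lambda>x. u n x - w x) (v n)\<bar> \<le> sqrt (B.sqdist (u n) w)"
        using B.Cauchy_Schwarz[OF d vV[of n]] by (simp add: bv del: B.linear_left B.linear_right)
      moreover have "b (\<lambda>x. u n x - w x) (v n) = b (u n) (v n) - b (v n) w"
        using u(1) w vV by (simp add: B.sym[of w "v n"])
      ultimately show ?thesis using buv[of n] by linarith
    qed
    then show "\<forall>\<^sub>F n in sequentially. 0 \<le> b (v (r (r' n))) w
        + sqrt (B.sqdist (u (r (r' n))) w)" by simp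
  qed
  then have "b (pos_part y) (pos_part y) = 0"
    using strong_maximum[OF w weig bwp _ y] bw wy by simp
  then show False using byp by simp
qed


text \<open>
  The strong maximum principle for \<open>- \<phi>\<close>.
\<close>

lemma eigenfunction_positive:
  assumes u: "u \<in> V" and "b \<phi> (pos_part u) = 0"
  shows "b (pos_part u) (pos_part u) = 0"
proof (rule strong_maximum[of "\<lambda>x. - \<phi> x"])
  have "pos_part (\<lambda>x. - \<phi> x) = (\<lambda>x. pos_part \<phi> x - \<phi> x)"
    by (rule ext) (simp add: pos_part_def max_def)
  then show "b (pos_part (\<lambda>x. - \<phi> x)) (pos_part (\<lambda>x. - \<phi> x)) = 0"
    using \<phi>_nonneg by simp
qed (use assms \<phi>_norm \<phi>_eigen in \<open>simp_all add: B.closed(4)\<close>)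

text \<open>
  Testing with \<open>u\<^sup>-\<close> gives \<open>lam \<le> t\<close> unless \<open>u\<^sup>-\<close> vanishes.  In that case \<open>u\<close> is nonnegative, and
  testing with \<open>\<phi>\<close> gives \<open>p + t = lam\<close>.
\<close>

lemma lam_le_of_solution:
  assumes u: "resolves p t u u" and nz: "b u u \<noteq> 0" and nt: "p + t \<noteq> lam"
  shows "lam \<le> t"
proof -
  define P where "P = pos_part u"
  define N where "N = (\<lambda>x. P x - u x)"
  have uV: "u \<in> V" using u by (simp add: resolves_def)
  then have V: "P \<in> V" "N \<in> V" by (simp_all add: P_def N_def)
  have bPu: "b P u = b P P" "b u P = b P P"
    using b_pos_part[OF uV] B.sym[OF uV V(1)] by (simp_all add: P_def)
  have bN: "b N N = b u u - b P P" "b u N = - b N N" "b P N = 0"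
    unfolding N_def using bPu uV V by simp_all
  have aPN: "a P N \<le> 0"
    using a_pos_part[OF uV] uV V unfolding N_def P_def[symmetric] by simp
  have "a u N = a P N - a N N"
    using V A.linear_left(2)[OF V(1) V(2) V(2)] by (simp add: N_def)
  moreover have "a u N = - t * b N N" using u V(2) bN by (simp add: resolves_def P_def algebra_simps)
  ultimately have key: "lam * b N N \<le> t * b N N" using aPN poincare[OF V(2)] by simp
  show ?thesis
  proof (cases "b N N = 0")
    case False
    then have "0 < b N N" using B.nonneg[OF V(2)] by simp
    then show ?thesis using key by (simp only: mult_le_cancel_right_pos)
  next
    case True
    have "b N \<phi> = 0" by (rule b_null_left[OF V(2) \<phi>_in True])
    then have bPp: "b P \<phi> = b u \<phi>" unfolding N_def using uV V by simp
    have "a u \<phi> = (p + t) * b u \<phi>"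
      using u bPp by (simp add: resolves_def P_def algebra_simps)
    moreover have "a u \<phi> = lam * b u \<phi>"
      using \<phi>_eigen[OF uV] A.sym[OF uV \<phi>_in] B.sym[OF uV \<phi>_in] by simp
    ultimately have "b u \<phi> = 0" using nt by simp
    then have "b P P = 0" using eigenfunction_positive[OF uV] bPp B.sym[OF \<phi>_in V(1)] by (simp add: P_def)
    then show ?thesis using True bN nz by simp
  qed
qed

lemma solution_independent_of_eigenfunction:
  assumes p: "0 \<le> p" "0 \<le> t" and u: "resolves p t u u" and nz: "b u u \<noteq> 0"
    and nt: "t \<noteq> lam" "p + t \<noteq> lam"
  shows "0 < b (\<lambda>x. u x - c * \<phi> x) (\<lambda>x. u x - c * \<phi> x)"
proof (rule ccontr)
  assume n: "\<not> ?thesis"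
  have uV: "u \<in> V" using u by (simp add: resolves_def)
  then have z: "b (\<lambda>x. u x - c * \<phi> x) (\<lambda>x. u x - c * \<phi> x) = 0"
    using n B.nonneg[of "\<lambda>x. u x - c * \<phi> x"] by (simp del: B.linear_left B.linear_right)
  have coef: "b u \<phi> = k" if "b (\<lambda>x. u x - k * \<phi> x) (\<lambda>x. u x - k * \<phi> x) = 0" for k
    using b_null_left[OF _ \<phi>_in that] uV \<phi>_norm by simp
  have c0: "c \<noteq> 0"
    using z nz by auto
  show False
  proof (cases "c > 0")
    case True
    have "resolves p t (\<lambda>x. c * \<phi> x) (\<lambda>x. c * ((p + t) / lam * \<phi> x))"
      using True by (intro resolves_scale resolves_eigenfunction) simp
    from resolves_cong[OF u this p z] have "b (\<lambda>x. u x - (c * ((p + t) / lam)) * \<phi> x)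
        (\<lambda>x. u x - (c * ((p + t) / lam)) * \<phi> x) = 0" by (simp only: mult.assoc)
    from coef[OF this] coef[OF z] have "c * ((p + t) / lam) = c" by simp
    then have "c * (p + t) = c * lam" using lam_pos by (simp add: divide_eq_eq)
    then show False using mult_left_cancel[OF c0, of "p + t" lam] nt by blast
  next
    case False
    have "resolves p t (\<lambda>x. (- c) * - \<phi> x) (\<lambda>x. (- c) * (- (t / lam * \<phi> x)))"
      using False by (intro resolves_scale resolves_neg_eigenfunction) simp
    then have "resolves p t (\<lambda>x. c * \<phi> x) (\<lambda>x. c * (t / lam) * \<phi> x)" by (simp add: mult.assoc)
    from resolves_cong[OF u this p z] coef[OF z] coef[of "c * (t / lam)"]
    have "c * (t / lam) = c" by simp
    then have "c * t = c * lam" using lam_pos by (simp add: divide_eq_eq)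
    then show False using mult_left_cancel[OF c0, of t lam] nt by blast
  qed
qed

end

section \<open>Lebesgue measure on a product space\<close>

lemma nn_integral_lborel_iterated:
  fixes H :: "'a::euclidean_space \<times> 'b::euclidean_space \<Rightarrow> ennreal"
  assumes "H \<in> borel_measurable borel"
  shows "(\<integral>\<^sup>+z. H z \<partial>lborel) = (\<integral>\<^sup>+x. \<integral>\<^sup>+y. H (x, y) \<partial>lborel \<partial>lborel)"
    "(\<integral>\<^sup>+z. H z \<partial>lborel) = (\<integral>\<^sup>+y. \<integral>\<^sup>+x. H (x, y) \<partial>lborel \<partial>lborel)"
proof -
  have m: "H \<in> borel_measurable (lborel \<Otimes>\<^sub>M lborel)" using assms by (simp add: lborel_prod)
  show "(\<integral>\<^sup>+z. H z \<partial>lborel) = (\<integral>\<^sup>+x. \<integral>\<^sup>+y. H (x, y) \<partial>lborel \<partial>lborel)"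
    using lborel.nn_integral_fst[OF m] by (simp add: lborel_prod)
  show "(\<integral>\<^sup>+z. H z \<partial>lborel) = (\<integral>\<^sup>+y. \<integral>\<^sup>+x. H (x, y) \<partial>lborel \<partial>lborel)"
    using lborel_pair.nn_integral_snd[OF m] by (simp add: lborel_prod)
qed

lemma nn_integral_lborel_tensor:
  fixes F :: "'a::euclidean_space \<Rightarrow> ennreal" and G :: "'b::euclidean_space \<Rightarrow> ennreal"
  assumes [measurable]: "F \<in> borel_measurable borel" "G \<in> borel_measurable borel"
  shows "(\<integral>\<^sup>+z. F (fst z) * G (snd z) \<partial>lborel) = (\<integral>\<^sup>+x. F x \<partial>lborel) * (\<integral>\<^sup>+y. G y \<partial>lborel)"
proof -
  have "(\<lambda>z. F (fst z) * G (snd z)) \<in> borel_measurable borel" by (simp add: borel_prod[symmetric])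
  from nn_integral_lborel_iterated(1)[OF this] show ?thesis
    by (simp add: nn_integral_cmult nn_integral_multc)
qed

lemma lborel_distr_reflect:
  fixes t :: "'a::euclidean_space" shows "distr lborel borel (\<lambda>x. t - x) = lborel"
  using lborel_affine[of "-1" t, symmetric] by (simp add: density_1)

lemma lborel_distr_translate:
  fixes t :: "'a::euclidean_space" shows "distr lborel borel (\<lambda>x. x - t) = lborel"
proof -
  have "(+) (- t) = (\<lambda>x. x - t)" by auto
  then show ?thesis using lborel_distr_plus[of "- t"] by simp
qed

lemma nn_integral_lborel_shear:
  fixes F G :: "'a::euclidean_space \<Rightarrow> ennreal"
  assumes [measurable]: "F \<in> borel_measurable borel" "G \<in> borel_measurable borel"
  shows "(\<integral>\<^sup>+z. F (fst z) * G (fst z - snd z) \<partial>lborel) = (\<integral>\<^sup>+x. F x \<partial>lborel) * (\<integral>\<^sup>+y. G y \<partial>lborel)"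
    and "(\<integral>\<^sup>+z. F (snd z) * G (fst z - snd z) \<partial>lborel) = (\<integral>\<^sup>+x. F x \<partial>lborel) * (\<integral>\<^sup>+y. G y \<partial>lborel)"
proof -
  have 1: "(\<integral>\<^sup>+y. G (x - y) \<partial>lborel) = (\<integral>\<^sup>+y. G y \<partial>lborel)" for x
    by (subst lborel_distr_reflect[of x, symmetric], subst nn_integral_distr) auto
  have 2: "(\<integral>\<^sup>+x. G (x - y) \<partial>lborel) = (\<integral>\<^sup>+y. G y \<partial>lborel)" for y
    by (subst lborel_distr_translate[of y, symmetric], subst nn_integral_distr) auto
  have "(\<lambda>z. F (fst z) * G (fst z - snd z)) \<in> borel_measurable borel"
    "(\<lambda>z. F (snd z) * G (fst z - snd z)) \<in> borel_measurable borel"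
    by (simp_all add: borel_prod[symmetric])
  from nn_integral_lborel_iterated(1)[OF this(1)] nn_integral_lborel_iterated(2)[OF this(2)]
  show "(\<integral>\<^sup>+z. F (fst z) * G (fst z - snd z) \<partial>lborel) = (\<integral>\<^sup>+x. F x \<partial>lborel) * (\<integral>\<^sup>+y. G y \<partial>lborel)"
    "(\<integral>\<^sup>+z. F (snd z) * G (fst z - snd z) \<partial>lborel) = (\<integral>\<^sup>+x. F x \<partial>lborel) * (\<integral>\<^sup>+y. G y \<partial>lborel)"
    by (simp_all add: nn_integral_cmult nn_integral_multc 1 2)
qed

text \<open>
  A Borel map under which preimages of null sets are null.  Such maps pull back Lebesgue measurable
  functions and almost everywhere statements.
\<close>

definition nonsingular :: "('b::euclidean_space \<Rightarrow> 'a::euclidean_space) \<Rightarrow> bool" where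
  "nonsingular T \<longleftrightarrow> T \<in> borel_measurable borel \<and>
     (\<forall>N\<in>null_sets lborel. T -` N \<in> null_sets lborel)"

text \<open>
  The three maps through which \<open>u x\<close>, \<open>u y\<close> and \<open>K (x - y)\<close> depend on the pair \<open>(x, y)\<close>.
\<close>

lemma nonsingular_coordinates:
  "nonsingular (fst :: 'a::euclidean_space \<times> 'a \<Rightarrow> 'a)"
  "nonsingular (snd :: 'a::euclidean_space \<times> 'a \<Rightarrow> 'a)"
  "nonsingular (\<lambda>z :: 'a::euclidean_space \<times> 'a. fst z - snd z)"
proof -
  have m: "fst \<in> borel_measurable (borel :: ('a \<times> 'a) measure)"
    "snd \<in> borel_measurable (borel :: ('a \<times> 'a) measure)"
    by (auto simp: borel_prod[symmetric])
  have aux: "T -` N \<in> null_sets lborel"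
    if N: "N \<in> null_sets lborel" and T: "T \<in> borel_measurable borel"
      and z: "(\<integral>\<^sup>+z. indicator N (T z) \<partial>lborel) = 0"
    for N :: "'a set" and T :: "'a \<times> 'a \<Rightarrow> 'a"
  proof -
    have "N \<in> sets borel" using N by (auto simp: null_sets_def)
    then have s: "T -` N \<in> sets lborel" using measurable_sets[OF T, of N] by simp
    have "emeasure lborel (T -` N) = (\<integral>\<^sup>+z. indicator (T -` N) z \<partial>lborel)"
      using s by simp
    also have "\<dots> = (\<integral>\<^sup>+z. indicator N (T z) \<partial>lborel)"
      by (simp add: indicator_def vimage_def)
    finally show ?thesis using s z by (simp add: null_sets_def)
  qed
  have N0: "(\<integral>\<^sup>+x. indicator N x \<partial>lborel) = 0" "indicator N \<in> borel_measurable (borel :: 'a measure)"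
    if "N \<in> null_sets lborel" for N :: "'a set"
    using that by (auto simp: null_sets_def)
  show "nonsingular (fst :: 'a \<times> 'a \<Rightarrow> 'a)" unfolding nonsingular_def
  proof (intro conjI ballI)
    fix N :: "'a set" assume N: "N \<in> null_sets lborel"
    show "fst -` N \<in> null_sets (lborel :: ('a \<times> 'a) measure)"
      using nn_integral_lborel_tensor[OF N0(2)[OF N], of "\<lambda>_::'a. 1"] N0(1)[OF N]
      by (intro aux[OF N m(1)]) simp
  qed (rule m)
  show "nonsingular (snd :: 'a \<times> 'a \<Rightarrow> 'a)" unfolding nonsingular_def
  proof (intro conjI ballI)
    fix N :: "'a set" assume N: "N \<in> null_sets lborel"
    show "snd -` N \<in> null_sets (lborel :: ('a \<times> 'a) measure)"
      using nn_integral_lborel_tensor[OF _ N0(2)[OF N], of "\<lambda>_::'a. 1"] N0(1)[OF N]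
      by (intro aux[OF N m(2)]) simp
  qed (rule m)
  show "nonsingular (\<lambda>z :: 'a \<times> 'a. fst z - snd z)" unfolding nonsingular_def
  proof (intro conjI ballI)
    show d: "(\<lambda>z :: 'a \<times> 'a. fst z - snd z) \<in> borel_measurable borel" using m by simp
    fix N :: "'a set" assume N: "N \<in> null_sets lborel"
    show "(\<lambda>z :: 'a \<times> 'a. fst z - snd z) -` N \<in> null_sets (lborel :: ('a \<times> 'a) measure)"
      using nn_integral_lborel_shear(1)[OF _ N0(2)[OF N], of "\<lambda>_::'a. 1"] N0(1)[OF N]
      by (intro aux[OF N d]) simp
  qed
qed

lemma AE_nonsingular:
  assumes T: "nonsingular T" and P: "AE x in lebesgue. P x"
  shows "AE z in lebesgue. P (T z)"
proof -
  have "AE x in lborel. P x" using P by (simp add: AE_completion_iff)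
  then obtain N where N: "N \<in> null_sets lborel" "{x. \<not> P x} \<subseteq> N"
    unfolding eventually_ae_filter by auto
  then have "T -` N \<in> null_sets lborel" using T by (simp add: nonsingular_def)
  then have "AE z in lborel. z \<notin> T -` N" by (rule AE_not_in)
  then have "AE z in lborel. P (T z)" by eventually_elim (use N in auto)
  then show ?thesis by (simp add: AE_completion_iff)
qed

lemma borel_representative:
  fixes f :: "'a::euclidean_space \<Rightarrow> real"
  assumes "f \<in> borel_measurable lebesgue"
  obtains g where "g \<in> borel_measurable borel" "AE x in lebesgue. f x = g x"
  using completion_ex_borel_measurable_real[OF assms] by (auto simp: AE_completion_iff)

lemma measurable_nonsingular:
  fixes f :: "'a::euclidean_space \<Rightarrow> real"
  assumes T: "nonsingular T" and f: "f \<in> borel_measurable lebesgue"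
  shows "(\<lambda>z. f (T z)) \<in> borel_measurable lebesgue"
proof -
  obtain g where g: "g \<in> borel_measurable borel" "AE x in lebesgue. f x = g x"
    by (rule borel_representative[OF f])
  have "(\<lambda>z. g (T z)) \<in> borel_measurable borel"
    using T g(1) by (auto simp: nonsingular_def intro: measurable_compose)
  then have "(\<lambda>z. g (T z)) \<in> borel_measurable lebesgue"
    by (intro measurable_completion) simp
  moreover have "AE z in lebesgue. g (T z) = f (T z)"
    using AE_nonsingular[OF T g(2)] by eventually_elim simp
  ultimately show ?thesis by (rule borel_measurable_AE)
qed

text \<open>
  The shear \<open>(x, y) \<mapsto> (x, x - y)\<close> and its mirror image preserve Lebesgue measure, so the last two
  claims have the same reason as the first.  For Lebesgue measurable functions everything is proved on
  Borel representatives.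
\<close>

lemma integrable_tensor:
  fixes f :: "'a::euclidean_space \<Rightarrow> real" and g :: "'a \<Rightarrow> real"
  assumes f: "integrable lebesgue f" and g: "integrable lebesgue g"
  shows "integrable lebesgue (\<lambda>z. f (fst z) * g (snd z))"
    "integral\<^sup>L lebesgue (\<lambda>z. f (fst z) * g (snd z)) = integral\<^sup>L lebesgue f * integral\<^sup>L lebesgue g"
    "integrable lebesgue (\<lambda>z. f (fst z) * g (fst z - snd z))"
    "integrable lebesgue (\<lambda>z. f (snd z) * g (fst z - snd z))"
proof -
  obtain f' where f': "f' \<in> borel_measurable borel" "AE x in lebesgue. f x = f' x"
    using f by (auto intro: borel_representative[of f])
  obtain g' where g': "g' \<in> borel_measurable borel" "AE x in lebesgue. g x = g' x"
    using g by (auto intro: borel_representative[of g])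
  note [measurable] = f'(1) g'(1)
  have rep: "integrable lborel h'" "integral\<^sup>L lborel h' = integral\<^sup>L lebesgue h" if "integrable lebesgue h" "h' \<in> borel_measurable borel"
      "AE x in lebesgue. h x = h' x" for h h' :: "'a \<Rightarrow> real"
  proof -
    have b: "h' \<in> borel_measurable lborel" using that(2) by simp
    have "integrable lebesgue h'"
      using integrable_cong_AE[OF borel_measurable_integrable[OF that(1)] measurable_completion[OF b] that(3)]
        that(1) by simp
    then show "integrable lborel h'" by (simp add: integrable_completion[OF b])
    show "integral\<^sup>L lborel h' = integral\<^sup>L lebesgue h"
      using integral_cong_AE[OF borel_measurable_integrable[OF that(1)] measurable_completion[OF b] that(3)]
        integral_completion[OF b] by simp
  qed
  have if': "integrable lborel f'" "integrable lborel g'"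
    using rep(1)[OF f f'] rep(1)[OF g g'] .
  have fin: "(\<integral>\<^sup>+x. ennreal \<bar>f' x\<bar> \<partial>lborel) < \<infinity>" "(\<integral>\<^sup>+x. ennreal \<bar>g' x\<bar> \<partial>lborel) < \<infinity>"
    using if' by (auto simp: integrable_iff_bounded)
  have m: "fst \<in> borel_measurable (borel :: ('a \<times> 'a) measure)"
    "snd \<in> borel_measurable (borel :: ('a \<times> 'a) measure)"
    by (auto simp: borel_prod[symmetric])
  note [measurable] = m
  have A: "integrable lborel (\<lambda>z. f' (fst z) * g' (snd z))"
    unfolding integrable_iff_bounded
    using nn_integral_lborel_tensor[of "\<lambda>x. ennreal \<bar>f' x\<bar>" "\<lambda>x. ennreal \<bar>g' x\<bar>"] fin
    by (auto simp: ennreal_mult' abs_mult ennreal_mult_less_top)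
  have B: "integrable lborel (\<lambda>z. f' (fst z) * g' (fst z - snd z))"
    unfolding integrable_iff_bounded
    using nn_integral_lborel_shear(1)[of "\<lambda>x. ennreal \<bar>f' x\<bar>" "\<lambda>x. ennreal \<bar>g' x\<bar>"] fin
    by (auto simp: ennreal_mult' abs_mult ennreal_mult_less_top)
  have C: "integrable lborel (\<lambda>z. f' (snd z) * g' (fst z - snd z))"
    unfolding integrable_iff_bounded
    using nn_integral_lborel_shear(2)[of "\<lambda>x. ennreal \<bar>f' x\<bar>" "\<lambda>x. ennreal \<bar>g' x\<bar>"] fin
    by (auto simp: ennreal_mult' abs_mult ennreal_mult_less_top)
  have mf: "f \<in> borel_measurable lebesgue" "g \<in> borel_measurable lebesgue" using f g by auto
  note ns = nonsingular_coordinates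
  have eA: "AE z in lebesgue. f' (fst z) * g' (snd z) = f (fst z) * g (snd z)"
    using AE_nonsingular[OF ns(1) f'(2)] AE_nonsingular[OF ns(2) g'(2)] by eventually_elim simp
  have eB: "AE z in lebesgue. f' (fst z) * g' (fst z - snd z) = f (fst z) * g (fst z - snd z)"
    using AE_nonsingular[OF ns(1) f'(2)] AE_nonsingular[OF ns(3) g'(2)] by eventually_elim simp
  have eC: "AE z in lebesgue. f' (snd z) * g' (fst z - snd z) = f (snd z) * g (fst z - snd z)"
    using AE_nonsingular[OF ns(2) f'(2)] AE_nonsingular[OF ns(3) g'(2)] by eventually_elim simp
  have tr: "integrable lebesgue h" "integral\<^sup>L lebesgue h = integral\<^sup>L lborel h'"
    if "integrable lborel h'" "AE z in lebesgue. h' z = h z" for h h' :: "'a \<times> 'a \<Rightarrow> real"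
  proof -
    have h': "h' \<in> borel_measurable lborel" using that by auto
    have m': "h' \<in> borel_measurable lebesgue" using h' by (rule measurable_completion)
    have mh: "h \<in> borel_measurable lebesgue" by (rule borel_measurable_AE[OF m' that(2)])
    have "integrable lebesgue h'" using that(1) h' by (simp add: integrable_completion)
    then show "integrable lebesgue h" using integrable_cong_AE[OF m' mh that(2)] by simp
    show "integral\<^sup>L lebesgue h = integral\<^sup>L lborel h'"
      using integral_cong_AE[OF m' mh that(2)] integral_completion[OF h'] by simp
  qed
  show "integrable lebesgue (\<lambda>z. f (fst z) * g (snd z))"
    "integrable lebesgue (\<lambda>z. f (fst z) * g (fst z - snd z))"
    "integrable lebesgue (\<lambda>z. f (snd z) * g (fst z - snd z))"
    using tr(1)[OF A eA] tr(1)[OF B eB] tr(1)[OF C eC] .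
  have "integral\<^sup>L lebesgue (\<lambda>z. f (fst z) * g (snd z)) = integral\<^sup>L lborel (\<lambda>z. f' (fst z) * g' (snd z))"
    by (rule tr(2)[OF A eA])
  also have "\<dots> = integral\<^sup>L (lborel \<Otimes>\<^sub>M lborel) (\<lambda>z. f' (fst z) * g' (snd z))"
    by (simp only: lborel_prod)
  also have "\<dots> = (\<integral>x. (\<integral>y. f' x * g' y \<partial>lborel) \<partial>lborel)"
    using A by (subst lborel_pair.integral_fst'[symmetric]) (simp_all add: lborel_prod)
  also have "\<dots> = integral\<^sup>L lborel f' * integral\<^sup>L lborel g'" by simp
  also have "\<dots> = integral\<^sup>L lebesgue f * integral\<^sup>L lebesgue g"
    using rep(2)[OF f f'] rep(2)[OF g g'] by simp
  finally show "integral\<^sup>L lebesgue (\<lambda>z. f (fst z) * g (snd z)) = integral\<^sup>L lebesgue f * integral\<^sup>L lebesgue g" .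
qed

section \<open>The nonlocal energy form\<close>

lemma integrable_mult_of_squares:
  fixes f g :: "'a \<Rightarrow> real"
  assumes [measurable]: "f \<in> borel_measurable M" "g \<in> borel_measurable M"
    and i: "integrable M (\<lambda>x. (f x)\<^sup>2)" "integrable M (\<lambda>x. (g x)\<^sup>2)"
  shows "integrable M (\<lambda>x. f x * g x)"
proof (rule Bochner_Integration.integrable_bound[OF Bochner_Integration.integrable_add[OF i]])
  have "\<bar>u * v\<bar> \<le> u\<^sup>2 + v\<^sup>2" for u v :: real
    using sum_squares_bound[of "\<bar>u\<bar>" "\<bar>v\<bar>"] mult_nonneg_nonneg[of "\<bar>u\<bar>" "\<bar>v\<bar>"]
    unfolding abs_mult power2_abs by linarith
  then show "AE x in M. norm (f x * g x) \<le> norm ((f x)\<^sup>2 + (g x)\<^sup>2)" by auto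
qed measurable

locale nonlocal_form =
  fixes K :: "'a::euclidean_space \<Rightarrow> real" and \<Omega> :: "'a set" and s :: real
  assumes s_pos: "0 < s" and K_adm: "admissible_kernel s K"
    and \<Omega>_open: "open \<Omega>" and \<Omega>_bounded: "bounded \<Omega>" and \<Omega>_ne: "\<Omega> \<noteq> {}"
begin

abbreviation V where "V \<equiv> X0_space K \<Omega>"
abbreviation energy where "energy \<equiv> X0_form K \<Omega>"

text \<open>
  The weighted difference whose square integrates to the energy; the energy form is thus the inner
  product of \<open>D u\<close> and \<open>D v\<close> in \<open>L\<^sup>2\<close>.  On the diagonal, where the kernel is unconstrained, the
  difference vanishes.
\<close>

definition D :: "('a \<Rightarrow> real) \<Rightarrow> 'a \<times> 'a \<Rightarrow> real" where
  "D u z = indicator (Q_set \<Omega>) z * ((u (fst z) - u (snd z)) * sqrt (K (fst z - snd z)))"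

definition R :: "('a \<Rightarrow> real) \<Rightarrow> 'a \<Rightarrow> real" where
  "R u x = indicator \<Omega> x * u x"

definition L2 :: "('a \<Rightarrow> real) \<Rightarrow> ('a \<Rightarrow> real) \<Rightarrow> real" where
  "L2 u v = (LINT x:\<Omega>|lebesgue. u x * v x)"

lemma K_pos: "x \<noteq> 0 \<Longrightarrow> 0 < K x"
  using K_adm by (simp add: admissible_kernel_def)

lemma K_lower: obtains l where "0 < l" "\<And>x. x \<noteq> 0 \<Longrightarrow> l * norm x powr (- (real DIM('a) + 2 * s)) \<le> K x"
  using K_adm by (auto simp: admissible_kernel_def)

lemma K_moment: "integrable lebesgue (\<lambda>x. min ((norm x)\<^sup>2) 1 * K x)"
  using K_adm by (simp add: admissible_kernel_def)

lemma K_measurable: "K \<in> borel_measurable lebesgue"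
proof (rule borel_measurable_AE)
  have m: "(\<lambda>x::'a. min ((norm x)\<^sup>2) 1) \<in> borel_measurable lebesgue"
    by (intro measurable_completion) simp
  show "(\<lambda>x. (min ((norm x)\<^sup>2) 1 * K x) / min ((norm x)\<^sup>2) 1) \<in> borel_measurable lebesgue"
    by (rule borel_measurable_divide[OF borel_measurable_integrable[OF K_moment] m])
  have "AE x in lebesgue. (x::'a) \<noteq> 0"
    by (simp add: AE_completion_iff AE_lborel_singleton)
  then show "AE x in lebesgue. (min ((norm x)\<^sup>2) 1 * K x) / min ((norm x)\<^sup>2) 1 = K x"
    by eventually_elim (simp add: min_def)
qed

lemma \<Omega>_sets: "\<Omega> \<in> sets lebesgue" using \<Omega>_open by simp

lemma Q_sets: "Q_set \<Omega> \<in> sets lebesgue"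
proof -
  have "closed ((UNIV - \<Omega>) \<times> (UNIV - \<Omega>))"
    using \<Omega>_open by (intro closed_Times) (auto simp: closed_def Compl_eq_Diff_UNIV[symmetric])
  then have "open (Q_set \<Omega>)" unfolding Q_set_def by (simp add: open_Diff)
  then show ?thesis by simp
qed

lemma mem_Q: "z \<in> Q_set \<Omega> \<longleftrightarrow> fst z \<in> \<Omega> \<or> snd z \<in> \<Omega>"
  by (cases z) (auto simp: Q_set_def)

lemma R_measurable: "u \<in> borel_measurable lebesgue \<Longrightarrow> R u \<in> borel_measurable lebesgue"
  unfolding R_def[abs_def] using \<Omega>_sets by measurable

lemma coords_measurable:
  fixes u :: "'a \<Rightarrow> real"
  assumes "u \<in> borel_measurable lebesgue"
  shows "(\<lambda>z. u (fst z)) \<in> borel_measurable (lebesgue :: ('a \<times> 'a) measure)"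
    "(\<lambda>z. u (snd z)) \<in> borel_measurable (lebesgue :: ('a \<times> 'a) measure)"
    "(\<lambda>z. u (fst z - snd z)) \<in> borel_measurable (lebesgue :: ('a \<times> 'a) measure)"
  using assms by (auto intro: measurable_nonsingular nonsingular_coordinates)

lemma D_measurable: "u \<in> borel_measurable lebesgue \<Longrightarrow> D u \<in> borel_measurable lebesgue"
  unfolding D_def[abs_def]
  by (intro borel_measurable_times borel_measurable_diff borel_measurable_indicator Q_sets
      coords_measurable measurable_compose[OF coords_measurable(3)[OF K_measurable]]) simp_all

lemma sqrt_K_sq: "(d * sqrt (K (x - y))) * (e * sqrt (K (x - y))) = d * e * K (x - y)"
  if "x = y \<Longrightarrow> d = 0"
proof (cases "x = y")
  case False
  then have "sqrt (K (x - y)) * sqrt (K (x - y)) = K (x - y)"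
    using K_pos[of "x - y"] by simp
  then show ?thesis by (metis (no_types, lifting) mult.assoc mult.left_commute)
qed (use that in simp)

lemma form_eq: "energy u v = (\<integral>z. D u z * D v z \<partial>lebesgue)"
  unfolding X0_form_def set_lebesgue_integral_def
proof (rule Bochner_Integration.integral_cong[OF refl])
  fix z :: "'a \<times> 'a"
  show "indicat_real (Q_set \<Omega>) z *\<^sub>R (case z of (x, y) \<Rightarrow> (u x - u y) * (v x - v y) * K (x - y)) = D u z * D v z"
    using sqrt_K_sq[of "fst z" "snd z" "u (fst z) - u (snd z)" "v (fst z) - v (snd z)"]
    by (auto simp: D_def case_prod_beta indicator_def)
qed

lemma L2_eq: "L2 u v = (\<integral>x. R u x * R v x \<partial>lebesgue)"
  unfolding L2_def set_lebesgue_integral_def R_def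
  by (rule Bochner_Integration.integral_cong) (auto simp: indicator_def)

lemma norm_eq: "X0_norm K \<Omega> u = sqrt (energy u u)"
  unfolding X0_norm_def X0_form_def by (simp add: power2_eq_square)

lemma V_iff: "u \<in> V \<longleftrightarrow> u \<in> borel_measurable lebesgue \<and> (AE x in lebesgue. x \<notin> \<Omega> \<longrightarrow> u x = 0) \<and>
    integrable lebesgue (\<lambda>x. (R u x)\<^sup>2) \<and> integrable lebesgue (\<lambda>z. (D u z)\<^sup>2)"
proof -
  have "(\<lambda>x. indicat_real \<Omega> x *\<^sub>R (u x)\<^sup>2) = (\<lambda>x. (R u x)\<^sup>2)"
    by (auto simp: R_def indicator_def)
  moreover have "(\<lambda>z. indicat_real (Q_set \<Omega>) z *\<^sub>R (case z of (x, y) \<Rightarrow> ((u x - u y) * sqrt (K (x - y)))\<^sup>2))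
      = (\<lambda>z. (D u z)\<^sup>2)"
    by (auto simp: D_def case_prod_beta indicator_def)
  ultimately show ?thesis
    unfolding X0_space_def X_space_def set_integrable_def by auto
qed

lemma R_lin: "R (\<lambda>x. c * u x + d * v x) = (\<lambda>x. c * R u x + d * R v x)"
  by (rule ext) (simp add: R_def algebra_simps)

lemma D_lin: "D (\<lambda>x. c * u x + d * v x) = (\<lambda>x. c * D u x + d * D v x)"
  by (rule ext) (simp add: D_def algebra_simps)

lemma V_D: assumes "u \<in> V"
  shows "u \<in> borel_measurable lebesgue" "AE x in lebesgue. x \<notin> \<Omega> \<longrightarrow> u x = 0"
    "R u \<in> borel_measurable lebesgue" "D u \<in> borel_measurable lebesgue"
    "integrable lebesgue (\<lambda>x. (R u x)\<^sup>2)" "integrable lebesgue (\<lambda>z. (D u z)\<^sup>2)"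
  using assms R_measurable D_measurable by (auto simp: V_iff)

lemma DD_integrable: "u \<in> V \<Longrightarrow> v \<in> V \<Longrightarrow> integrable lebesgue (\<lambda>z. D u z * D v z)"
  by (rule integrable_mult_of_squares[OF V_D(4) V_D(4) V_D(6) V_D(6)])

lemma RR_integrable: "u \<in> V \<Longrightarrow> v \<in> V \<Longrightarrow> integrable lebesgue (\<lambda>z. R u z * R v z)"
  by (rule integrable_mult_of_squares[OF V_D(3) V_D(3) V_D(5) V_D(5)])

lemma integrable_sq_lin:
  fixes f g :: "'b \<Rightarrow> real"
  assumes "f \<in> borel_measurable M" "g \<in> borel_measurable M"
    and "integrable M (\<lambda>x. (f x)\<^sup>2)" "integrable M (\<lambda>x. (g x)\<^sup>2)"
  shows "integrable M (\<lambda>x. (c * f x + d * g x)\<^sup>2)"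
proof -
  have "integrable M (\<lambda>x. c\<^sup>2 * (f x)\<^sup>2 + 2 * c * d * (f x * g x) + d\<^sup>2 * (g x)\<^sup>2)"
    using assms integrable_mult_of_squares[OF assms] by auto
  then show ?thesis by (simp add: power2_eq_square algebra_simps)
qed

lemma V_lin:
  assumes "u \<in> V" "v \<in> V" shows "(\<lambda>x. c * u x + d * v x) \<in> V"
  unfolding V_iff R_lin D_lin
proof (intro conjI)
  show "(\<lambda>x. c * u x + d * v x) \<in> borel_measurable lebesgue"
    using V_D(1)[OF assms(1)] V_D(1)[OF assms(2)] by simp
  show "AE x in lebesgue. x \<notin> \<Omega> \<longrightarrow> c * u x + d * v x = 0"
    using V_D(2)[OF assms(1)] V_D(2)[OF assms(2)] by eventually_elim simp
qed (use V_D[OF assms(1)] V_D[OF assms(2)] in \<open>auto intro: integrable_sq_lin\<close>)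

sublocale A: semi_inner V "energy"
proof
  fix u v w :: "'a \<Rightarrow> real" and c d :: real
  assume "u \<in> V" "v \<in> V" "w \<in> V"
  then show "energy (\<lambda>x. c * u x + d * v x) w = c * energy u w + d * energy v w"
    unfolding form_eq D_lin using DD_integrable by (simp add: distrib_right mult.assoc)
qed (simp_all add: V_lin form_eq mult.commute)

sublocale B: semi_inner V L2
proof
  fix u v w :: "'a \<Rightarrow> real" and c d :: real
  assume "u \<in> V" "v \<in> V" "w \<in> V"
  then show "L2 (\<lambda>x. c * u x + d * v x) w = c * L2 u w + d * L2 v w"
    unfolding L2_eq R_lin using RR_integrable by (simp add: distrib_right mult.assoc)
qed (simp_all add: V_lin L2_eq mult.commute)

lemma pos_part_V:
  assumes u: "u \<in> V" shows "pos_part u \<in> V"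
  unfolding V_iff
proof (intro conjI)
  show m: "pos_part u \<in> borel_measurable lebesgue"
    using V_D(1)[OF u] unfolding pos_part_def[abs_def] by measurable
  show "AE x in lebesgue. x \<notin> \<Omega> \<longrightarrow> pos_part u x = 0"
    using V_D(2)[OF u] by eventually_elim (simp add: pos_part_def)
  show "integrable lebesgue (\<lambda>x. (R (pos_part u) x)\<^sup>2)"
  proof (rule Bochner_Integration.integrable_bound[OF V_D(5)[OF u]])
    show "AE x in lebesgue. norm ((R (pos_part u) x)\<^sup>2) \<le> norm ((R u x)\<^sup>2)"
      by (auto simp: R_def pos_part_def indicator_def max_def)
  qed (use R_measurable[OF m] in simp)
  show "integrable lebesgue (\<lambda>z. (D (pos_part u) z)\<^sup>2)"
  proof (rule Bochner_Integration.integrable_bound[OF V_D(6)[OF u]])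
    have "\<bar>max x 0 - max y 0\<bar>\<^sup>2 \<le> \<bar>x - y\<bar>\<^sup>2" for x y :: real
      by (intro power_mono) auto
    then have "(max x 0 - max y 0)\<^sup>2 \<le> (x - y)\<^sup>2" for x y :: real by simp
    then have "(D (pos_part u) z)\<^sup>2 \<le> (D u z)\<^sup>2" for z
      unfolding D_def pos_part_def power_mult_distrib
      by (intro mult_left_mono mult_right_mono) auto
    then show "AE z in lebesgue. norm ((D (pos_part u) z)\<^sup>2) \<le> norm ((D u z)\<^sup>2)" by simp
  qed (use D_measurable[OF m] in simp)
qed

lemma form_pos_part:
  assumes u: "u \<in> V"
  shows "energy (pos_part u) (pos_part u) \<le> energy (pos_part u) u"
  unfolding form_eq
proof (rule integral_mono)
  fix z :: "'a \<times> 'a"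
  have key: "(max x 0 - max y 0) * (max x 0 - max y 0) \<le> (max x 0 - max y 0) * (x - y)" for x y :: real
    by (cases "x \<ge> 0"; cases "y \<ge> 0") (auto simp: algebra_simps mult_nonneg_nonpos mult_nonpos_nonneg)
  have "D (pos_part u) z * D v z = (indicator (Q_set \<Omega>) z * sqrt (K (fst z - snd z)))\<^sup>2 *
      ((pos_part u (fst z) - pos_part u (snd z)) * (v (fst z) - v (snd z)))" for v
    by (simp add: D_def power2_eq_square)
  then show "D (pos_part u) z * D (pos_part u) z \<le> D (pos_part u) z * D u z"
    using key by (simp add: pos_part_def mult_left_mono)
qed (use u pos_part_V in \<open>auto intro: DD_integrable\<close>)

lemma L2_pos_part: "L2 (pos_part u) u = L2 (pos_part u) (pos_part u)"
  unfolding L2_def pos_part_def by (intro set_lebesgue_integral_cong) (auto simp: max_def \<Omega>_sets)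

lemma L2_pos_part_Lipschitz:
  assumes u: "u \<in> V" and v: "v \<in> V"
  shows "B.sqdist (pos_part u) (pos_part v)
        \<le> B.sqdist u v"
  unfolding L2_eq
proof (rule integral_mono)
  have "\<bar>max x 0 - max y 0\<bar>\<^sup>2 \<le> \<bar>x - y\<bar>\<^sup>2" for x y :: real
    by (intro power_mono) auto
  then have "(max x 0 - max y 0) * (max x 0 - max y 0) \<le> (x - y) * (x - y)" for x y :: real
    by (simp add: power2_eq_square)
  then show "R (\<lambda>x. pos_part u x - pos_part v x) x * R (\<lambda>x. pos_part u x - pos_part v x) x
      \<le> R (\<lambda>x. u x - v x) x * R (\<lambda>x. u x - v x) x" for x
    by (simp add: R_def pos_part_def indicator_def)
qed (use u v pos_part_V in \<open>auto intro!: RR_integrable\<close>)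

lemma L2_pos_part_convex:
  assumes u: "u \<in> V" and h: "h \<in> V"
  shows "L2 (pos_part u) (pos_part u) + 2 * L2 (pos_part u) h
        \<le> L2 (pos_part (\<lambda>x. u x + h x)) (pos_part (\<lambda>x. u x + h x))"
proof -
  have key: "max x 0 * max x 0 + 2 * (max x 0 * y) \<le> max (x + y) 0 * max (x + y) 0" for x y :: real
  proof (cases "x \<ge> 0")
    case True
    show ?thesis
    proof (cases "x + y \<ge> 0")
      case False
      then have "x * (x + 2 * y) \<le> 0" using True by (intro mult_nonneg_nonpos) auto
      then show ?thesis using True False by (simp add: algebra_simps)
    next
      case le: True
      have "0 \<le> y * y" by simp
      then show ?thesis using True le by (simp add: algebra_simps)
    qed
  qed simp
  have "L2 (pos_part u) (pos_part u) + 2 * L2 (pos_part u) h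
      = (\<integral>x. R (pos_part u) x * R (pos_part u) x + 2 * (R (pos_part u) x * R h x) \<partial>lebesgue)"
    unfolding L2_eq using RR_integrable u h pos_part_V by simp
  also have "\<dots> \<le> L2 (pos_part (\<lambda>x. u x + h x)) (pos_part (\<lambda>x. u x + h x))"
    unfolding L2_eq
  proof (rule integral_mono)
    show "R (pos_part u) x * R (pos_part u) x + 2 * (R (pos_part u) x * R h x)
       \<le> R (pos_part (\<lambda>x. u x + h x)) x * R (pos_part (\<lambda>x. u x + h x)) x" for x
      using key by (simp add: R_def pos_part_def indicator_def)
  qed (use u h pos_part_V RR_integrable in auto)
  finally show ?thesis .
qed

lemma L2_zero_iff:
  assumes u: "u \<in> V" shows "L2 u u = 0 \<longleftrightarrow> (AE x in lebesgue. u x = 0)"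
proof -
  have "L2 u u = 0 \<longleftrightarrow> (AE x in lebesgue. R u x * R u x = 0)"
    unfolding L2_eq using RR_integrable[OF u u] by (intro integral_nonneg_eq_0_iff_AE) auto
  also have "\<dots> \<longleftrightarrow> (AE x in lebesgue. u x = 0)"
  proof
    assume "AE x in lebesgue. R u x * R u x = 0"
    with V_D(2)[OF u] show "AE x in lebesgue. u x = 0"
      by eventually_elim (auto simp: R_def indicator_def split: if_splits)
  next
    assume "AE x in lebesgue. u x = 0"
    then show "AE x in lebesgue. R u x * R u x = 0" by eventually_elim (simp add: R_def)
  qed
  finally show ?thesis .
qed

lemma form_null:
  assumes u: "u \<in> V" and z: "L2 u u = 0" shows "energy u u = 0"
proof -
  have ae: "AE x in lebesgue. u x = 0" using z L2_zero_iff[OF u] by simp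
  have "AE z in lebesgue. D u z * D u z = 0"
    using AE_nonsingular[OF nonsingular_coordinates(1) ae] AE_nonsingular[OF nonsingular_coordinates(2) ae]
    by eventually_elim (simp add: D_def)
  then show ?thesis unfolding form_eq by (rule integral_eq_zero_AE)
qed

end

section \<open>Poincare inequality and compact embedding\<close>

text \<open>
  Fatou's lemma for squares; the bound is only required eventually so that it applies to tails.
\<close>

lemma Fatou_square:
  fixes f :: "nat \<Rightarrow> 'b \<Rightarrow> real"
  assumes f: "\<And>k. f k \<in> borel_measurable M" and g: "g \<in> borel_measurable M"
    and i: "\<And>k. integrable M (\<lambda>x. (f k x)\<^sup>2)"
    and le: "\<forall>\<^sub>F k in sequentially. (\<integral>x. (f k x)\<^sup>2 \<partial>M) \<le> C"
    and lim: "AE x in M. (\<lambda>k. f k x) \<longlonglongrightarrow> g x"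
  shows "integrable M (\<lambda>x. (g x)\<^sup>2)" "(\<integral>x. (g x)\<^sup>2 \<partial>M) \<le> C"
proof -
  note [measurable] = f g
  have C: "0 \<le> C"
  proof -
    obtain k where "(\<integral>x. (f k x)\<^sup>2 \<partial>M) \<le> C" using le by (auto simp: eventually_sequentially)
    moreover have "0 \<le> (\<integral>x. (f k x)\<^sup>2 \<partial>M)" by simp
    ultimately show ?thesis by linarith
  qed
  have "(\<integral>\<^sup>+x. ennreal ((g x)\<^sup>2) \<partial>M) = (\<integral>\<^sup>+x. liminf (\<lambda>k. ennreal ((f k x)\<^sup>2)) \<partial>M)"
  proof (rule nn_integral_cong_AE)
    show "AE x in M. ennreal ((g x)\<^sup>2) = liminf (\<lambda>k. ennreal ((f k x)\<^sup>2))"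
      using lim
    proof eventually_elim
      case (elim x)
      then have "(\<lambda>k. ennreal ((f k x)\<^sup>2)) \<longlonglongrightarrow> ennreal ((g x)\<^sup>2)"
        by (intro tendsto_ennrealI tendsto_power)
      from lim_imp_Liminf[OF _ this] show ?case by simp
    qed
  qed
  also have "\<dots> \<le> liminf (\<lambda>k. \<integral>\<^sup>+x. ennreal ((f k x)\<^sup>2) \<partial>M)" by (rule nn_integral_liminf) measurable
  also have "\<dots> \<le> limsup (\<lambda>k. \<integral>\<^sup>+x. ennreal ((f k x)\<^sup>2) \<partial>M)" by (rule Liminf_le_Limsup) simp
  also have "\<dots> \<le> ennreal C"
  proof (rule Limsup_bounded)
    show "\<forall>\<^sub>F k in sequentially. (\<integral>\<^sup>+x. ennreal ((f k x)\<^sup>2) \<partial>M) \<le> ennreal C"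
      using le by eventually_elim (use i in \<open>simp add: nn_integral_eq_integral C\<close>)
  qed
  finally have b: "(\<integral>\<^sup>+x. ennreal ((g x)\<^sup>2) \<partial>M) \<le> ennreal C" .
  then show "integrable M (\<lambda>x. (g x)\<^sup>2)"
    unfolding integrable_iff_bounded by (auto intro: le_less_trans)
  show "(\<integral>x. (g x)\<^sup>2 \<partial>M) \<le> C"
    using b C by (subst integral_eq_nn_integral) (auto intro: enn2real_leI)
qed

lemma subsequence_tails_small:
  fixes d :: "nat \<Rightarrow> nat \<Rightarrow> real" and \<epsilon> :: "nat \<Rightarrow> real"
  assumes "\<And>e. 0 < e \<Longrightarrow> \<exists>N. \<forall>m\<ge>N. \<forall>n\<ge>N. d m n \<le> e" and "\<And>k. 0 < \<epsilon> k"
  obtains r :: "nat \<Rightarrow> nat" where "strict_mono r" "\<And>k m n. m \<ge> r k \<Longrightarrow> n \<ge> r k \<Longrightarrow> d m n \<le> \<epsilon> k"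
proof -
  obtain N where N: "\<And>k m n. m \<ge> N k \<Longrightarrow> n \<ge> N k \<Longrightarrow> d m n \<le> \<epsilon> k"
    using assms(1)[OF assms(2)] by metis
  define r where "r k = k + (\<Sum>i\<le>k. N i)" for k
  have "strict_mono r" by (simp add: strict_mono_Suc_iff r_def)
  moreover have "N k \<le> r k" for k
    unfolding r_def using member_le_sum[of k "{..k}" N] by auto
  ultimately show ?thesis using that[of r] N order_trans by blast
qed

text \<open>
  With weights \<open>2\<^sup>k\<close> the squared increments still have a finite total integral, so their weighted sum is
  finite almost everywhere; by \<open>\<bar>d\<bar> \<le> 2\<^sup>-\<^sup>k + 2\<^sup>k d\<^sup>2\<close> the increments themselves are then
  summable.
\<close>

lemma AE_convergent_of_fast_Cauchy:
  fixes g :: "nat \<Rightarrow> 'b \<Rightarrow> real"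
  assumes g: "\<And>k. g k \<in> borel_measurable M"
    and i: "\<And>k. integrable M (\<lambda>x. (g (Suc k) x - g k x)\<^sup>2)"
    and le: "\<And>k. (\<integral>x. (g (Suc k) x - g k x)\<^sup>2 \<partial>M) \<le> (1/4) ^ k"
  shows "AE x in M. convergent (\<lambda>k. g k x)"
proof -
  note [measurable] = g
  have "(\<integral>\<^sup>+x. (\<Sum>k. ennreal (2 ^ k * (g (Suc k) x - g k x)\<^sup>2)) \<partial>M)
      = (\<Sum>k. \<integral>\<^sup>+x. ennreal (2 ^ k * (g (Suc k) x - g k x)\<^sup>2) \<partial>M)"
    by (rule nn_integral_suminf) measurable
  also have "\<dots> \<le> (\<Sum>k. ennreal ((1/2) ^ k))"
  proof (rule suminf_le)
    fix k
    have "(\<integral>\<^sup>+x. ennreal (2 ^ k * (g (Suc k) x - g k x)\<^sup>2) \<partial>M)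
        = ennreal (2 ^ k * (\<integral>x. (g (Suc k) x - g k x)\<^sup>2 \<partial>M))"
      using i[of k] by (subst nn_integral_eq_integral) auto
    also have "\<dots> \<le> ennreal (2 ^ k * (1/4) ^ k)"
      using le[of k] by (intro ennreal_leI mult_left_mono) auto
    also have "2 ^ k * (1/4) ^ k = ((1/2) ^ k :: real)" by (simp flip: power_mult_distrib)
    finally show "(\<integral>\<^sup>+x. ennreal (2 ^ k * (g (Suc k) x - g k x)\<^sup>2) \<partial>M) \<le> ennreal ((1/2) ^ k)" .
  qed auto
  also have "\<dots> < \<infinity>"
    by (subst suminf_ennreal_eq[of _ 2]) (auto intro: geometric_sums[of "1/2::real", simplified])
  finally have "AE x in M. (\<Sum>k. ennreal (2 ^ k * (g (Suc k) x - g k x)\<^sup>2)) \<noteq> \<infinity>"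
    by (intro nn_integral_PInf_AE) auto
  then show ?thesis
  proof eventually_elim
    case (elim x)
    define \<Delta> where "\<Delta> k = g (Suc k) x - g k x" for k
    have "summable (\<lambda>k. 2 ^ k * (\<Delta> k)\<^sup>2)"
      using elim unfolding \<Delta>_def by (intro summable_suminf_not_top) auto
    then have s: "summable (\<lambda>k. (1/2) ^ k + 2 ^ k * (\<Delta> k)\<^sup>2)"
      by (intro summable_add summable_geometric) auto
    have "norm (\<Delta> k) \<le> (1/2) ^ k + 2 ^ k * (\<Delta> k)\<^sup>2" for k
    proof -
      define q :: real where "q = 2 ^ k"
      have q: "q > 0" by (simp add: q_def)
      have "(q * \<bar>\<Delta> k\<bar> - 1)\<^sup>2 = q * (q * (\<Delta> k)\<^sup>2) + 1 - 2 * (q * \<bar>\<Delta> k\<bar>)"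
        unfolding power2_diff power_mult_distrib power2_abs by (simp add: power2_eq_square)
      then have "2 * (q * \<bar>\<Delta> k\<bar>) \<le> q * (q * (\<Delta> k)\<^sup>2) + 1"
        using zero_le_power2[of "q * \<bar>\<Delta> k\<bar> - 1"] by linarith
      moreover have "0 \<le> q * \<bar>\<Delta> k\<bar>" using q by simp
      moreover have "q * (1 / q + q * (\<Delta> k)\<^sup>2) = q * (q * (\<Delta> k)\<^sup>2) + 1"
        using q by (simp add: distrib_left)
      ultimately have "q * \<bar>\<Delta> k\<bar> \<le> q * (1 / q + q * (\<Delta> k)\<^sup>2)" by linarith
      then have "\<bar>\<Delta> k\<bar> \<le> 1 / q + q * (\<Delta> k)\<^sup>2" using q by simp
      then show ?thesis by (simp add: q_def power_one_over)
    qed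
    then have "summable \<Delta>" by (rule summable_comparison_test'[OF s])
    then have "convergent (\<lambda>n. \<Sum>k<n. \<Delta> k)" by (simp add: summable_iff_convergent)
    then have "convergent (\<lambda>n. g n x - g 0 x)" by (simp add: \<Delta>_def sum_lessThan_telescope[of "\<lambda>k. g k x"])
    then have "convergent (\<lambda>n. (g n x - g 0 x) + g 0 x)" by (intro convergent_add convergent_const)
    then show ?case by simp
  qed
qed

lemma common_convergent_subsequence:
  fixes f :: "'c \<Rightarrow> nat \<Rightarrow> real"
  assumes "finite F" "\<And>c. c \<in> F \<Longrightarrow> bounded (range (f c))"
  shows "\<exists>r :: nat \<Rightarrow> nat. strict_mono r \<and> (\<forall>c\<in>F. convergent (\<lambda>n. f c (r n)))"
  using assms
proof (induction F rule: finite_induct)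
  case empty
  show ?case by (rule exI[of _ id]) (auto simp: strict_mono_def)
next
  case (insert c F)
  then obtain r where r: "strict_mono r" "\<And>c. c \<in> F \<Longrightarrow> convergent (\<lambda>n. f c (r n))" by auto
  have "bounded (range (\<lambda>n. f c (r n)))"
    using insert.prems[of c] by (rule bounded_subset) auto
  then obtain l r' where r': "strict_mono r'" "((\<lambda>n. f c (r n)) \<circ> r') \<longlonglongrightarrow> l"
    using bounded_imp_convergent_subsequence by metis
  have "convergent (\<lambda>n. f d ((r \<circ> r') n))" if "d \<in> insert c F" for d
  proof (cases "d = c")
    case True
    then show ?thesis using r'(2) by (auto simp: o_def convergent_def)
  next
    case False
    then have "convergent (\<lambda>n. f d (r n))" using that r by auto
    then show ?thesis using convergent_subseq_convergent[OF _ r'(1)] by (auto simp: o_def)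
  qed
  then show ?case using strict_mono_o[OF r(1) r'(1)] by blast
qed

context nonlocal_form begin

lemma kernel_bounded_below:
  assumes "0 < l" and l: "\<And>x. x \<noteq> 0 \<Longrightarrow> l * norm x powr (- (real DIM('a) + 2 * s)) \<le> K x"
    and "x \<noteq> 0" "norm x \<le> d"
  shows "l * d powr (- (real DIM('a) + 2 * s)) \<le> K x"
proof -
  have "d powr (- (real DIM('a) + 2 * s)) \<le> norm x powr (- (real DIM('a) + 2 * s))"
    using assms s_pos by (intro powr_mono2') auto
  then have "l * d powr (- (real DIM('a) + 2 * s)) \<le> l * norm x powr (- (real DIM('a) + 2 * s))"
    using assms(1) by (intro mult_left_mono) auto
  also have "\<dots> \<le> K x" by (rule l[OF assms(3)])
  finally show ?thesis .
qed

text \<open>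
  Compare \<open>u\<close> in \<open>\<Omega>\<close> with its value zero in a ball \<open>A\<close> outside \<open>\<Omega>\<close>.  For \<open>x\<close> in \<open>\<Omega>\<close> and \<open>y\<close>
  in \<open>A\<close> the kernel is bounded below, so \<open>(u x)\<^sup>2 = (u x - u y)\<^sup>2\<close> integrated over such pairs is bounded
  by the energy.
\<close>

lemma Poincare: "\<exists>c>0. \<forall>u\<in>V. c * L2 u u \<le> energy u u"
proof -
  obtain r where r: "r > 0" "\<Omega> \<subseteq> ball 0 r"
    using bounded_subset_ballD[OF \<Omega>_bounded, of 0] by auto
  obtain e :: 'a where e: "e \<in> Basis" using nonempty_Basis by blast
  \<comment> \<open>a ball of radius \<open>r\<close> that is disjoint from the ball of radius \<open>r\<close> around the origin\<close>
  define A where "A = ball ((3 * r) *\<^sub>R e) r"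
  have far: "x \<noteq> y" "norm (x - y) \<le> 5 * r" "y \<notin> \<Omega>" if "x \<in> \<Omega>" "y \<in> A" for x y
  proof -
    have x: "norm x < r" using that r by auto
    have y: "norm (y - (3 * r) *\<^sub>R e) < r" using that by (simp add: A_def dist_norm norm_minus_commute)
    have n: "norm ((3 * r) *\<^sub>R e) = 3 * r" using e r by simp
    have "norm y > 2 * r" using norm_triangle_ineq2[of "(3 * r) *\<^sub>R e" "(3 * r) *\<^sub>R e - y"] y n
      by (simp add: norm_minus_commute)
    then show "x \<noteq> y" "y \<notin> \<Omega>" using x r by auto
    have "norm y < 4 * r" using norm_triangle_ineq2[of y "(3 * r) *\<^sub>R e"] y n by simp
    then show "norm (x - y) \<le> 5 * r" using norm_triangle_ineq4[of x y] x by simp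
  qed
  obtain l where l: "0 < l" "\<And>x. x \<noteq> 0 \<Longrightarrow> l * norm x powr (- (real DIM('a) + 2 * s)) \<le> K x"
    using K_lower by metis
  define k where "k = l * (5 * r) powr (- (real DIM('a) + 2 * s))"
  have k: "k > 0" using l r by (simp add: k_def)
  have Km: "k \<le> K (x - y)" if "x \<in> \<Omega>" "y \<in> A" for x y
    unfolding k_def using far[OF that] by (intro kernel_bounded_below[OF l]) auto
  have mA: "0 < measure lebesgue A" unfolding A_def using r by (simp add: content_ball_pos)
  have iA: "integrable lebesgue (\<lambda>y. indicat_real A y)"
    unfolding A_def using lmeasurable_ball by (simp only: lmeasurable_iff_integrable)
  have "k * measure lebesgue A * L2 u u \<le> energy u u" if u: "u \<in> V" for u
  proof -
    have "k * measure lebesgue A * L2 u u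
        = k * (integral\<^sup>L lebesgue (\<lambda>x. (R u x)\<^sup>2) * integral\<^sup>L lebesgue (\<lambda>y. indicat_real A y))"
      by (simp add: L2_eq power2_eq_square mult.assoc mult.commute[of "measure lebesgue A"])
    also have "\<dots> = (\<integral>z. k * ((R u (fst z))\<^sup>2 * indicat_real A (snd z)) \<partial>lebesgue)"
      using integrable_tensor(2)[OF V_D(5)[OF u] iA] by simp
    also have "\<dots> \<le> (\<integral>z. (D u z)\<^sup>2 \<partial>lebesgue)"
    proof (rule integral_mono_AE)
      show "integrable lebesgue (\<lambda>z. k * ((R u (fst z))\<^sup>2 * indicat_real A (snd z)))"
        using integrable_tensor(1)[OF V_D(5)[OF u] iA] by simp
      show "integrable lebesgue (\<lambda>z. (D u z)\<^sup>2)" by (rule V_D(6)[OF u])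
      show "AE z in lebesgue. k * ((R u (fst z))\<^sup>2 * indicat_real A (snd z)) \<le> (D u z)\<^sup>2"
        using AE_nonsingular[OF nonsingular_coordinates(2) V_D(2)[OF u]]
      proof eventually_elim
        case (elim z)
        show ?case
        proof (cases "fst z \<in> \<Omega> \<and> snd z \<in> A")
          case True
          then have "u (snd z) = 0" using elim far by blast
          moreover have "0 < K (fst z - snd z)" using True far(1) by (intro K_pos) auto
          moreover have "k \<le> K (fst z - snd z)" using True Km by blast
          ultimately show ?thesis using True
            by (simp add: D_def R_def mem_Q power_mult_distrib mult.commute mult_right_mono)
        qed (auto simp: R_def)
      qed
    qed
    also have "\<dots> = energy u u" by (simp add: form_eq power2_eq_square)
    finally show ?thesis .
  qed
  then show ?thesis using k mA by (intro exI[of _ "k * measure lebesgue A"]) auto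
qed

text \<open>
  The half-open cube of side \<open>1/N\<close> of the grid of mesh \<open>1/N\<close> that contains \<open>x\<close>.
\<close>

definition cell :: "nat \<Rightarrow> 'a \<Rightarrow> 'a set" where
  "cell N x = {y. \<forall>i\<in>Basis. \<lfloor>real N * (y \<bullet> i)\<rfloor> = \<lfloor>real N * (x \<bullet> i)\<rfloor>}"

lemma cell_diameter:
  assumes "0 < N" "y \<in> cell N x" "z \<in> cell N x" shows "norm (y - z) \<le> real DIM('a) / real N"
proof -
  have "\<bar>(y - z) \<bullet> i\<bar> \<le> 1 / real N" if i: "i \<in> Basis" for i
  proof -
    have "\<lfloor>real N * (y \<bullet> i)\<rfloor> = \<lfloor>real N * (z \<bullet> i)\<rfloor>" using assms i by (simp add: cell_def)
    then have "\<bar>real N * (y \<bullet> i) - real N * (z \<bullet> i)\<bar> \<le> 1" by linarith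
    then have "real N * \<bar>(y - z) \<bullet> i\<bar> \<le> 1"
      by (simp add: inner_diff_left abs_mult flip: right_diff_distrib)
    then show ?thesis using assms(1) by (simp add: field_simps)
  qed
  then have "(\<Sum>i\<in>Basis. \<bar>(y - z) \<bullet> i\<bar>) \<le> real DIM('a) * (1 / real N)"
    by (intro sum_bounded_above) auto
  then show ?thesis using norm_le_l1[of "y - z"] by simp
qed

lemma cell_lmeasurable: assumes "0 < N" shows "cell N x \<in> lmeasurable"
proof -
  have "cell N x = (\<Inter>i\<in>Basis. (\<lambda>y. \<lfloor>real N * (y \<bullet> i)\<rfloor>) -` {\<lfloor>real N * (x \<bullet> i)\<rfloor>} \<inter> space borel)"
    by (auto simp: cell_def)
  also have "\<dots> \<in> sets borel"
  proof (rule sets.finite_INT)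
    fix i :: 'a assume "i \<in> Basis"
    have "(\<lambda>y::'a. \<lfloor>real N * (y \<bullet> i)\<rfloor>) \<in> measurable borel (count_space UNIV)" by measurable
    then show "(\<lambda>y. \<lfloor>real N * (y \<bullet> i)\<rfloor>) -` {\<lfloor>real N * (x \<bullet> i)\<rfloor>} \<inter> space borel \<in> sets borel"
      by (rule measurable_sets) simp
  qed auto
  finally have "cell N x \<in> sets lebesgue" by simp
  moreover have "bounded (cell N x)"
    unfolding bounded_def using cell_diameter[OF assms, of x x]
    by (intro exI[of _ x] exI[of _ "real DIM('a) / real N"] ballI)
       (use cell_diameter[OF assms] in \<open>auto simp: dist_norm cell_def\<close>)
  ultimately show ?thesis by (rule bounded_set_imp_lmeasurable[rotated])
qed

lemma cell_measure: assumes N: "0 < N" shows "(1 / real N) ^ DIM('a) \<le> measure lebesgue (cell N x)"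
proof -
  define lo where "lo = (\<Sum>i\<in>Basis. (real_of_int \<lfloor>real N * (x \<bullet> i)\<rfloor> / real N) *\<^sub>R i)"
  define hi where "hi = (\<Sum>i\<in>Basis. ((real_of_int \<lfloor>real N * (x \<bullet> i)\<rfloor> + 1) / real N) *\<^sub>R i)"
  have lh: "lo \<bullet> i = real_of_int \<lfloor>real N * (x \<bullet> i)\<rfloor> / real N"
    "hi \<bullet> i = (real_of_int \<lfloor>real N * (x \<bullet> i)\<rfloor> + 1) / real N" if "i \<in> Basis" for i
    using that by (simp_all add: lo_def hi_def)
  have "box lo hi \<subseteq> cell N x"
  proof
    fix y assume y: "y \<in> box lo hi"
    have "\<lfloor>real N * (y \<bullet> i)\<rfloor> = \<lfloor>real N * (x \<bullet> i)\<rfloor>" if i: "i \<in> Basis" for i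
    proof -
      have "lo \<bullet> i < y \<bullet> i" "y \<bullet> i < hi \<bullet> i" using y i by (auto simp: mem_box)
      then show ?thesis using N unfolding lh[OF i] by (intro floor_unique) (auto simp: field_simps)
    qed
    then show "y \<in> cell N x" by (simp add: cell_def)
  qed
  then have "measure lebesgue (box lo hi) \<le> measure lebesgue (cell N x)"
    by (rule measure_mono_fmeasurable[OF _ _ cell_lmeasurable[OF N]]) simp
  moreover have "measure lebesgue (box lo hi) = (1 / real N) ^ DIM('a)"
  proof -
    have "measure lebesgue (box lo hi) = (\<Prod>i\<in>Basis. (hi - lo) \<bullet> i)"
      using N by (subst measure_completion) (auto simp: measure_lborel_box_eq lh divide_right_mono)
    also have "\<dots> = (\<Prod>i\<in>(Basis::'a set). 1 / real N)"
      by (rule prod.cong) (auto simp: inner_diff_left lh diff_divide_distrib add_divide_distrib)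
    finally show ?thesis by simp
  qed
  ultimately show ?thesis by simp
qed

lemma finite_cells: "finite (cell N ` \<Omega>)"
proof -
  obtain r where r: "\<And>x. x \<in> \<Omega> \<Longrightarrow> norm x \<le> r" using \<Omega>_bounded by (auto simp: bounded_iff)
  define M where "M = \<lceil>real N * r\<rceil> + 1"
  let ?P = "PiE (Basis :: 'a set) (\<lambda>_. {- M..M})"
  have "cell N ` \<Omega> \<subseteq> (\<lambda>f. {y. \<forall>i\<in>Basis. \<lfloor>real N * (y \<bullet> i)\<rfloor> = f i}) ` ?P"
  proof (rule image_subsetI)
    fix x assume x: "x \<in> \<Omega>"
    have "\<lfloor>real N * (x \<bullet> i)\<rfloor> \<in> {- M..M}" if "i \<in> Basis" for i
    proof -
      have "\<bar>x \<bullet> i\<bar> \<le> r" using Basis_le_norm[OF that, of x] r[OF x] by simp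
      then have "\<bar>real N * (x \<bullet> i)\<bar> \<le> real N * r" by (simp add: abs_mult mult_left_mono)
      then show ?thesis unfolding M_def by (simp, linarith)
    qed
    then show "cell N x \<in> (\<lambda>f. {y. \<forall>i\<in>Basis. \<lfloor>real N * (y \<bullet> i)\<rfloor> = f i}) ` ?P"
      by (intro image_eqI[of _ _ "\<lambda>i\<in>Basis. \<lfloor>real N * (x \<bullet> i)\<rfloor>"]) (auto simp: cell_def)
  qed
  moreover have "finite ?P" by (intro finite_PiE) auto
  ultimately show ?thesis by (rule finite_subset[OF _ finite_imageI])
qed

lemma cell_self: "x \<in> cell N x" by (simp add: cell_def)

lemma cell_eq: "y \<in> cell N x \<Longrightarrow> cell N y = cell N x" by (auto simp: cell_def)

definition oscillation :: "('a \<Rightarrow> real) \<Rightarrow> 'a set \<Rightarrow> real" where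
  "oscillation w C =
     (\<integral>z. indicat_real C (fst z) * indicat_real C (snd z) * (w (fst z) - w (snd z))\<^sup>2 \<partial>lebesgue)"

text \<open>
  The last claim is the variance identity, obtained by expanding the square under the double integral.
\<close>

lemma cell_variance:
  assumes w: "w \<in> V" and C: "C \<in> lmeasurable"
  shows "integrable lebesgue (\<lambda>x. indicat_real C x * R w x)"
    "integrable lebesgue (\<lambda>x. indicat_real C x * (R w x)\<^sup>2)"
    "integrable lebesgue (\<lambda>z. indicat_real C (fst z) * indicat_real C (snd z) * (R w (fst z) - R w (snd z))\<^sup>2)"
    "oscillation (R w) C = 2 * measure lebesgue C * (\<integral>x. indicat_real C x * (R w x)\<^sup>2 \<partial>lebesgue)
        - 2 * (\<integral>x. indicat_real C x * R w x \<partial>lebesgue)\<^sup>2"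
proof -
  have iC: "integrable lebesgue (indicat_real C)" using C by (simp only: lmeasurable_iff_integrable)
  have mC: "C \<in> sets lebesgue" using C by (rule fmeasurableD)
  have sq: "(\<lambda>x. (indicat_real C x)\<^sup>2) = indicat_real C" by (auto simp: indicator_def)
  show i1: "integrable lebesgue (\<lambda>x. indicat_real C x * R w x)"
    using iC V_D(5)[OF w] V_D(3)[OF w] mC by (intro integrable_mult_of_squares) (auto simp: sq)
  show i2: "integrable lebesgue (\<lambda>x. indicat_real C x * (R w x)\<^sup>2)"
    using integrable_mult_indicator[OF mC V_D(5)[OF w]] by simp
  note t1 = integrable_tensor(1,2)[OF i2 iC] and t2 = integrable_tensor(1,2)[OF i1 i1]
    and t3 = integrable_tensor(1,2)[OF iC i2]
  have e: "indicat_real C (fst z) * indicat_real C (snd z) * (R w (fst z) - R w (snd z))\<^sup>2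
     = (indicat_real C (fst z) * (R w (fst z))\<^sup>2) * indicat_real C (snd z)
      - 2 * ((indicat_real C (fst z) * R w (fst z)) * (indicat_real C (snd z) * R w (snd z)))
      + indicat_real C (fst z) * (indicat_real C (snd z) * (R w (snd z))\<^sup>2)" for z
    by (simp add: power2_diff algebra_simps)
  show "integrable lebesgue (\<lambda>z. indicat_real C (fst z) * indicat_real C (snd z) * (R w (fst z) - R w (snd z))\<^sup>2)"
    unfolding e by (intro Bochner_Integration.integrable_add Bochner_Integration.integrable_diff
        integrable_mult_right t1 t2 t3)
  have "oscillation (R w) C = (\<integral>z. (indicat_real C (fst z) * (R w (fst z))\<^sup>2) * indicat_real C (snd z) \<partial>lebesgue)
      - 2 * (\<integral>z. (indicat_real C (fst z) * R w (fst z)) * (indicat_real C (snd z) * R w (snd z)) \<partial>lebesgue)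
      + (\<integral>z. indicat_real C (fst z) * (indicat_real C (snd z) * (R w (snd z))\<^sup>2) \<partial>lebesgue)"
    unfolding oscillation_def e using t1(1) t2(1) t3(1)
    by (subst Bochner_Integration.integral_add, simp, simp, subst Bochner_Integration.integral_diff, simp_all)
  also have "\<dots> = 2 * measure lebesgue C * (\<integral>x. indicat_real C x * (R w x)\<^sup>2 \<partial>lebesgue)
        - 2 * (\<integral>x. indicat_real C x * R w x \<partial>lebesgue)\<^sup>2"
    unfolding t1(2) t2(2) t3(2) using mC by (simp add: power2_eq_square)
  finally show "oscillation (R w) C = 2 * measure lebesgue C * (\<integral>x. indicat_real C x * (R w x)\<^sup>2 \<partial>lebesgue)
        - 2 * (\<integral>x. indicat_real C x * R w x \<partial>lebesgue)\<^sup>2" .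
qed

text \<open>
  Two points of one cube are at distance at most \<open>DIM('a) / N\<close>, so the kernel at their difference is at
  least the factor in front of the sum.  As the cubes are disjoint, each pair of points is counted at
  most once.
\<close>

lemma oscillation_on_cells:
  assumes w: "w \<in> V" and N: "0 < N"
    and l: "0 < l" "\<And>x. x \<noteq> 0 \<Longrightarrow> l * norm x powr (- (real DIM('a) + 2 * s)) \<le> K x"
  shows "l * (real DIM('a) / real N) powr (- (real DIM('a) + 2 * s)) *
    (\<Sum>C\<in>cell N ` \<Omega>. oscillation (R w) C) \<le> energy w w"
proof -
  define \<kappa> where "\<kappa> = l * (real DIM('a) / real N) powr (- (real DIM('a) + 2 * s))"
  define F where "F = cell N ` \<Omega>"
  have F: "finite F" unfolding F_def by (rule finite_cells)
  have Fm: "C \<in> lmeasurable" if "C \<in> F" for C using that cell_lmeasurable[OF N] by (auto simp: F_def)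
  define g where "g C z = indicat_real C (fst z) * indicat_real C (snd z) * (R w (fst z) - R w (snd z))\<^sup>2" for C z
  have gi: "integrable lebesgue (g C)" if "C \<in> F" for C
    using cell_variance(3)[OF w Fm[OF that]] by (simp add: g_def[abs_def])
  have "\<kappa> * (\<Sum>C\<in>F. \<integral>z. g C z \<partial>lebesgue) = (\<integral>z. \<kappa> * (\<Sum>C\<in>F. g C z) \<partial>lebesgue)"
    using gi by (simp add: Bochner_Integration.integral_sum)
  also have "\<dots> \<le> (\<integral>z. (D w z)\<^sup>2 \<partial>lebesgue)"
  proof (rule integral_mono_AE)
    show "integrable lebesgue (\<lambda>z. \<kappa> * (\<Sum>C\<in>F. g C z))" using gi by auto
    show "integrable lebesgue (\<lambda>z. (D w z)\<^sup>2)" by (rule V_D(6)[OF w])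
    show "AE z in lebesgue. \<kappa> * (\<Sum>C\<in>F. g C z) \<le> (D w z)\<^sup>2"
      using AE_nonsingular[OF nonsingular_coordinates(1) V_D(2)[OF w]]
        AE_nonsingular[OF nonsingular_coordinates(2) V_D(2)[OF w]]
    proof eventually_elim
      case (elim z)
      obtain x y where z: "z = (x, y)" by (cases z)
      have Rw: "R w x = w x" "R w y = w y" using elim by (auto simp: R_def z indicator_def)
      define t where "t = (w x - w y)\<^sup>2"
      have t0: "0 \<le> t" by (simp add: t_def)
      have "(\<Sum>C\<in>F. g C z) = (\<Sum>C\<in>F. if C = cell N x then indicat_real (cell N x) y * t else 0)"
      proof (rule sum.cong[OF refl])
        fix C assume "C \<in> F"
        then obtain x' where "C = cell N x'" by (auto simp: F_def)
        then have "x \<in> C \<longleftrightarrow> C = cell N x"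
          using cell_eq[of x N x'] cell_self[of x N] by metis
        then show "g C z = (if C = cell N x then indicat_real (cell N x) y * t else 0)"
          by (auto simp: g_def z Rw t_def indicator_def)
      qed
      also have "\<dots> = (if cell N x \<in> F then indicat_real (cell N x) y * t else 0)"
        using F by simp
      finally have S: "(\<Sum>C\<in>F. g C z) = (if cell N x \<in> F then indicat_real (cell N x) y * t else 0)" .
      show "\<kappa> * (\<Sum>C\<in>F. g C z) \<le> (D w z)\<^sup>2"
      proof (cases "cell N x \<in> F \<and> y \<in> cell N x \<and> x \<noteq> y \<and> z \<in> Q_set \<Omega>")
        case True
        have "norm (x - y) \<le> real DIM('a) / real N"
          using cell_diameter[OF N cell_self] True by blast
        then have "\<kappa> \<le> K (x - y)"
          unfolding \<kappa>_def using True by (intro kernel_bounded_below[OF l]) auto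
        then have "\<kappa> * t \<le> K (x - y) * t" using t0 by (rule mult_right_mono)
        moreover have "(D w z)\<^sup>2 = K (x - y) * t"
          using True K_pos[of "x - y"] by (simp add: D_def z t_def power_mult_distrib)
        ultimately show ?thesis using True by (simp add: S)
      next
        case False
        have "t = 0" if "z \<notin> Q_set \<Omega>" using elim that by (simp add: mem_Q z t_def)
        moreover have "t = 0" if "x = y" using that by (simp add: t_def)
        ultimately have "(\<Sum>C\<in>F. g C z) = 0" using False unfolding S by auto
        then show ?thesis by simp
      qed
    qed
  qed
  also have "\<dots> = energy w w" by (simp add: form_eq power2_eq_square)
  finally show ?thesis unfolding \<kappa>_def F_def g_def oscillation_def .
qed

text \<open>
  Up to the finitely many cube integrals, the \<open>L\<^sup>2\<close> norm is controlled by the oscillation on the cubes,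
  hence, with \<open>n = DIM('a)\<close>, by the energy times \<open>N\<^sup>n / (2 l (n/N)\<^sup>-\<^sup>n\<^sup>-\<^sup>2\<^sup>s)\<close>, which is a constant times \<open>N\<^sup>-\<^sup>2\<^sup>s\<close> and tends
  to zero.
\<close>

lemma approximate_by_cell_means:
  assumes \<epsilon>: "0 < \<epsilon>"
  shows "\<exists>M F. finite F \<and> F \<subseteq> lmeasurable \<and> 0 \<le> M \<and>
    (\<forall>w\<in>V. L2 w w \<le> \<epsilon> * energy w w + M * (\<Sum>C\<in>F. (\<integral>x. indicat_real C x * R w x \<partial>lebesgue)\<^sup>2))"
proof -
  obtain l where l: "0 < l" "\<And>x. x \<noteq> 0 \<Longrightarrow> l * norm x powr (- (real DIM('a) + 2 * s)) \<le> K x"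
    using K_lower by metis
  define n where "n = real DIM('a)"
  have n: "n > 0" by (simp add: n_def)
  have "(\<lambda>N. (n powr (n + 2 * s) / (2 * l)) * real N powr (- (2 * s))) \<longlonglongrightarrow>
        (n powr (n + 2 * s) / (2 * l)) * 0"
    using s_pos by (intro tendsto_mult tendsto_const tendsto_neg_powr filterlim_real_sequentially) auto
  then have "\<forall>\<^sub>F N in sequentially. (n powr (n + 2 * s) / (2 * l)) * real N powr (- (2 * s)) < \<epsilon>"
    using \<epsilon> by (intro order_tendstoD(2)) auto
  then obtain N where "N \<ge> 1" and Ne: "(n powr (n + 2 * s) / (2 * l)) * real N powr (- (2 * s)) < \<epsilon>"
    using eventually_conj[OF _ eventually_ge_at_top[of 1]]
    by (metis (mono_tags, lifting) eventually_happens sequentially_bot)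
  then have N: "0 < N" by simp
  define \<mu> where "\<mu> = (1 / real N) ^ DIM('a)"
  define \<kappa> where "\<kappa> = l * (n / real N) powr (- (n + 2 * s))"
  have pos: "0 < \<mu>" "0 < \<kappa>" using N l n by (simp_all add: \<mu>_def \<kappa>_def)
  have "1 / (2 * \<mu> * \<kappa>) = (n powr (n + 2 * s) / (2 * l)) * real N powr (- (2 * s))"
  proof -
    have "\<mu> = real N powr (- n)" using N
      by (simp add: \<mu>_def n_def powr_minus powr_realpow power_one_over inverse_eq_divide)
    moreover have "(n / real N) powr (- (n + 2 * s)) = real N powr (n + 2 * s) / n powr (n + 2 * s)"
      using N n by (simp only: powr_minus powr_divide less_imp_le of_nat_0_less_iff inverse_divide)
    ultimately have "2 * \<mu> * \<kappa> = 2 * l * (real N powr (- n) * real N powr (n + 2 * s)) / n powr (n + 2 * s)"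
      by (simp add: \<kappa>_def)
    also have "real N powr (- n) * real N powr (n + 2 * s) = real N powr (2 * s)"
      by (simp flip: powr_add)
    finally show ?thesis using N by (simp add: powr_minus field_simps)
  qed
  then have Me: "1 / (2 * \<mu> * \<kappa>) \<le> \<epsilon>" using Ne by simp
  define F where "F = cell N ` \<Omega>"
  have F: "finite F" unfolding F_def by (rule finite_cells)
  have Fm: "C \<in> lmeasurable" if "C \<in> F" for C using that cell_lmeasurable[OF N] by (auto simp: F_def)
  have "L2 w w \<le> \<epsilon> * energy w w + (1 / \<mu>) * (\<Sum>C\<in>F. (\<integral>x. indicat_real C x * R w x \<partial>lebesgue)\<^sup>2)"
    if w: "w \<in> V" for w
  proof -
    define m where "m C = (\<integral>x. indicat_real C x * R w x \<partial>lebesgue)" for C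
    define I where "I = oscillation (R w)"
    have I0: "0 \<le> I C" for C unfolding I_def oscillation_def by (rule Bochner_Integration.integral_nonneg) simp
    have "L2 w w = (\<integral>x. (R w x)\<^sup>2 \<partial>lebesgue)" by (simp add: L2_eq power2_eq_square)
    also have "\<dots> \<le> (\<integral>x. (\<Sum>C\<in>F. indicat_real C x * (R w x)\<^sup>2) \<partial>lebesgue)"
    proof (rule integral_mono[OF V_D(5)[OF w]])
      show "integrable lebesgue (\<lambda>x. \<Sum>C\<in>F. indicat_real C x * (R w x)\<^sup>2)"
        using cell_variance(2)[OF w Fm] by auto
      fix x
      show "(R w x)\<^sup>2 \<le> (\<Sum>C\<in>F. indicat_real C x * (R w x)\<^sup>2)"
      proof (cases "x \<in> \<Omega>")
        case True
        then have "cell N x \<in> F" by (simp add: F_def)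
        then have "indicat_real (cell N x) x * (R w x)\<^sup>2 \<le> (\<Sum>C\<in>F. indicat_real C x * (R w x)\<^sup>2)"
          using F by (intro member_le_sum) auto
        then show ?thesis by (simp add: cell_self)
      qed (simp add: R_def)
    qed
    also have "\<dots> = (\<Sum>C\<in>F. \<integral>x. indicat_real C x * (R w x)\<^sup>2 \<partial>lebesgue)"
      using cell_variance(2)[OF w Fm] by (rule Bochner_Integration.integral_sum)
    also have "\<dots> \<le> (\<Sum>C\<in>F. 1 / (2 * \<mu>) * I C + 1 / \<mu> * (m C)\<^sup>2)"
    proof (rule sum_mono)
      fix C assume C: "C \<in> F"
      define c where "c = measure lebesgue C"
      have c: "\<mu> \<le> c" using cell_measure[OF N] C by (auto simp: F_def c_def \<mu>_def)
      have "I C = 2 * c * (\<integral>x. indicat_real C x * (R w x)\<^sup>2 \<partial>lebesgue) - 2 * (m C)\<^sup>2"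
        unfolding I_def m_def c_def by (rule cell_variance(4)[OF w Fm[OF C]])
      then have "(\<integral>x. indicat_real C x * (R w x)\<^sup>2 \<partial>lebesgue) = 1 / (2 * c) * I C + 1 / c * (m C)\<^sup>2"
        using c pos by (simp add: field_simps)
      also have "\<dots> \<le> 1 / (2 * \<mu>) * I C + 1 / \<mu> * (m C)\<^sup>2"
        using c pos I0 by (intro add_mono mult_right_mono frac_le) auto
      finally show "(\<integral>x. indicat_real C x * (R w x)\<^sup>2 \<partial>lebesgue) \<le> 1 / (2 * \<mu>) * I C + 1 / \<mu> * (m C)\<^sup>2" .
    qed
    also have "\<dots> = 1 / (2 * \<mu>) * (\<Sum>C\<in>F. I C) + 1 / \<mu> * (\<Sum>C\<in>F. (m C)\<^sup>2)"
      by (simp add: sum.distrib sum_distrib_left)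
    also have "1 / (2 * \<mu>) * (\<Sum>C\<in>F. I C) \<le> \<epsilon> * energy w w"
    proof -
      have "\<kappa> * (\<Sum>C\<in>F. I C) \<le> energy w w"
        unfolding \<kappa>_def F_def I_def n_def by (rule oscillation_on_cells[OF w N l])
      then have "(\<Sum>C\<in>F. I C) \<le> energy w w / \<kappa>" using pos by (simp add: field_simps)
      then have "1 / (2 * \<mu>) * (\<Sum>C\<in>F. I C) \<le> 1 / (2 * \<mu>) * (energy w w / \<kappa>)"
        using pos by (intro mult_left_mono) auto
      also have "\<dots> = 1 / (2 * \<mu> * \<kappa>) * energy w w" by simp
      also have "\<dots> \<le> \<epsilon> * energy w w"
        using Me A.nonneg[OF w] by (rule mult_right_mono)
      finally show ?thesis .
    qed
    finally show ?thesis by (simp add: m_def)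
  qed
  then show ?thesis using F Fm pos by (intro exI[of _ "1 / \<mu>"] exI[of _ F]) auto
qed

lemma R_diff: "R (\<lambda>x. u x - v x) = (\<lambda>x. R u x - R v x)"
  by (rule ext) (simp add: R_def algebra_simps)

lemma L2_sq: "L2 u u = (\<integral>x. (R u x)\<^sup>2 \<partial>lebesgue)" by (simp add: L2_eq power2_eq_square)

lemma form_sq: "energy u u = (\<integral>z. (D u z)\<^sup>2 \<partial>lebesgue)" by (simp add: form_eq power2_eq_square)

text \<open>
  By \<open>approximate_by_cell_means\<close> it suffices that finitely many bounded sequences of real numbers, the
  integrals over the cubes, converge along a subsequence.
\<close>

lemma almost_Cauchy_subsequence:
  assumes v: "\<And>n. v n \<in> V" and B: "\<And>n. energy (v n) (v n) \<le> B" and e: "0 < e"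
  shows "\<exists>r :: nat \<Rightarrow> nat. strict_mono r \<and> (\<exists>N. \<forall>m\<ge>N. \<forall>n\<ge>N.
           B.sqdist (v (r m)) (v (r n)) \<le> e)"
proof -
  obtain c where c: "0 < c" "\<And>u. u \<in> V \<Longrightarrow> c * L2 u u \<le> energy u u" using Poincare by blast
  have B0: "0 \<le> B" using A.nonneg[OF v] B order_trans by blast
  \<comment> \<open>differences have energy at most \<open>4 * B\<close>, so the energy term takes at most half of \<open>e\<close>\<close>
  define \<epsilon> where "\<epsilon> = e / (8 * (B + 1))"
  have \<epsilon>: "0 < \<epsilon>" "\<epsilon> * (4 * B) \<le> e / 2" using e B0 by (simp_all add: \<epsilon>_def field_simps)
  obtain M F where F: "finite F" "F \<subseteq> lmeasurable" "0 \<le> M"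
    and approx: "\<And>w. w \<in> V \<Longrightarrow> L2 w w \<le> \<epsilon> * energy w w
       + M * (\<Sum>C\<in>F. (\<integral>x. indicat_real C x * R w x \<partial>lebesgue)\<^sup>2)"
    using approximate_by_cell_means[OF \<epsilon>(1)] by blast
  define f where "f C n = (\<integral>x. indicat_real C x * R (v n) x \<partial>lebesgue)" for C n
  have fi: "integrable lebesgue (\<lambda>x. indicat_real C x * R (v n) x)" if "C \<in> F" for C n
    using cell_variance(1)[OF v] that F by blast
  have "bounded (range (f C))" if C: "C \<in> F" for C
    unfolding bounded_iff
  proof (intro exI ballI)
    fix y assume "y \<in> range (f C)"
    then obtain n where y: "y = f C n" by blast
    have iC: "integrable lebesgue (indicat_real C)"
      using C F by (auto simp: lmeasurable_iff_integrable)
    have "\<bar>f C n\<bar> \<le> (\<integral>x. \<bar>indicat_real C x * R (v n) x\<bar> \<partial>lebesgue)"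
      unfolding f_def by (rule integral_abs_bound)
    also have "\<dots> \<le> (\<integral>x. indicat_real C x + (R (v n) x)\<^sup>2 \<partial>lebesgue)"
    proof (rule integral_mono)
      fix x
      have "0 \<le> (\<bar>R (v n) x\<bar> - 1)\<^sup>2" by simp
      then have "2 * \<bar>R (v n) x\<bar> \<le> (R (v n) x)\<^sup>2 + 1"
        unfolding power2_diff power2_abs by simp
      then have "\<bar>R (v n) x\<bar> \<le> 1 + (R (v n) x)\<^sup>2" by simp
      then show "\<bar>indicat_real C x * R (v n) x\<bar> \<le> indicat_real C x + (R (v n) x)\<^sup>2"
        by (simp add: indicator_def abs_mult)
    qed (use fi[OF C] iC V_D(5)[OF v] in auto)
    also have "\<dots> = measure lebesgue C + L2 (v n) (v n)"
      using iC V_D(5)[OF v] C F by (auto simp: L2_sq)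
    also have "\<dots> \<le> measure lebesgue C + B / c"
      using c(2)[OF v[of n]] B[of n] c(1) by (simp add: field_simps)
    finally show "norm y \<le> measure lebesgue C + B / c" by (simp add: y)
  qed
  then obtain r where r: "strict_mono r" "\<And>C. C \<in> F \<Longrightarrow> convergent (\<lambda>n. f C (r n))"
    using common_convergent_subsequence[OF F(1)] by blast
  define l where "l C = lim (\<lambda>n. f C (r n))" for C
  have l: "(\<lambda>n. f C (r n)) \<longlonglongrightarrow> l C" if "C \<in> F" for C
    using r(2)[OF that] by (simp add: l_def convergent_LIMSEQ_iff)
  define g where "g n = M * (\<Sum>C\<in>F. (f C (r n) - l C)\<^sup>2)" for n
  have "g \<longlonglongrightarrow> M * (\<Sum>C\<in>F. (l C - l C)\<^sup>2)"
    unfolding g_def by (intro tendsto_intros l)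
  then have "\<forall>\<^sub>F n in sequentially. g n < e / 8" using e by (intro order_tendstoD(2)) auto
  then obtain N where N: "\<And>n. n \<ge> N \<Longrightarrow> g n < e / 8" by (auto simp: eventually_sequentially)
  have "B.sqdist (v (r m)) (v (r n)) \<le> e"
    if mn: "m \<ge> N" "n \<ge> N" for m n
  proof -
    define w where "w = (\<lambda>x. v (r m) x - v (r n) x)"
    have w: "w \<in> V" unfolding w_def by (rule A.closed(2)[OF v v])
    have neg: "(\<lambda>x. - v (r n) x) \<in> V" by (rule A.closed(4)[OF v])
    have "energy w w \<le> 2 * energy (v (r m)) (v (r m)) + 2 * energy (v (r n)) (v (r n))"
      using A.norm_sq_add_le[OF v[of "r m"] neg] A.linear_left(4)[OF v neg, of "r n"] A.linear_right(4)[OF v v, of "r n" "r n"]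
      unfolding w_def by simp
    also have "\<dots> \<le> 4 * B" using B[of "r m"] B[of "r n"] by simp
    finally have "\<epsilon> * energy w w \<le> \<epsilon> * (4 * B)" using \<epsilon>(1) by (intro mult_left_mono) auto
    then have aw: "\<epsilon> * energy w w \<le> e / 2" using \<epsilon>(2) by linarith
    have "M * (\<Sum>C\<in>F. (\<integral>x. indicat_real C x * R w x \<partial>lebesgue)\<^sup>2)
       \<le> M * (\<Sum>C\<in>F. 2 * (f C (r m) - l C)\<^sup>2 + 2 * (f C (r n) - l C)\<^sup>2)"
    proof (intro mult_left_mono sum_mono F(3))
      fix C assume C: "C \<in> F"
      have "(\<integral>x. indicat_real C x * R w x \<partial>lebesgue) = f C (r m) - f C (r n)"
        unfolding w_def R_diff f_def right_diff_distrib
        by (rule Bochner_Integration.integral_diff[OF fi[OF C] fi[OF C]])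
      moreover have "(x - y)\<^sup>2 \<le> 2 * (x - q)\<^sup>2 + 2 * (y - q)\<^sup>2" for x y q :: real
        using zero_le_power2[of "x + y - 2 * q"] by (simp add: power2_eq_square algebra_simps)
      ultimately show "(\<integral>x. indicat_real C x * R w x \<partial>lebesgue)\<^sup>2
          \<le> 2 * (f C (r m) - l C)\<^sup>2 + 2 * (f C (r n) - l C)\<^sup>2" by simp
    qed
    also have "\<dots> = 2 * g m + 2 * g n"
      by (simp add: g_def sum.distrib sum_distrib_left algebra_simps)
    also have "\<dots> \<le> e / 2" using N[OF mn(1)] N[OF mn(2)] by simp
    finally have "L2 w w \<le> e" using approx[OF w] aw by linarith
    then show ?thesis by (simp add: w_def)
  qed
  then show ?thesis using r(1) by blast
qed

lemma Cauchy_subsequence: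
  assumes u: "\<And>n. u n \<in> V" and B: "\<And>n. energy (u n) (u n) \<le> B"
  shows "\<exists>r :: nat \<Rightarrow> nat. strict_mono r \<and> (\<forall>e>0. \<exists>N. \<forall>m\<ge>N. \<forall>n\<ge>N.
           B.sqdist (u (r m)) (u (r n)) \<le> e)"
proof -
  define P where "P k s \<longleftrightarrow> (\<exists>N. \<forall>m\<ge>N. \<forall>n\<ge>N.
     B.sqdist (u (s m)) (u (s n)) \<le> 1 / real (Suc k))"
    for k :: nat and s :: "nat \<Rightarrow> nat"
  interpret subseqs P
  proof
    fix k :: nat and s :: "nat \<Rightarrow> nat"
    show "\<exists>r'. strict_mono r' \<and> P k (s \<circ> r')"
      using almost_Cauchy_subsequence[of "\<lambda>n. u (s n)" B "1 / real (Suc k)"] u B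
      by (simp add: P_def o_def)
  qed
  have holds: "P k (diagseq \<circ> ((+) (Suc k)))" for k
  proof (rule diagseq_holds)
    fix r s :: "nat \<Rightarrow> nat" and n assume r: "strict_mono r" and "P n s"
    then obtain N where N: "\<And>i j. i \<ge> N \<Longrightarrow> j \<ge> N \<Longrightarrow>
        B.sqdist (u (s i)) (u (s j)) \<le> 1 / real (Suc n)"
      unfolding P_def by blast
    have "r i \<ge> N" if "i \<ge> N" for i using seq_suble[OF r, of i] that by simp
    then show "P n (s \<circ> r)" unfolding P_def o_def using N by blast
  qed
  have "\<exists>N. \<forall>m\<ge>N. \<forall>n\<ge>N. B.sqdist (u (diagseq m)) (u (diagseq n)) \<le> e" if e: "e > 0" for e
  proof -
    obtain k where k: "1 / real (Suc k) < e" using nat_approx_posE[OF e] by blast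
    obtain N where N: "\<And>i j. i \<ge> N \<Longrightarrow> j \<ge> N \<Longrightarrow>
        B.sqdist (u (diagseq (Suc k + i))) (u (diagseq (Suc k + j))) \<le> 1 / real (Suc k)"
      using holds[of k] unfolding P_def o_def by blast
    have "B.sqdist (u (diagseq m)) (u (diagseq n)) \<le> e"
      if mn: "m \<ge> Suc k + N" "n \<ge> Suc k + N" for m n
    proof -
      have "Suc k + (m - Suc k) = m" "Suc k + (n - Suc k) = n" "m - Suc k \<ge> N" "n - Suc k \<ge> N"
        using mn by auto
      with N[of "m - Suc k" "n - Suc k"] k show ?thesis by simp
    qed
    then show ?thesis by blast
  qed
  then show ?thesis using subseq_diagseq by blast
qed

text \<open>
  A rapidly converging subsequence of a Cauchy subsequence converges almost everywhere; by Fatou's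
  lemma the pointwise limit keeps the energy bound and is the limit in \<open>L\<^sup>2(\<Omega>)\<close>.
\<close>

lemma compact_embedding_V:
  assumes u: "\<And>n. u n \<in> V" and B: "\<And>n. energy (u n) (u n) \<le> B"
  shows "\<exists>r w. strict_mono (r :: nat \<Rightarrow> nat) \<and> w \<in> V \<and> energy w w \<le> B \<and>
    (\<lambda>n. B.sqdist (u (r n)) w) \<longlonglongrightarrow> 0"
proof -
  from Cauchy_subsequence[of u B, OF u B] obtain \<delta> :: "nat \<Rightarrow> nat"
    where \<delta>: "strict_mono \<delta>" and Cau: "\<forall>e>0. \<exists>N. \<forall>m\<ge>N. \<forall>n\<ge>N.
      B.sqdist (u (\<delta> m)) (u (\<delta> n)) \<le> e"
    by (elim exE conjE) (rule that)
  define d where "d m n = B.sqdist (u (\<delta> m)) (u (\<delta> n))" for m n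
  obtain \<rho> :: "nat \<Rightarrow> nat" where \<rho>: "strict_mono \<rho>"
    and small: "\<And>k m n. m \<ge> \<rho> k \<Longrightarrow> n \<ge> \<rho> k \<Longrightarrow> d m n \<le> (1/4) ^ k"
  proof (rule subsequence_tails_small[of d "\<lambda>k. (1/4) ^ k"])
    show "\<exists>N. \<forall>m\<ge>N. \<forall>n\<ge>N. d m n \<le> e" if "0 < e" for e
      unfolding d_def by (rule mp[OF spec[OF Cau] that])
  qed auto
  define v where "v k = u (\<delta> (\<rho> k))" for k
  have v: "v k \<in> V" for k using u by (simp add: v_def)
  have vB: "energy (v k) (v k) \<le> B" for k using B by (simp add: v_def)
  have vd: "(\<integral>x. (R (v i) x - R (v j) x)\<^sup>2 \<partial>lebesgue) \<le> (1/4) ^ k" if "i \<ge> k" "j \<ge> k" for i j k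
    using small[of k "\<rho> i" "\<rho> j"] that \<rho> unfolding d_def L2_sq R_diff v_def
    by (simp add: strict_mono_less_eq)
  have di: "integrable lebesgue (\<lambda>x. (R (v i) x - R (v j) x)\<^sup>2)" for i j
    using V_D(5)[OF A.closed(2)[OF v v], of i j] by (simp add: R_diff)
  have conv: "AE x in lebesgue. convergent (\<lambda>k. R (v k) x)"
    by (rule AE_convergent_of_fast_Cauchy) (use V_D(3)[OF v] di vd in auto)
  define w where "w x = lim (\<lambda>k. R (v k) x)" for x
  have wm: "w \<in> borel_measurable lebesgue"
    unfolding w_def[abs_def] by (intro borel_measurable_lim_metric V_D(3) v)
  have w0: "w x = 0" if "x \<notin> \<Omega>" for x using that by (simp add: w_def R_def)
  have Rw: "R w = w" using w0 by (auto simp: fun_eq_iff R_def indicator_def)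
  have limw: "AE x in lebesgue. (\<lambda>k. R (v k) x) \<longlonglongrightarrow> w x"
    using conv by eventually_elim (simp add: w_def convergent_LIMSEQ_iff)
  have "AE x in lebesgue. \<forall>k. x \<notin> \<Omega> \<longrightarrow> v k x = 0"
    unfolding AE_all_countable using V_D(2)[OF v] by blast
  with limw have limv: "AE x in lebesgue. (\<lambda>k. v k x) \<longlonglongrightarrow> w x"
  proof eventually_elim
    case (elim x)
    then have "(\<lambda>k. v k x) = (\<lambda>k. R (v k) x)" by (auto simp: fun_eq_iff R_def indicator_def)
    then show ?case using elim(1) by simp
  qed
  have limD: "AE z in lebesgue. (\<lambda>k. D (v k) z) \<longlonglongrightarrow> D w z"
    using AE_nonsingular[OF nonsingular_coordinates(1) limv] AE_nonsingular[OF nonsingular_coordinates(2) limv]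
    unfolding D_def by eventually_elim (intro tendsto_intros)
  have Dw: "integrable lebesgue (\<lambda>z. (D w z)\<^sup>2)" "(\<integral>z. (D w z)\<^sup>2 \<partial>lebesgue) \<le> B"
    using Fatou_square[OF V_D(4)[OF v] D_measurable[OF wm] V_D(6)[OF v] _ limD, of B] vB
    by (simp_all add: form_sq)
  have diff: "integrable lebesgue (\<lambda>x. (R (v k) x - w x)\<^sup>2)"
    "(\<integral>x. (R (v k) x - w x)\<^sup>2 \<partial>lebesgue) \<le> (1/4) ^ k" for k
  proof -
    have lim': "AE x in lebesgue. (\<lambda>j. R (v k) x - R (v j) x) \<longlonglongrightarrow> R (v k) x - w x"
      using limw by eventually_elim (intro tendsto_intros)
    have ev: "\<forall>\<^sub>F j in sequentially. (\<integral>x. (R (v k) x - R (v j) x)\<^sup>2 \<partial>lebesgue) \<le> (1/4) ^ k"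
      using vd[of k k] unfolding eventually_sequentially by auto
    have m: "(\<lambda>x. R (v k) x - R (v j) x) \<in> borel_measurable lebesgue" for j
      by (intro borel_measurable_diff V_D(3) v)
    have m': "(\<lambda>x. R (v k) x - w x) \<in> borel_measurable lebesgue"
      by (intro borel_measurable_diff V_D(3) v wm)
    from Fatou_square[OF m m' di ev lim']
    show "integrable lebesgue (\<lambda>x. (R (v k) x - w x)\<^sup>2)"
      "(\<integral>x. (R (v k) x - w x)\<^sup>2 \<partial>lebesgue) \<le> (1/4) ^ k" .
  qed
  have "integrable lebesgue (\<lambda>x. (1 * R (v 0) x + (-1) * (R (v 0) x - w x))\<^sup>2)"
    by (intro integrable_sq_lin V_D(3,5) v diff borel_measurable_diff wm)
  then have "integrable lebesgue (\<lambda>x. (R w x)\<^sup>2)" by (simp add: Rw)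
  then have w: "w \<in> V" using wm w0 Dw by (simp add: V_iff)
  have "(\<lambda>k. B.sqdist (v k) w) \<longlonglongrightarrow> 0"
  proof (rule Lim_null_comparison)
    show "\<forall>\<^sub>F k in sequentially. norm (B.sqdist (v k) w) \<le> (1/4) ^ k"
      using diff by (simp add: L2_sq R_diff Rw del: B.linear_left B.linear_right)
    show "(\<lambda>k. (1/4) ^ k :: real) \<longlonglongrightarrow> 0" by (rule LIMSEQ_power_zero) simp
  qed
  then have "(\<lambda>k. B.sqdist (u ((\<delta> \<circ> \<rho>) k)) w) \<longlonglongrightarrow> 0"
    by (simp add: v_def del: B.linear_left B.linear_right)
  moreover have "energy w w \<le> B" using Dw by (simp add: form_sq)
  ultimately show ?thesis using w strict_mono_o[OF \<delta> \<rho>] by blast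
qed

end

section \<open>Strong maximum principle\<close>

lemma AE_ex_ball:
  fixes y :: "'a::euclidean_space"
  assumes "AE x in lebesgue. P x" "0 < r" obtains x where "x \<in> ball y r" "P x"
proof -
  have "\<not> (\<forall>x\<in>ball y r. \<not> P x)"
  proof
    assume a: "\<forall>x\<in>ball y r. \<not> P x"
    have "AE x in lebesgue. x \<notin> ball y r" using assms(1) by eventually_elim (use a in auto)
    then have "negligible (ball y r)"
      by (simp add: negligible_iff_null_sets completion.AE_iff_null_sets ball_def)
    then show False using open_not_negligible[of "ball y r"] assms(2) by simp
  qed
  then show ?thesis using that by blast
qed

context nonlocal_form begin

text \<open>
  Such a function is bounded, so \<open>(f x - f y)\<^sup>2\<close> is at most a constant times \<open>min \<bar>x - y\<bar>\<^sup>2 1\<close>, against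
  which the kernel is integrable; the pair \<open>(x, y)\<close> contributes only if one of its entries lies in
  the bounded set \<open>\<Omega>\<close>.
\<close>

lemma Lipschitz_in_V:
  assumes f: "\<And>x y. \<bar>f x - f y\<bar> \<le> norm (x - y)" and f0: "\<And>x. x \<notin> \<Omega> \<Longrightarrow> f x = 0"
  shows "f \<in> V"
proof -
  have "1-lipschitz_on UNIV f"
    by (rule lipschitz_onI) (use f in \<open>auto simp: dist_norm\<close>)
  then have "continuous_on UNIV f" by (rule lipschitz_on_continuous_on)
  then have "f \<in> borel_measurable borel" by (rule borel_measurable_continuous_onI)
  then have fm: "f \<in> borel_measurable lebesgue" by (intro measurable_completion) simp
  obtain M where M: "\<And>x. \<bar>f x\<bar> \<le> M"
  proof -
    obtain y where y: "y \<notin> \<Omega>"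
      using \<Omega>_bounded not_bounded_UNIV by (metis UNIV_eq_I)
    obtain r where r: "\<And>x. x \<in> \<Omega> \<Longrightarrow> norm x \<le> r" using \<Omega>_bounded by (auto simp: bounded_iff)
    have "\<bar>f x\<bar> \<le> \<bar>r\<bar> + norm y" for x
    proof (cases "x \<in> \<Omega>")
      case True
      have "\<bar>f x\<bar> \<le> norm (x - y)" using f[of x y] f0[OF y] by simp
      also have "\<dots> \<le> norm x + norm y" by (rule norm_triangle_ineq4)
      finally show ?thesis using r[OF True] by simp
    qed (simp add: f0)
    then show ?thesis by (rule that)
  qed
  have i\<Omega>: "integrable lebesgue (indicat_real \<Omega>)"
    using bounded_set_imp_lmeasurable[OF \<Omega>_bounded \<Omega>_sets] by (simp only: lmeasurable_iff_integrable)
  have iR: "integrable lebesgue (\<lambda>x. (R f x)\<^sup>2)"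
  proof (rule Bochner_Integration.integrable_bound)
    show "integrable lebesgue (\<lambda>x. M\<^sup>2 * indicat_real \<Omega> x)" using i\<Omega> by simp
    have "\<bar>f x\<bar>\<^sup>2 \<le> M\<^sup>2" for x by (intro power_mono M) simp
    then show "AE x in lebesgue. norm ((R f x)\<^sup>2) \<le> norm (M\<^sup>2 * indicat_real \<Omega> x)"
      by (auto simp: R_def indicator_def)
    show "(\<lambda>x. (R f x)\<^sup>2) \<in> borel_measurable lebesgue" using R_measurable[OF fm] by simp
  qed
  define k where "k x = min ((norm x)\<^sup>2) 1 * K x" for x
  have ik: "integrable lebesgue k" using K_moment by (simp add: k_def[abs_def])
  \<comment> \<open>increments of \<open>f\<close> are bounded both by \<open>norm (x - y)\<close> and by \<open>2 * M\<close>\<close>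
  define L where "L = 1 + 4 * M\<^sup>2"
  have iD: "integrable lebesgue (\<lambda>z. (D f z)\<^sup>2)"
  proof (rule Bochner_Integration.integrable_bound)
    show "integrable lebesgue (\<lambda>z. L * (indicat_real \<Omega> (fst z) * k (fst z - snd z)
        + indicat_real \<Omega> (snd z) * k (fst z - snd z)))"
      using integrable_tensor(3,4)[OF i\<Omega> ik] by simp
    have "(D f z)\<^sup>2 \<le> L * (indicat_real \<Omega> (fst z) * k (fst z - snd z)
        + indicat_real \<Omega> (snd z) * k (fst z - snd z))" for z
    proof (cases "z \<in> Q_set \<Omega> \<and> fst z \<noteq> snd z")
      case True
      obtain x y where z: "z = (x, y)" by (cases z)
      have xy: "x \<noteq> y" "x \<in> \<Omega> \<or> y \<in> \<Omega>" using True by (auto simp: z mem_Q)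
      have Kp: "0 < K (x - y)" using xy by (intro K_pos) simp
      have d1: "(f x - f y)\<^sup>2 \<le> (norm (x - y))\<^sup>2"
        using power_mono[OF f[of x y], of 2] by simp
      have "\<bar>f x - f y\<bar> \<le> 2 * M" using M[of x] M[of y] by simp
      then have d2: "(f x - f y)\<^sup>2 \<le> 4 * M\<^sup>2"
        using power_mono[of "\<bar>f x - f y\<bar>" "2 * M" 2] by (simp add: power_mult_distrib)
      have "(f x - f y)\<^sup>2 \<le> L * min ((norm (x - y))\<^sup>2) 1"
      proof (cases "(norm (x - y))\<^sup>2 \<le> 1")
        case True
        have "0 \<le> 4 * M\<^sup>2 * (norm (x - y))\<^sup>2" by simp
        moreover have "L * min ((norm (x - y))\<^sup>2) 1 = (norm (x - y))\<^sup>2 + 4 * M\<^sup>2 * (norm (x - y))\<^sup>2"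
          using True by (simp add: L_def distrib_right)
        ultimately show ?thesis using d1 by linarith
      next
        case False
        then show ?thesis using d2 by (simp add: L_def)
      qed
      then have "(f x - f y)\<^sup>2 * K (x - y) \<le> (L * min ((norm (x - y))\<^sup>2) 1) * K (x - y)"
        using Kp by (intro mult_right_mono) auto
      then have "(f x - f y)\<^sup>2 * K (x - y) \<le> L * k (x - y)" unfolding k_def by (simp only: mult.assoc)
      moreover have "(D f z)\<^sup>2 = (f x - f y)\<^sup>2 * K (x - y)"
        using True Kp by (simp add: D_def z power_mult_distrib)
      moreover have "k (x - y) \<le> indicat_real \<Omega> x * k (x - y) + indicat_real \<Omega> y * k (x - y)"
        using xy Kp by (auto simp: indicator_def k_def)
      moreover have "0 \<le> L" by (simp add: L_def)
      ultimately show ?thesis unfolding z by (smt (verit) mult_left_mono fst_conv snd_conv)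
    next
      case False
      then have "(D f z)\<^sup>2 = 0" by (auto simp: D_def)
      moreover have "0 \<le> k (fst z - snd z)"
      proof (cases "fst z = snd z")
        case False
        then show ?thesis using K_pos[of "fst z - snd z"] by (simp add: k_def)
      qed (simp add: k_def)
      moreover have "0 \<le> L" by (simp add: L_def)
      ultimately show ?thesis by simp
    qed
    then show "AE z in lebesgue. norm ((D f z)\<^sup>2) \<le> norm (L * (indicat_real \<Omega> (fst z) * k (fst z - snd z)
        + indicat_real \<Omega> (snd z) * k (fst z - snd z)))"
      by (simp add: order_trans[OF _ abs_ge_self])
    show "(\<lambda>z. (D f z)\<^sup>2) \<in> borel_measurable lebesgue" using D_measurable[OF fm] by simp
  qed
  show ?thesis unfolding V_iff using fm f0 iR iD by simp
qed

lemma cutoff_in_V: "(\<lambda>x. infdist x (- \<Omega>)) \<in> V"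
  and cutoff_pos: "x \<in> \<Omega> \<Longrightarrow> 0 < infdist x (- \<Omega>)"
proof -
  have ne: "- \<Omega> \<noteq> {}" using \<Omega>_bounded not_bounded_UNIV by (metis Compl_UNIV_eq double_compl)
  have cl: "closed (- \<Omega>)" using \<Omega>_open by (simp add: closed_Compl)
  show "(\<lambda>x. infdist x (- \<Omega>)) \<in> V"
  proof (rule Lipschitz_in_V)
    show "\<bar>infdist x (- \<Omega>) - infdist y (- \<Omega>)\<bar> \<le> norm (x - y)" for x y
      using infdist_triangle_abs[of x "- \<Omega>" y] by (simp add: dist_norm)
    show "infdist x (- \<Omega>) = 0" if "x \<notin> \<Omega>" for x using that by simp
  qed
  show "0 < infdist x (- \<Omega>)" if "x \<in> \<Omega>"
    using in_closed_iff_infdist_zero[OF cl ne, of x] that infdist_nonneg[of x "- \<Omega>"] by auto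
qed

text \<open>
  For \<open>g = \<eta> - M U\<close> one has \<open>a g g\<^sup>+ = a g\<^sup>+ g\<^sup>+ - a g\<^sup>- g\<^sup>+\<close>, while \<open>a g g\<^sup>+ \<le> a \<eta> g\<^sup>+\<close> because \<open>U\<close> is a
  supersolution.  Young's inequality for \<open>a \<eta> g\<^sup>+\<close> leaves a bound on the interaction of the two parts
  that does not depend on \<open>M\<close>.
\<close>

lemma interaction_bound:
  assumes U: "U \<in> V" and nn: "AE x in lebesgue. 0 \<le> U x"
    and super: "\<And>v. v \<in> V \<Longrightarrow> (AE x in lebesgue. 0 \<le> v x) \<Longrightarrow> 0 \<le> energy U v"
    and \<eta>: "\<eta> \<in> V" and M: "0 \<le> M"
  defines "P \<equiv> pos_part (\<lambda>x. \<eta> x - M * U x)"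
  defines "N \<equiv> (\<lambda>x. P x - (\<eta> x - M * U x))"
  shows "integrable lebesgue (\<lambda>z. - (D N z * D P z))"
    "(\<integral>z. - (D N z * D P z) \<partial>lebesgue) \<le> energy \<eta> \<eta> / 2"
proof -
  define g where "g = (\<lambda>x. \<eta> x - M * U x)"
  have g: "g \<in> V" unfolding g_def by (rule A.closed(2)[OF \<eta> A.closed(3)[OF U]])
  have P: "P \<in> V" unfolding P_def g_def[symmetric] by (rule pos_part_V[OF g])
  have N_eq: "N = (\<lambda>x. P x - g x)" by (simp add: N_def g_def)
  have N: "N \<in> V" unfolding N_eq by (rule A.closed(2)[OF P g])
  show "integrable lebesgue (\<lambda>z. - (D N z * D P z))" using DD_integrable[OF N P] by simp
  let ?a = energy
  have "0 \<le> ?a U P" by (rule super[OF P]) (simp add: P_def pos_part_def)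
  then have "0 \<le> M * ?a U P" using M by simp
  then have "?a g P \<le> ?a \<eta> P"
    unfolding g_def using A.linear_left(2)[OF \<eta> P A.closed(3)[OF U, of M]] A.linear_left(3)[OF U P, of M] by simp
  moreover have "?a N P = ?a P P - ?a g P"
    unfolding N_eq by (rule A.linear_left(2)[OF P P g])
  moreover have "2 * ?a \<eta> P \<le> ?a \<eta> \<eta> + ?a P P"
    using A.nonneg[OF A.closed(2)[OF \<eta> P]] \<eta> P by (simp add: A.sym[OF P \<eta>])
  moreover have "0 \<le> ?a P P" by (rule A.nonneg[OF P])
  ultimately have "- ?a N P \<le> ?a \<eta> \<eta> / 2" by linarith
  then show "(\<integral>z. - (D N z * D P z) \<partial>lebesgue) \<le> ?a \<eta> \<eta> / 2"
    unfolding form_eq[of N P] using DD_integrable[OF N P] by simp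
qed

text \<open>
  Let \<open>A\<close> be the part of \<open>\<Omega>\<close> where \<open>U\<close> vanishes.  For \<open>x\<close> in \<open>A\<close> the function
  \<open>g = \<eta> - M U\<close> has the positive part \<open>\<eta> x\<close>, whereas \<open>g\<^sup>- y\<close> grows like \<open>M U y\<close>.  The interaction of
  the two parts is bounded independently of \<open>M\<close>; dividing by \<open>M\<close> and letting it tend to infinity
  shows that \<open>\<eta> x U y K (x - y)\<close> vanishes for almost all pairs with \<open>x\<close> in \<open>A\<close>.  As the kernel is
  positive everywhere, this nonlocal argument reaches all of \<open>\<Omega>\<close> at once.
\<close>

theorem strong_maximum_principle:
  assumes U: "U \<in> V" and nn: "AE x in lebesgue. 0 \<le> U x"
    and super: "\<And>v. v \<in> V \<Longrightarrow> (AE x in lebesgue. 0 \<le> v x) \<Longrightarrow> 0 \<le> energy U v"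
    and nz: "\<not> (AE x in lebesgue. U x = 0)"
  shows "AE x in lebesgue. x \<in> \<Omega> \<longrightarrow> 0 < U x"
proof -
  define \<eta> where "\<eta> = (\<lambda>x. infdist x (- \<Omega>))"
  have \<eta>: "\<eta> \<in> V" "\<And>x. x \<in> \<Omega> \<Longrightarrow> 0 < \<eta> x" "\<And>x. 0 \<le> \<eta> x"
    unfolding \<eta>_def using cutoff_in_V cutoff_pos infdist_nonneg by auto
  define E where "E = energy \<eta> \<eta> / 2"
  have E: "0 \<le> E" using A.nonneg[OF \<eta>(1)] by (simp add: E_def)
  define A where "A = {x \<in> \<Omega>. U x = 0}"
  define B where "B = {y \<in> \<Omega>. 0 < U y}"
  have Um: "U \<in> borel_measurable lebesgue" and \<eta>m: "\<eta> \<in> borel_measurable lebesgue"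
    using V_D(1) U \<eta> by auto
  have As: "A \<in> sets lebesgue" and Bs: "B \<in> sets lebesgue"
  proof -
    have "A = \<Omega> \<inter> (U -` {0} \<inter> space lebesgue)" "B = \<Omega> \<inter> (U -` {0<..} \<inter> space lebesgue)"
      by (auto simp: A_def B_def)
    moreover have "U -` {0} \<inter> space lebesgue \<in> sets lebesgue" "U -` {0<..} \<inter> space lebesgue \<in> sets lebesgue"
      by (intro measurable_sets[OF Um]; simp)+
    ultimately show "A \<in> sets lebesgue" "B \<in> sets lebesgue" using \<Omega>_sets by auto
  qed
  define H where "H n z = indicat_real A (fst z) * \<eta> (fst z) * max (U (snd z) - \<eta> (snd z) / real (Suc n)) 0
      * K (fst z - snd z)" for n z
  define H\<^sub>0 where "H\<^sub>0 z = indicat_real A (fst z) * \<eta> (fst z) * max (U (snd z)) 0 * K (fst z - snd z)" for z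
  have Hm: "H n \<in> borel_measurable lebesgue" for n
    unfolding H_def[abs_def]
    by (intro borel_measurable_times borel_measurable_max borel_measurable_diff borel_measurable_divide
        borel_measurable_const coords_measurable Um \<eta>m K_measurable borel_measurable_indicator As)
  have bound: "(\<integral>\<^sup>+z. ennreal (H n z) \<partial>lebesgue) \<le> ennreal (E / real (Suc n))" for n
  proof -
    \<comment> \<open>\<open>P\<close> and \<open>N\<close> are the positive and the negative part of \<open>\<eta> - M U\<close>\<close>
    define M where "M = real (Suc n)"
    have M: "0 < M" by (simp add: M_def)
    define P where "P = pos_part (\<lambda>x. \<eta> x - M * U x)"
    define N where "N = (\<lambda>x. P x - (\<eta> x - M * U x))"
    have ib: "integrable lebesgue (\<lambda>z. - (D N z * D P z))" "(\<integral>z. - (D N z * D P z) \<partial>lebesgue) \<le> E"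
      using interaction_bound[OF U nn super \<eta>(1), of M] M unfolding P_def N_def E_def by simp_all
    have P0: "0 \<le> P x" and N0: "0 \<le> N x" and NP: "N x * P x = 0" for x
      by (auto simp: P_def N_def pos_part_def max_def)
    have DD: "- (D N z * D P z) = indicat_real (Q_set \<Omega>) z *
        (N (fst z) * P (snd z) + P (fst z) * N (snd z)) * K (fst z - snd z)" for z
    proof -
      have "D N z * D P z = indicat_real (Q_set \<Omega>) z *
          ((N (fst z) - N (snd z)) * (P (fst z) - P (snd z)) * K (fst z - snd z))"
        using sqrt_K_sq[of "fst z" "snd z" "N (fst z) - N (snd z)" "P (fst z) - P (snd z)"]
        by (simp add: D_def indicator_def)
      moreover have "(N (fst z) - N (snd z)) * (P (fst z) - P (snd z))
          = - (N (fst z) * P (snd z) + P (fst z) * N (snd z))"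
        using NP[of "fst z"] NP[of "snd z"] unfolding left_diff_distrib right_diff_distrib
        by (simp only: mult.commute[of "P (fst z)"])
      ultimately have "D N z * D P z = indicat_real (Q_set \<Omega>) z *
          (- (N (fst z) * P (snd z) + P (fst z) * N (snd z)) * K (fst z - snd z))" by (simp only:)
      then show ?thesis by (simp only: mult_minus_left mult_minus_right minus_minus mult.assoc)
    qed
    have nonneg: "0 \<le> - (D N z * D P z)" for z
    proof (cases "fst z = snd z")
      case True
      then show ?thesis by (simp add: D_def)
    next
      case False
      then have "0 < K (fst z - snd z)" by (intro K_pos) simp
      then show ?thesis unfolding DD using P0 N0 by (intro mult_nonneg_nonneg add_nonneg_nonneg) auto
    qed
    have le: "H n z \<le> - (D N z * D P z) / M" for z
    proof (cases "fst z \<in> A")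
      case True
      then have x: "fst z \<in> \<Omega>" "U (fst z) = 0" by (auto simp: A_def)
      have "P (fst z) = \<eta> (fst z)" "N (fst z) = 0"
        using x \<eta>(3)[of "fst z"] by (auto simp: P_def N_def pos_part_def)
      moreover have "N (snd z) = M * max (U (snd z) - \<eta> (snd z) / M) 0"
        using M by (auto simp: P_def N_def pos_part_def max_def field_simps)
      moreover have "z \<in> Q_set \<Omega>" using x by (simp add: mem_Q)
      ultimately show ?thesis using M True unfolding DD H_def M_def[symmetric] by (simp add: mult.assoc)
    next
      case False
      then show ?thesis using divide_nonneg_pos[OF nonneg[of z] M] by (simp add: H_def)
    qed
    have "(\<integral>\<^sup>+z. ennreal (H n z) \<partial>lebesgue) \<le> (\<integral>\<^sup>+z. ennreal (- (D N z * D P z) / M) \<partial>lebesgue)"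
      by (intro nn_integral_mono ennreal_leI le)
    also have "\<dots> = ennreal (\<integral>z. - (D N z * D P z) / M \<partial>lebesgue)"
    proof (rule nn_integral_eq_integral)
      show "integrable lebesgue (\<lambda>z. - (D N z * D P z) / M)"
        by (rule integrable_divide_zero) (rule ib(1))
      show "AE z in lebesgue. 0 \<le> - (D N z * D P z) / M"
        by (rule AE_I2) (rule divide_nonneg_pos[OF nonneg M])
    qed
    also have "(\<integral>z. - (D N z * D P z) / M \<partial>lebesgue) = (\<integral>z. - (D N z * D P z) \<partial>lebesgue) / M"
      by (rule integral_divide_zero)
    also have "ennreal \<dots> \<le> ennreal (E / M)" using ib(2) M by (intro ennreal_leI divide_right_mono) auto
    finally show ?thesis by (simp add: M_def)
  qed
  have "(\<integral>\<^sup>+z. ennreal (H\<^sub>0 z) \<partial>lebesgue) = (\<integral>\<^sup>+z. liminf (\<lambda>n. ennreal (H n z)) \<partial>lebesgue)"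
  proof (rule nn_integral_cong)
    fix z :: "'a \<times> 'a"
    have "(\<lambda>n. \<eta> (snd z) * (1 / real (Suc n))) \<longlonglongrightarrow> \<eta> (snd z) * 0"
      by (intro tendsto_intros LIMSEQ_Suc[OF lim_1_over_n])
    then have "(\<lambda>n. \<eta> (snd z) / real (Suc n)) \<longlonglongrightarrow> 0" by simp
    then have "(\<lambda>n. H n z) \<longlonglongrightarrow> indicat_real A (fst z) * \<eta> (fst z) * max (U (snd z) - 0) 0 * K (fst z - snd z)"
      unfolding H_def by (intro tendsto_intros)
    then have "(\<lambda>n. ennreal (H n z)) \<longlonglongrightarrow> ennreal (H\<^sub>0 z)"
      by (intro tendsto_ennrealI) (simp add: H\<^sub>0_def)
    from lim_imp_Liminf[OF _ this] show "ennreal (H\<^sub>0 z) = liminf (\<lambda>n. ennreal (H n z))" by simp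
  qed
  also have "\<dots> \<le> liminf (\<lambda>n. \<integral>\<^sup>+z. ennreal (H n z) \<partial>lebesgue)"
    using Hm by (intro nn_integral_liminf) simp
  also have "\<dots> \<le> liminf (\<lambda>n. ennreal (E / real (Suc n)))"
    by (intro Liminf_mono always_eventually allI bound)
  also have "\<dots> = 0"
  proof -
    have "(\<lambda>n. E * (1 / real (Suc n))) \<longlonglongrightarrow> E * 0"
      by (intro tendsto_intros LIMSEQ_Suc[OF lim_1_over_n])
    then have "(\<lambda>n. ennreal (E / real (Suc n))) \<longlonglongrightarrow> ennreal 0" by (intro tendsto_ennrealI) simp
    from lim_imp_Liminf[OF _ this] show ?thesis by simp
  qed
  finally have "(\<integral>\<^sup>+z. ennreal (H\<^sub>0 z) \<partial>lebesgue) = 0" by simp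
  moreover have "H\<^sub>0 \<in> borel_measurable lebesgue"
    unfolding H\<^sub>0_def[abs_def]
    by (intro borel_measurable_times borel_measurable_max
        borel_measurable_const coords_measurable Um \<eta>m K_measurable borel_measurable_indicator As)
  ultimately have "AE z in lebesgue. ennreal (H\<^sub>0 z) = 0"
    by (subst (asm) nn_integral_0_iff_AE) auto
  moreover have "AE z in lebesgue. fst z - snd z \<noteq> (0::'a)"
    by (rule AE_nonsingular[OF nonsingular_coordinates(3)])
       (simp add: AE_completion_iff AE_lborel_singleton)
  ultimately have ae: "AE z in lebesgue. indicat_real A (fst z) * indicat_real B (snd z) = 0"
  proof eventually_elim
    case (elim z)
    show ?case
    proof (rule ccontr)
      assume "\<not> ?thesis"
      then have "fst z \<in> A" "snd z \<in> B" by (auto simp: indicator_def split: if_splits)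
      then have "0 < H\<^sub>0 z"
        using elim(2) \<eta>(2)[of "fst z"] K_pos[of "fst z - snd z"] by (simp add: H\<^sub>0_def A_def B_def)
      then show False using elim(1) by simp
    qed
  qed
  have iAB: "integrable lebesgue (indicat_real A)" "integrable lebesgue (indicat_real B)"
    using bounded_set_imp_lmeasurable[OF bounded_subset[OF \<Omega>_bounded] As]
      bounded_set_imp_lmeasurable[OF bounded_subset[OF \<Omega>_bounded] Bs]
    by (auto simp only: lmeasurable_iff_integrable A_def B_def)
  have "measure lebesgue A * measure lebesgue B
      = (\<integral>z. indicat_real A (fst z) * indicat_real B (snd z) \<partial>lebesgue)"
    using integrable_tensor(2)[OF iAB] by simp
  also have "\<dots> = 0" by (rule integral_eq_zero_AE[OF ae])
  finally have "measure lebesgue A = 0 \<or> measure lebesgue B = 0" by simp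
  moreover have null: "AE x in lebesgue. x \<notin> S" if "S \<in> lmeasurable" "measure lebesgue S = 0" for S :: "'a set"
    using that negligible_iff_measure[of S] AE_not_in[of S lebesgue] by (auto simp: negligible_iff_null_sets)
  moreover have "A \<in> lmeasurable" "B \<in> lmeasurable" using iAB by (simp_all add: lmeasurable_iff_integrable)
  moreover have "\<not> (AE x in lebesgue. x \<notin> B)"
  proof
    assume "AE x in lebesgue. x \<notin> B"
    with nn V_D(2)[OF U] have "AE x in lebesgue. U x = 0" by eventually_elim (force simp: B_def)
    then show False using nz by blast
  qed
  ultimately have "AE x in lebesgue. x \<notin> A" by blast
  with nn show ?thesis by eventually_elim (force simp: A_def)
qed

text \<open>
  A cone-shaped bump supported in a small ball vanishes on another ball inside \<open>\<Omega>\<close>, where \<open>\<phi>\<close> does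
  not.
\<close>

lemma independent_of_positive:
  assumes \<phi>: "\<phi> \<in> V" and pos: "AE x in lebesgue. x \<in> \<Omega> \<longrightarrow> 0 < \<phi> x"
  shows "\<exists>w\<in>V. \<forall>c. 0 < L2 (\<lambda>x. w x - c * \<phi> x) (\<lambda>x. w x - c * \<phi> x)"
proof -
  obtain x0 where "x0 \<in> \<Omega>" using \<Omega>_ne by blast
  then obtain \<rho> where \<rho>: "0 < \<rho>" "ball x0 \<rho> \<subseteq> \<Omega>" using \<Omega>_open openE by blast
  obtain e :: 'a where "e \<in> Basis" using nonempty_Basis by blast
  then have e: "norm e = 1" by simp
  define x1 where "x1 = x0 + (\<rho> / 2) *\<^sub>R e"
  have d: "dist x1 x0 = \<rho> / 2" using e \<rho> by (simp add: x1_def dist_norm)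
  define f where "f x = max 0 (\<rho> / 4 - dist x x0)" for x
  have f: "f \<in> V"
  proof (rule Lipschitz_in_V)
    show "\<bar>f x - f y\<bar> \<le> norm (x - y)" for x y
      using dist_triangle[of x x0 y] dist_triangle[of y x0 x] dist_commute[of x y]
      unfolding f_def dist_norm[of x y, symmetric] by (auto simp: max_def)
    show "f x = 0" if "x \<notin> \<Omega>" for x
    proof -
      have "\<rho> \<le> dist x x0" using that \<rho> by (auto simp: dist_commute not_less)
      then show ?thesis using \<rho> by (simp add: f_def)
    qed
  qed
  have "0 < L2 (\<lambda>x. f x - c * \<phi> x) (\<lambda>x. f x - c * \<phi> x)" for c
  proof (rule ccontr)
    assume n: "\<not> ?thesis"
    have V: "(\<lambda>x. f x - c * \<phi> x) \<in> V" by (rule A.closed(2)[OF f A.closed(3)[OF \<phi>]])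
    have "L2 (\<lambda>x. f x - c * \<phi> x) (\<lambda>x. f x - c * \<phi> x) = 0" using n B.nonneg[OF V] by linarith
    then have ae: "AE x in lebesgue. f x - c * \<phi> x = 0" using L2_zero_iff[OF V] by blast
    with pos have ae2: "AE x in lebesgue. f x = c * \<phi> x \<and> (x \<in> \<Omega> \<longrightarrow> 0 < \<phi> x)"
      by eventually_elim simp
    obtain y where y: "y \<in> ball x1 (\<rho> / 4)" "f y = c * \<phi> y" "y \<in> \<Omega> \<longrightarrow> 0 < \<phi> y"
      using AE_ex_ball[OF ae2, of "\<rho> / 4" x1] \<rho> by auto
    have dy: "\<rho> / 4 < dist y x0" "dist y x0 < \<rho>"
      using y(1) d dist_triangle[of x1 x0 y] dist_triangle[of y x0 x1] by (auto simp: dist_commute)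
    have "y \<in> \<Omega>" using dy \<rho> by (auto simp: dist_commute)
    then have c: "c = 0" using y dy by (simp add: f_def)
    obtain z where z: "z \<in> ball x0 (\<rho> / 4)" "f z = c * \<phi> z"
      using AE_ex_ball[OF ae2, of "\<rho> / 4" x0] \<rho> by auto
    then show False using c by (simp add: f_def dist_commute)
  qed
  then show ?thesis using f by blast
qed

end

section \<open>The nonlocal Fucik spectrum\<close>

context nonlocal_form begin

lemma form_nonneg: "0 \<le> energy u u"
  unfolding form_sq by (rule Bochner_Integration.integral_nonneg) simp

lemma norm_sq: "(X0_norm K \<Omega> u)\<^sup>2 = energy u u"
  using form_nonneg by (simp add: norm_eq)

lemma L2_square: "(LINT x:\<Omega>|lebesgue. (u x)\<^sup>2) = L2 u u"
  by (simp add: L2_def power2_eq_square)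

lemma sphere_iff: "u \<in> unit_sphere K \<Omega> \<longleftrightarrow> u \<in> V \<and> L2 u u = 1"
  by (simp add: unit_sphere_def L2_square)

lemma lambda1_le:
  assumes u: "u \<in> V" shows "lambda1 K \<Omega> * L2 u u \<le> energy u u"
proof (cases "L2 u u = 0")
  case True
  then show ?thesis using form_nonneg by simp
next
  case False
  then have pos: "0 < L2 u u" using B.nonneg[OF u] by simp
  define w where "w = (\<lambda>x. u x / sqrt (L2 u u))"
  have w: "w \<in> V" unfolding w_def using u by simp
  have "L2 w w = 1" unfolding w_def using u pos by simp
  then have "lambda1 K \<Omega> \<le> (X0_norm K \<Omega> w)\<^sup>2"
    unfolding lambda1_def using w by (intro cINF_lower bdd_belowI2[of _ 0]) (auto simp: sphere_iff)
  also have "\<dots> = energy u u / L2 u u"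
    unfolding norm_sq w_def using u pos by simp
  finally show ?thesis using pos by (simp add: field_simps)
qed

lemma lambda1_pos:
  assumes "\<phi> \<in> unit_sphere K \<Omega>" shows "0 < lambda1 K \<Omega>"
proof -
  obtain c where c: "0 < c" "\<And>u. u \<in> V \<Longrightarrow> c * L2 u u \<le> energy u u" using Poincare by blast
  have "c \<le> lambda1 K \<Omega>"
    unfolding lambda1_def
  proof (rule cINF_greatest)
    fix u assume "u \<in> unit_sphere K \<Omega>"
    then show "c \<le> (X0_norm K \<Omega> u)\<^sup>2" using c(2)[of u] by (simp add: sphere_iff norm_sq)
  qed (use assms in blast)
  then show ?thesis using c by simp
qed

lemma L2_nonneg:
  assumes "AE x in lebesgue. 0 \<le> u x" "AE x in lebesgue. 0 \<le> v x" shows "0 \<le> L2 u v"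
  unfolding L2_eq
proof (rule integral_nonneg_AE)
  show "AE x in lebesgue. 0 \<le> R u x * R v x" using assms by eventually_elim (simp add: R_def)
qed

lemma eigenfunction_signed:
  assumes u: "u \<in> V" and eig: "\<And>v. v \<in> V \<Longrightarrow> energy u v = l * L2 u v" and l: "0 \<le> l"
    and nn: "AE x in lebesgue. 0 \<le> u x" and nz: "L2 u u \<noteq> 0"
  shows "AE x in lebesgue. x \<in> \<Omega> \<longrightarrow> 0 < u x"
proof (rule strong_maximum_principle[OF u nn])
  show "0 \<le> energy u v" if "v \<in> V" "AE x in lebesgue. 0 \<le> v x" for v
    using eig[OF that(1)] L2_nonneg[OF nn that(2)] l by simp
  show "\<not> (AE x in lebesgue. u x = 0)" using nz L2_zero_iff[OF u] by blast
qed

text \<open>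
  The property that needs an argument here is \<open>strong_maximum\<close>: a nonpositive eigenfunction \<open>u\<close> is
  negative in \<open>\<Omega>\<close>, and a nonnegative function whose product with it has nonnegative integral must
  vanish.
\<close>

lemma fucik_form_first_eigenfunction:
  assumes \<phi>: "first_eigenfunction K \<Omega> \<phi>"
  shows "fucik_form V energy L2 (lambda1 K \<Omega>) \<phi>"
proof (intro fucik_form.intro A.semi_inner_axioms B.semi_inner_axioms fucik_form_axioms.intro)
  let ?l = "lambda1 K \<Omega>"
  have \<phi>V: "\<phi> \<in> V" and eig: "\<And>v. v \<in> V \<Longrightarrow> energy \<phi> v = ?l * L2 \<phi> v"
    and nn: "AE x in lebesgue. 0 \<le> \<phi> x" and one: "L2 \<phi> \<phi> = 1"
    using \<phi> by (auto simp: first_eigenfunction_def L2_square L2_def)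
  show lp: "0 < ?l" by (rule lambda1_pos[of \<phi>]) (simp add: sphere_iff \<phi>V one)
  show "\<phi> \<in> V" by (rule \<phi>V)
  show "L2 \<phi> \<phi> = 1" by (rule one)
  show "energy \<phi> v = ?l * L2 \<phi> v" if "v \<in> V" for v by (rule eig[OF that])
  show "B.sqdist (pos_part \<phi>) \<phi> = 0"
  proof (subst L2_zero_iff)
    show "(\<lambda>x. pos_part \<phi> x - \<phi> x) \<in> V" by (rule A.closed(2)[OF pos_part_V[OF \<phi>V] \<phi>V])
    show "AE x in lebesgue. pos_part \<phi> x - \<phi> x = 0" using nn by eventually_elim (simp add: pos_part_def)
  qed
  show "\<exists>w\<in>V. \<forall>c. 0 < L2 (\<lambda>x. w x - c * \<phi> x) (\<lambda>x. w x - c * \<phi> x)"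
    by (rule independent_of_positive[OF \<phi>V eigenfunction_signed[OF \<phi>V eig]]) (use lp nn one in auto)
  show "\<exists>r w. strict_mono (r :: nat \<Rightarrow> nat) \<and> w \<in> V \<and> energy w w \<le> C \<and>
      (\<lambda>n. B.sqdist (u (r n)) w) \<longlonglongrightarrow> 0"
    if "\<And>n. u n \<in> V" "\<And>n. energy (u n) (u n) \<le> C" for u C
    by (rule compact_embedding_V[OF that])
  fix u w assume u: "u \<in> V" and ue: "\<And>v. v \<in> V \<Longrightarrow> energy u v = ?l * L2 u v"
    and up: "L2 (pos_part u) (pos_part u) = 0" and nz: "L2 u u \<noteq> 0" and w: "w \<in> V"
    and uw: "0 \<le> L2 u (pos_part w)"
  define U where "U = (\<lambda>x. - u x)"
  have U: "U \<in> V" unfolding U_def by (rule A.closed(4)[OF u])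
  have "AE x in lebesgue. pos_part u x = 0" using up L2_zero_iff[OF pos_part_V[OF u]] by simp
  then have Unn: "AE x in lebesgue. 0 \<le> U x"
    by eventually_elim (simp add: U_def pos_part_def max_def split: if_splits)
  have UL: "L2 U v = - L2 u v" "energy U v = - energy u v" if "v \<in> V" for v
    unfolding U_def using u that by simp_all
  have "AE x in lebesgue. x \<in> \<Omega> \<longrightarrow> 0 < U x"
  proof (rule eigenfunction_signed[OF U _ _ Unn])
    show "energy U v = ?l * L2 U v" if "v \<in> V" for v using ue[OF that] UL[OF that] by simp
    show "0 \<le> ?l" using lp by simp
    show "L2 U U \<noteq> 0" using nz u UL[OF U] by (simp add: U_def)
  qed
  moreover have "AE x in lebesgue. R U x * R (pos_part w) x = 0"
  proof -
    have pw: "pos_part w \<in> V" by (rule pos_part_V[OF w])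
    have "AE x in lebesgue. 0 \<le> R U x * R (pos_part w) x"
      using Unn by eventually_elim (simp add: R_def pos_part_def)
    moreover have "(\<integral>x. R U x * R (pos_part w) x \<partial>lebesgue) = 0"
    proof -
      have "AE x in lebesgue. 0 \<le> pos_part w x" by (simp add: pos_part_def)
      then have "0 \<le> L2 U (pos_part w)" by (rule L2_nonneg[OF Unn])
      then show ?thesis using uw UL(1)[OF pw] by (simp add: L2_eq)
    qed
    ultimately show ?thesis using integral_nonneg_eq_0_iff_AE[OF RR_integrable[OF U pw]] by simp
  qed
  ultimately have "AE x in lebesgue. pos_part w x = 0"
    using V_D(2)[OF pos_part_V[OF w]]
    by eventually_elim (auto simp: R_def indicator_def split: if_splits)
  then show "L2 (pos_part w) (pos_part w) = 0" using L2_zero_iff[OF pos_part_V[OF w]] by simp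
qed (auto intro: pos_part_V lambda1_le form_null form_pos_part L2_pos_part L2_pos_part_Lipschitz L2_pos_part_convex
    simp del: A.linear_left A.linear_right B.linear_left B.linear_right)

end

theorem theorem3p4:
  fixes s p :: real
    and \<Omega> :: "(real ^ 'n) set"
    and K :: "real ^ 'n \<Rightarrow> real"
    and \<phi>\<^sub>1 :: "real ^ 'n \<Rightarrow> real"
  assumes "0 < s" and "s < 1" and "real CARD('n) > 2 * s"
    and "bounded_lipschitz_domain \<Omega>"
    and "admissible_kernel s K"
    and "first_eigenfunction K \<Omega> \<phi>\<^sub>1"
    and "p \<ge> 0"
  shows "(p + minimax_level K \<Omega> \<phi>\<^sub>1 p, minimax_level K \<Omega> \<phi>\<^sub>1 p) \<in> fucik_spectrum K \<Omega> \<and>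
         (p + minimax_level K \<Omega> \<phi>\<^sub>1 p, minimax_level K \<Omega> \<phi>\<^sub>1 p) \<notin> trivial_lines K \<Omega> \<and>
         (\<forall>t::real. (p + t, t) \<in> fucik_spectrum K \<Omega> \<and> (p + t, t) \<notin> trivial_lines K \<Omega> \<longrightarrow>
            minimax_level K \<Omega> \<phi>\<^sub>1 p \<le> t)"
proof -
  interpret N: nonlocal_form K \<Omega> s
    using assms by unfold_locales (auto simp: bounded_lipschitz_domain_def)
  interpret F: fucik_form N.V "X0_form K \<Omega>" N.L2 "lambda1 K \<Omega>" \<phi>\<^sub>1
    by (rule N.fucik_form_first_eigenfunction[OF assms(6)])
  have J: "J_fun K \<Omega> p = F.J p"
    by (rule ext) (simp add: J_fun_def F.J_def N.norm_sq N.L2_square)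
  have paths: "sphere_paths K \<Omega> \<phi>\<^sub>1 = F.paths"
  proof (rule set_eqI)
    fix \<gamma> :: "real \<Rightarrow> real ^ 'n \<Rightarrow> real"
    have cont: "((\<lambda>r. X0_norm K \<Omega> (\<lambda>x. \<gamma> r x - \<gamma> t x)) \<longlongrightarrow> 0) (at t within {-1..1}) \<longleftrightarrow>
        ((\<lambda>r. X0_form K \<Omega> (\<lambda>x. \<gamma> r x - \<gamma> t x) (\<lambda>x. \<gamma> r x - \<gamma> t x)) \<longlongrightarrow> 0) (at t within {-1..1})" for t
    proof
      assume "((\<lambda>r. X0_norm K \<Omega> (\<lambda>x. \<gamma> r x - \<gamma> t x)) \<longlongrightarrow> 0) (at t within {-1..1})"
      from tendsto_power[OF this, of 2]
      show "((\<lambda>r. X0_form K \<Omega> (\<lambda>x. \<gamma> r x - \<gamma> t x) (\<lambda>x. \<gamma> r x - \<gamma> t x)) \<longlongrightarrow> 0) (at t within {-1..1})"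
        unfolding N.norm_sq by simp
    next
      assume "((\<lambda>r. X0_form K \<Omega> (\<lambda>x. \<gamma> r x - \<gamma> t x) (\<lambda>x. \<gamma> r x - \<gamma> t x)) \<longlongrightarrow> 0) (at t within {-1..1})"
      from tendsto_real_sqrt[OF this]
      show "((\<lambda>r. X0_norm K \<Omega> (\<lambda>x. \<gamma> r x - \<gamma> t x)) \<longlongrightarrow> 0) (at t within {-1..1})"
        unfolding N.norm_eq by simp
    qed
    have ends: "(AE x in lebesgue. \<gamma> (-1) x = - \<phi>\<^sub>1 x) \<longleftrightarrow>
        N.L2 (\<lambda>x. \<gamma> (-1) x + \<phi>\<^sub>1 x) (\<lambda>x. \<gamma> (-1) x + \<phi>\<^sub>1 x) = 0" if "\<gamma> (-1) \<in> N.V"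
      using N.L2_zero_iff[OF N.A.closed(1)[OF that F.\<phi>_in]] by (simp only: eq_neg_iff_add_eq_0)
    have ends': "(AE x in lebesgue. \<gamma> 1 x = \<phi>\<^sub>1 x) \<longleftrightarrow>
        N.L2 (\<lambda>x. \<gamma> 1 x - \<phi>\<^sub>1 x) (\<lambda>x. \<gamma> 1 x - \<phi>\<^sub>1 x) = 0" if "\<gamma> 1 \<in> N.V"
      using N.L2_zero_iff[OF N.A.closed(2)[OF that F.\<phi>_in]] by (simp only: right_minus_eq)
    have mem: "-1 \<in> {-1..1::real}" "1 \<in> {-1..1::real}" by auto
    show "\<gamma> \<in> sphere_paths K \<Omega> \<phi>\<^sub>1 \<longleftrightarrow> \<gamma> \<in> F.paths"
      unfolding sphere_paths_def F.paths_def F.curve_def N.sphere_iff cont mem_Collect_eq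
      using ends ends' mem by meson
  qed
  have lev: "minimax_level K \<Omega> \<phi>\<^sub>1 p = F.level p"
    by (simp only: minimax_level_def F.level_def paths J)
  have spec: "(p + t, t) \<in> fucik_spectrum K \<Omega> \<longleftrightarrow> (\<exists>u. F.resolves p t u u \<and> N.L2 u u \<noteq> 0)" for t
  proof -
    have "weak_solution K \<Omega> (p + t) t u \<longleftrightarrow> F.resolves p t u u" for u
    proof (cases "u \<in> N.V")
      case True
      have "neg_part u = (\<lambda>x. pos_part u x - u x)"
        by (rule ext) (simp add: neg_part_def pos_part_def max_def)
      then have neg: "N.L2 (neg_part u) v = N.L2 (pos_part u) v - N.L2 u v" if "v \<in> N.V" for v
        using N.B.linear_left(2)[OF N.pos_part_V[OF True] that True] by simp
      have "(p + t) * N.L2 (pos_part u) v - t * N.L2 (neg_part u) v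
          = p * N.L2 (pos_part u) v + t * N.L2 u v" if "v \<in> N.V" for v
        unfolding neg[OF that] by (simp add: algebra_simps)
      then show ?thesis
        using True unfolding weak_solution_def F.resolves_def N.L2_def[symmetric] by auto
    qed (simp add: weak_solution_def F.resolves_def)
    moreover have "F.resolves p t u u \<Longrightarrow> N.L2 u u \<noteq> 0 \<longleftrightarrow> \<not> (AE x in lebesgue. u x = 0)" for u
      using N.L2_zero_iff[of u] by (simp add: F.resolves_def)
    ultimately show ?thesis unfolding fucik_spectrum_def by auto
  qed
  have gt: "lambda1 K \<Omega> < F.level p" by (rule F.lam_less_level[OF assms(7)])
  show ?thesis
    unfolding lev
  proof (intro conjI allI impI)
    show "(p + F.level p, F.level p) \<in> fucik_spectrum K \<Omega>"
      unfolding spec using gt F.lam_pos by (intro F.level_solution assms) simp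
    show "(p + F.level p, F.level p) \<notin> trivial_lines K \<Omega>"
      using gt assms(7) by (auto simp: trivial_lines_def)
    fix t assume t: "(p + t, t) \<in> fucik_spectrum K \<Omega> \<and> (p + t, t) \<notin> trivial_lines K \<Omega>"
    then obtain u where u: "F.resolves p t u u" "N.L2 u u \<noteq> 0" by (auto simp: spec)
    have nt: "p + t \<noteq> lambda1 K \<Omega>" "t \<noteq> lambda1 K \<Omega>" using t by (auto simp: trivial_lines_def)
    have le: "lambda1 K \<Omega> \<le> t" by (rule F.lam_le_of_solution[OF u nt(1)])
    then have "0 \<le> t" using F.lam_pos by simp
    from F.level_le_solution[OF assms(7) le u(1) F.solution_independent_of_eigenfunction[OF assms(7) this u nt(2,1)]]
    show "F.level p \<le> t" .
  qed
qed

end
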